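(* Let $G$ be a topological group and let $X$ be a compact metric $G$-space. The following conditions are equivalent: (1) $(G,X)$ is a tame $G$-system. (2) $(G,X)$ is representable on a separable Rosenthal Banach space, that is, $(G,X)$ admits a faithful continuous representation on some separable Rosenthal Banach space.
   Context: Compact means compact Hausdorff. A $G$-space (or $G$-system) $X$, also written $(G,X)$, is a topological space $X$ with a (jointly) continuous action $G\times X\to X$ of the topological group $G$. Fragmented map: a (not necessarily continuous) function $f:X\to (Y,\mu)$ from a topological space $X$ to a uniform space is fragmented if for every nonempty $A\subset X$ and every entourage $\varepsilon\in\mu$ there is an open $O\subset X$ such that $O\cap A\neq\emptyset$ and $f(O\cap A)$ is $\varepsilon$-small (i.e. $f(O\cap A)\times f(O\cap A)\subset\varepsilon$). A compact space carries its unique compatible uniformity. The enveloping semigroup $E(X)$ of a compact $G$-space $X$ is the closure in $X^X$ (pointwise topology) of the set of translations $\{x\mapsto gx\}_{g\in G}$. A compact $G$-space $X$ is tame if every $p\in E(X)$ is a fragmented map $p:X\to X$. Banach spaces are real. A Banach space is a Rosenthal space if it does not contain an isomorphic copy of $l_1$. $\mathrm{Iso}(V)$ is the topological group of linear isometries of the Banach space $V$ onto itself with the topology of pointwise convergence. A continuous representation of $(G,X)$ on $V$ is a pair $(h,\alpha)$, where $h:G\to \mathrm{Iso}(V)$ is a continuous co-homomorphism ($h(g_1g_2)=h(g_2)h(g_1)$) and $\alpha:X\to V^*$ is a weak$^*$ continuous bounded $G$-map with respect to the dual action $(g\varphi)(v):=\varphi(h(g)(v))$ of $G$ on $V^*$.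 It is faithful if $\alpha$ is a topological embedding (into $V^*$ with the weak$^*$ topology). *)

theory Defs
  imports "HOL-Analysis.Analysis" "HOL-Algebra.Module" "HOL-Algebra.Group_Action"
begin

section \<open>Real normed spaces on explicit carriers\<close>

text \<open>
  HOL cannot quantify existentially over types, so Banach spaces are modules over the ring of
  real numbers in the sense of HOL-Algebra, on an explicit carrier, together with a norm.  The
  inherited ring fields \<open>mult\<close> and \<open>one\<close> of such a record are never used.
\<close>

definition real_ring :: "real ring"
  where "real_ring = \<lparr>carrier = UNIV, mult = (*), one = 1, zero = 0, add = (+)\<rparr>"

lemma cring_real_ring: "cring real_ring"
  by (unfold_locales)
    (auto simp: real_ring_def Units_def algebra_simps intro: exI[of _ "- _"] add.right_inverse)

record 'v normed_module = "(real, 'v) module" +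
  vnorm :: "'v \<Rightarrow> real"

locale real_normed_space = module real_ring V
  for V :: "('v, 'm) normed_module_scheme" (structure) +
  assumes vnorm_eq_zero: "v \<in> carrier V \<Longrightarrow> vnorm V v = 0 \<Longrightarrow> v = \<zero>"
    and vnorm_smult: "v \<in> carrier V \<Longrightarrow> vnorm V (a \<odot> v) = \<bar>a\<bar> * vnorm V v"
    and vnorm_triangle:
      "v \<in> carrier V \<Longrightarrow> w \<in> carrier V \<Longrightarrow> vnorm V (v \<oplus> w) \<le> vnorm V v + vnorm V w"

text \<open>
  The value \<open>0\<close> outside the carrier is needed because \<^locale>\<open>Metric_space\<close> demands nonnegativity
  and symmetry on the whole type.
\<close>

definition vdist :: "('v, 'm) normed_module_scheme \<Rightarrow> 'v \<Rightarrow> 'v \<Rightarrow> real"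
  where "vdist V v w =
    (if v \<in> carrier V \<and> w \<in> carrier V then vnorm V (v \<ominus>\<^bsub>V\<^esub> w) else 0)"

definition norm_topology :: "('v, 'm) normed_module_scheme \<Rightarrow> 'v topology"
  where "norm_topology V = Metric_space.mtopology (carrier V) (vdist V)"

definition banach_space :: "('v, 'm) normed_module_scheme \<Rightarrow> bool"
  where "banach_space V \<longleftrightarrow>
    real_normed_space V \<and> Metric_space.mcomplete (carrier V) (vdist V)"

definition linear_operator ::
    "('v, 'm) normed_module_scheme \<Rightarrow> ('w, 'k) normed_module_scheme \<Rightarrow> ('v \<Rightarrow> 'w) \<Rightarrow> bool"
  where "linear_operator V W S \<longleftrightarrow>
    S \<in> carrier V \<rightarrow> carrier W \<and>
    (\<forall>v\<in>carrier V. \<forall>w\<in>carrier V. S (v \<oplus>\<^bsub>V\<^esub> w) = S v \<oplus>\<^bsub>W\<^esub> S w) \<and>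
    (\<forall>a. \<forall>v\<in>carrier V. S (a \<odot>\<^bsub>V\<^esub> v) = a \<odot>\<^bsub>W\<^esub> S v)"

lemma (in real_normed_space) real_smult_closed: "v \<in> carrier V \<Longrightarrow> a \<odot> v \<in> carrier V"
  by (simp add: real_ring_def)

lemma (in real_normed_space) vnorm_zero: "vnorm V \<zero> = 0"
proof -
  have "(0::real) \<odot> \<zero> = \<zero>"
    using smult_r_null[of 0] by (simp add: real_ring_def)
  then show ?thesis
    using vnorm_smult[of \<zero> 0] by simp
qed

lemma (in real_normed_space) vnorm_minus:
  assumes "v \<in> carrier V" shows "vnorm V (\<ominus> v) = vnorm V v"
proof -
  have "(0::real) \<odot> v = \<zero>"
    using smult_l_null[OF assms] by (simp add: real_ring_def)
  moreover have "(1::real) \<odot> v = v"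
    using smult_one[OF assms] by (simp add: real_ring_def)
  ultimately have "(-1::real) \<odot> v \<oplus> v = \<zero>"
    using smult_l_distr[of "-1" 1 v] assms by (simp add: real_ring_def)
  then have "(-1::real) \<odot> v = \<ominus> v"
    using M.minus_equality real_smult_closed assms by metis
  then show ?thesis
    using vnorm_smult[OF assms, of "-1"] by simp
qed

lemma (in real_normed_space) vnorm_nonneg:
  assumes "v \<in> carrier V" shows "0 \<le> vnorm V v"
  using vnorm_triangle[of v "\<ominus> v"] vnorm_minus[OF assms] vnorm_zero assms
  by (simp add: M.r_neg)

lemma (in real_normed_space) Metric_space_vdist: "Metric_space (carrier V) (vdist V)"
proof
  fix x y
  show "0 \<le> vdist V x y"
    by (simp add: vdist_def vnorm_nonneg)
  have "\<ominus> (x \<ominus> y) = y \<ominus> x" if "x \<in> carrier V" "y \<in> carrier V"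
    using that by (simp only: a_minus_def M.minus_add M.a_inv_closed M.minus_minus M.a_comm)
  then show "vdist V x y = vdist V y x"
    using vnorm_minus[of "x \<ominus> y"] M.minus_closed[of x y] by (metis vdist_def)
next
  fix x y assume xy: "x \<in> carrier V" "y \<in> carrier V"
  have "x = y" if "x \<ominus> y = \<zero>"
    using that xy M.minus_equality[of x "\<ominus> y"] by (metis M.a_inv_closed M.minus_minus a_minus_def)
  moreover have "x \<ominus> x = \<zero>"
    using xy by (simp only: a_minus_def M.r_neg)
  ultimately show "vdist V x y = 0 \<longleftrightarrow> x = y"
    using xy vnorm_eq_zero[of "x \<ominus> y"] vnorm_zero M.minus_closed[of x y]
    by (metis vdist_def)
next
  fix x y z assume xyz: "x \<in> carrier V" "y \<in> carrier V" "z \<in> carrier V"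
  have "(x \<ominus> y) \<oplus> (y \<ominus> z) = x \<ominus> z"
    using xyz by (simp add: a_minus_def M.a_assoc M.r_neg1 M.r_neg2)
  then show "vdist V x z \<le> vdist V x y + vdist V y z"
    using xyz vnorm_triangle[of "x \<ominus> y" "y \<ominus> z"] by (simp add: vdist_def)
qed


section \<open>Rosenthal spaces\<close>

definition l1_space :: "(nat \<Rightarrow> real) normed_module"
  where "l1_space =
    \<lparr>carrier = {a. summable (\<lambda>n. \<bar>a n\<bar>)}, mult = undefined, one = undefined,
     zero = (\<lambda>n. 0), add = (\<lambda>a b n. a n + b n), smult = (\<lambda>c a n. c * a n),
     vnorm = (\<lambda>a. \<Sum>n. \<bar>a n\<bar>)\<rparr>"

lemma real_normed_space_l1_space: "real_normed_space l1_space"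
proof -
  have add: "summable (\<lambda>n. \<bar>a n + b n\<bar>)"
    if "summable (\<lambda>n. \<bar>a n\<bar>)" "summable (\<lambda>n. \<bar>b n\<bar>)" for a b :: "nat \<Rightarrow> real"
    by (rule summable_comparison_test'[OF summable_add[OF that]]) auto
  have smult: "summable (\<lambda>n. \<bar>c * a n\<bar>)"
    if "summable (\<lambda>n. \<bar>a n\<bar>)" for a :: "nat \<Rightarrow> real" and c
    using summable_mult[OF that, of "\<bar>c\<bar>"] by (simp add: abs_mult)
  interpret cring real_ring
    by (rule cring_real_ring)
  have "abelian_group (l1_space :: (nat \<Rightarrow> real) normed_module)"
  proof (rule abelian_groupI)
    fix a :: "nat \<Rightarrow> real" assume "a \<in> carrier l1_space"
    then show "\<exists>b\<in>carrier l1_space. b \<oplus>\<^bsub>l1_space\<^esub> a = \<zero>\<^bsub>l1_space\<^esub>"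
      by (intro bexI[of _ "\<lambda>n. - a n"]) (auto simp: l1_space_def)
  qed (auto simp: l1_space_def algebra_simps intro: add)
  then have "module real_ring (l1_space :: (nat \<Rightarrow> real) normed_module)"
    by (intro module.intro cring_real_ring module_axioms.intro)
      (auto simp: l1_space_def real_ring_def algebra_simps intro: smult)
  moreover have "real_normed_space_axioms (l1_space :: (nat \<Rightarrow> real) normed_module)"
  proof
    fix a :: "nat \<Rightarrow> real"
    assume "a \<in> carrier l1_space" "vnorm l1_space a = 0"
    then show "a = \<zero>\<^bsub>l1_space\<^esub>"
      by (auto simp: l1_space_def suminf_eq_zero_iff)
  next
    fix a :: "nat \<Rightarrow> real" and c
    assume "a \<in> carrier l1_space"
    then show "vnorm l1_space (c \<odot>\<^bsub>l1_space\<^esub> a) = \<bar>c\<bar> * vnorm l1_space a"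
      by (simp add: l1_space_def abs_mult suminf_mult)
  next
    fix a b :: "nat \<Rightarrow> real"
    assume ab: "a \<in> carrier l1_space" "b \<in> carrier l1_space"
    then have "(\<Sum>n. \<bar>a n + b n\<bar>) \<le> (\<Sum>n. \<bar>a n\<bar> + \<bar>b n\<bar>)"
      by (intro suminf_le summable_add add) (auto simp: l1_space_def)
    also have "\<dots> = (\<Sum>n. \<bar>a n\<bar>) + (\<Sum>n. \<bar>b n\<bar>)"
      using ab by (intro suminf_add[symmetric]) (auto simp: l1_space_def)
    finally show "vnorm l1_space (a \<oplus>\<^bsub>l1_space\<^esub> b) \<le> vnorm l1_space a + vnorm l1_space b"
      by (simp add: l1_space_def)
  qed
  ultimately show ?thesis
    by (rule real_normed_space.intro)
qed

definition contains_isomorphic_copy ::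
    "('v, 'm) normed_module_scheme \<Rightarrow> ('w, 'k) normed_module_scheme \<Rightarrow> bool"
  where "contains_isomorphic_copy V W \<longleftrightarrow>
    (\<exists>S. linear_operator W V S \<and> embedding_map (norm_topology W) (norm_topology V) S)"

definition rosenthal_space :: "('v, 'm) normed_module_scheme \<Rightarrow> bool"
  where "rosenthal_space V \<longleftrightarrow> banach_space V \<and> \<not> contains_isomorphic_copy V l1_space"


section \<open>Dual space and isometry group\<close>

text \<open>
  Functionals and isometries are extensional functions (equal to \<^const>\<open>undefined\<close> off the
  carrier), so that they are points of product spaces.
\<close>

definition dual_space :: "('v, 'm) normed_module_scheme \<Rightarrow> ('v \<Rightarrow> real) set"
  where "dual_space V = {f \<in> extensional (carrier V).
    (\<forall>v\<in>carrier V. \<forall>w\<in>carrier V. f (v \<oplus>\<^bsub>V\<^esub> w) = f v + f w) \<and>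
    (\<forall>a. \<forall>v\<in>carrier V. f (a \<odot>\<^bsub>V\<^esub> v) = a * f v) \<and>
    continuous_map (norm_topology V) euclideanreal f}"

definition weak_star_topology :: "('v, 'm) normed_module_scheme \<Rightarrow> ('v \<Rightarrow> real) topology"
  where "weak_star_topology V =
    subtopology (product_topology (\<lambda>_. euclideanreal) (carrier V)) (dual_space V)"

definition norm_bounded_functionals ::
    "('v, 'm) normed_module_scheme \<Rightarrow> ('v \<Rightarrow> real) set \<Rightarrow> bool"
  where "norm_bounded_functionals V F \<longleftrightarrow>
    (\<exists>C. \<forall>f\<in>F. \<forall>v\<in>carrier V. \<bar>f v\<bar> \<le> C * vnorm V v)"

definition linear_isometries :: "('v, 'm) normed_module_scheme \<Rightarrow> ('v \<Rightarrow> 'v) set"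
  where "linear_isometries V = {S \<in> extensional (carrier V).
    linear_operator V V S \<and> S ` carrier V = carrier V \<and>
    (\<forall>v\<in>carrier V. vnorm V (S v) = vnorm V v)}"

text \<open>The topology of pointwise convergence.\<close>

definition isometry_topology :: "('v, 'm) normed_module_scheme \<Rightarrow> ('v \<Rightarrow> 'v) topology"
  where "isometry_topology V =
    subtopology (product_topology (\<lambda>_. norm_topology V) (carrier V)) (linear_isometries V)"


section \<open>Dynamical systems\<close>

locale topological_group = group G
  for G :: "('g, 'm) monoid_scheme" (structure) and T :: "'g topology" +
  assumes topspace_eq: "topspace T = carrier G"
    and continuous_mult: "continuous_map (prod_topology T T) T (\<lambda>(g, h). g \<otimes> h)"
    and continuous_inv: "continuous_map T T (\<lambda>g. inv\<^bsub>G\<^esub> g)"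

text \<open>
  In \<^locale>\<open>group_action\<close> each translation \<open>\<phi> g\<close> is an extensional bijection of \<open>X\<close>.
\<close>

definition G_space ::
    "('g, 'm) monoid_scheme \<Rightarrow> 'g topology \<Rightarrow> 'x::topological_space set \<Rightarrow> ('g \<Rightarrow> 'x \<Rightarrow> 'x) \<Rightarrow> bool"
  where "G_space G T X \<phi> \<longleftrightarrow>
    group_action G X \<phi> \<and>
    continuous_map (prod_topology T (top_of_set X)) (top_of_set X) (\<lambda>(g, x). \<phi> g x)"

definition fragmented_map ::
    "'x::topological_space set \<Rightarrow> ('x \<Rightarrow> 'y::uniform_space) \<Rightarrow> bool"
  where "fragmented_map X f \<longleftrightarrow>
    (\<forall>A E. A \<subseteq> X \<and> A \<noteq> {} \<and> eventually E uniformity \<longrightarrow>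
      (\<exists>U. openin (top_of_set X) U \<and> U \<inter> A \<noteq> {} \<and>
        (\<forall>y\<in>f ` (U \<inter> A). \<forall>z\<in>f ` (U \<inter> A). E (y, z))))"

definition enveloping_semigroup ::
    "('g, 'm) monoid_scheme \<Rightarrow> 'x::topological_space set \<Rightarrow> ('g \<Rightarrow> 'x \<Rightarrow> 'x) \<Rightarrow> ('x \<Rightarrow> 'x) set"
  where "enveloping_semigroup G X \<phi> =
    product_topology (\<lambda>_. top_of_set X) X closure_of (\<phi> ` carrier G)"

text \<open>
  For compact \<open>X\<close> the unique compatible uniformity is the one induced by the ambient uniform
  space; its entourages are the traces on \<open>X \<times> X\<close> of the ambient ones.
\<close>

definition tame_system ::
    "('g, 'm) monoid_scheme \<Rightarrow> 'x::uniform_space set \<Rightarrow> ('g \<Rightarrow> 'x \<Rightarrow> 'x) \<Rightarrow> bool"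
  where "tame_system G X \<phi> \<longleftrightarrow> (\<forall>p\<in>enveloping_semigroup G X \<phi>. fragmented_map X p)"


section \<open>Representations\<close>

definition continuous_representation ::
    "('g, 'm) monoid_scheme \<Rightarrow> 'g topology \<Rightarrow> 'x::topological_space set \<Rightarrow> ('g \<Rightarrow> 'x \<Rightarrow> 'x) \<Rightarrow>
     ('v, 'k) normed_module_scheme \<Rightarrow> ('g \<Rightarrow> 'v \<Rightarrow> 'v) \<Rightarrow> ('x \<Rightarrow> 'v \<Rightarrow> real) \<Rightarrow> bool"
  where "continuous_representation G T X \<phi> V h \<alpha> \<longleftrightarrow>
    continuous_map T (isometry_topology V) h \<and>
    (\<forall>g1\<in>carrier G. \<forall>g2\<in>carrier G. h (g1 \<otimes>\<^bsub>G\<^esub> g2) = compose (carrier V) (h g2) (h g1)) \<and>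
    continuous_map (top_of_set X) (weak_star_topology V) \<alpha> \<and>
    norm_bounded_functionals V (\<alpha> ` X) \<and>
    (\<forall>g\<in>carrier G. \<forall>x\<in>X. \<forall>v\<in>carrier V. \<alpha> (\<phi> g x) v = \<alpha> x (h g v))"

definition faithfully_representable_on ::
    "('g, 'm) monoid_scheme \<Rightarrow> 'g topology \<Rightarrow> 'x::topological_space set \<Rightarrow> ('g \<Rightarrow> 'x \<Rightarrow> 'x) \<Rightarrow>
     ('v, 'k) normed_module_scheme \<Rightarrow> bool"
  where "faithfully_representable_on G T X \<phi> V \<longleftrightarrow>
    (\<exists>h \<alpha>. continuous_representation G T X \<phi> V h \<alpha> \<and>
      embedding_map (top_of_set X) (weak_star_topology V) \<alpha>)"

text \<open>
  A separable Banach space \<open>V\<close> with dense sequence \<open>d\<close> injects into \<^typ>\<open>nat \<Rightarrow> real\<close> by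
  \<open>v \<mapsto> (\<lambda>n. \<parallel>v - d n\<parallel>)\<close>, so up to isometric isomorphism every separable Banach space has its
  carrier inside this type.  An existential statement about separable Banach spaces therefore loses
  nothing by ranging over \<^typ>\<open>(nat \<Rightarrow> real) normed_module\<close>.
\<close>

definition separable_rosenthal_representation_space ::
    "('g, 'm) monoid_scheme \<Rightarrow> 'g topology \<Rightarrow> 'x::topological_space set \<Rightarrow> ('g \<Rightarrow> 'x \<Rightarrow> 'x) \<Rightarrow>
     ('v, 'k) normed_module_scheme \<Rightarrow> bool"
  where "separable_rosenthal_representation_space G T X \<phi> V \<longleftrightarrow>
    rosenthal_space V \<and> separable_space (norm_topology V) \<and>
    faithfully_representable_on G T X \<phi> V"

end

theory Submission
  imports Defs "HOL-Probability.Probability" "HOL-Library.Diagonal_Subsequence"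
begin

text \<open>
  Both directions rest on independent sequences: \<open>f n\<close> on \<open>X\<close> such that, for some \<open>a < b\<close>, every
  pattern of conditions \<open>f n \<le> a\<close> and \<open>b \<le> f n\<close> on finitely many indices is realised at a point.

  If \<open>p\<close> in the enveloping semigroup of a represented system is not fragmented, then neither is
  \<open>x \<mapsto> \<alpha> (p x) v\<close> for some \<open>v\<close>; approximating \<open>p\<close> by translations on finite sets gives
  \<open>g n\<close> such that the functions \<open>x \<mapsto> \<alpha> x (h (g n) v)\<close> are independent, and then the vectors
  \<open>h (g n) v\<close> span a copy of \<open>\<ell>\<^sub>1\<close>.

  Conversely, let \<open>F\<close> be the set of functions \<open>x \<mapsto> dist (\<phi> g x) y\<close> on a tame system.  A cluster point
  of translations producing an independent sequence would not be fragmented, so by Rosenthal's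
  dichotomy every sequence in \<open>F\<close> has a pointwise convergent subsequence.  Then the absolutely convex
  hull of \<open>F\<close> contains no \<open>\<ell>\<^sub>1\<close>-sequence for the supremum norm: such a sequence has an independent
  subsequence by Simons' inequality and Rosenthal's dichotomy, and testing it against Rademacher
  functions along a random point of \<open>X\<close> produces a sequence in \<open>F\<close> contradicting Bessel's inequality.
  The interpolation space of Davis, Figiel, Johnson and Pelczynski built from \<open>F\<close> therefore contains
  no copy of \<open>\<ell>\<^sub>1\<close>.  Since \<open>F\<close> is invariant, \<open>G\<close> acts on this space by isometries, and the point
  evaluations embed \<open>X\<close> into its dual.
\<close>

text \<open>The delicate point is the passage from F to its absolutely convex hull. The space is
  built from the hull, whereas tameness concerns F only, and convergent subsequences in F say
  nothing directly about combinations whose lengths are unbounded. Correlation with a fixed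
  Rademacher function is linear, so if a combination of weight at most 1 has a large correlation,
  some single member of F has one of comparable size; this leads back to one sequence in F.
  Correlations require a measure, and a measurable choice of a point of X for each sign pattern
  carries the coin-tossing measure to X.

  Simons' inequality takes the place of the usual route through Riesz representation, dominated
  convergence and Mazur's theorem, by which a bounded pointwise null sequence of continuous
  functions has convex combinations of small supremum norm. The resulting argument stays with point
  values of continuous functions.

  In the interpolation space, a copy of l1 could in principle live on the infinitely many
  coordinates of the sum rather than in the supremum norm. A gliding hump excludes this: on some
  tail of the basis, the lower l1-estimate already holds for the supremum norm.\<close>

section \<open>Rosenthal's dichotomy\<close>

definition separated_on :: "(nat \<Rightarrow> 'a set) \<Rightarrow> (nat \<Rightarrow> 'a set) \<Rightarrow> nat set \<Rightarrow> 'a set \<Rightarrow> bool"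
  where "separated_on A B L S \<longleftrightarrow> (\<forall>x\<in>S. finite {n\<in>L. x \<in> A n} \<or> finite {n\<in>L. x \<in> B n})"

text \<open>Non-separation is required hereditarily: the constructions below keep thinning out the
  index set, and a mere failure of \<open>separated_on\<close> along M could disappear on a subset
  of M.\<close>

definition oscillating_on :: "(nat \<Rightarrow> 'a set) \<Rightarrow> (nat \<Rightarrow> 'a set) \<Rightarrow> nat set \<Rightarrow> 'a set \<Rightarrow> bool"
  where "oscillating_on A B M S \<longleftrightarrow> (\<forall>L\<subseteq>M. infinite L \<longrightarrow> \<not> separated_on A B L S)"

text \<open>Separation only distinguishes finite from infinite index sets, so finitely many
  exceptional indices are harmless. Diagonal arguments rely on this.\<close>

lemma separated_on_almost_subset:
  assumes "separated_on A B L S" "finite (L' - L)"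
  shows "separated_on A B L' S"
proof -
  have "finite {n \<in> L'. x \<in> C n}" if "finite {n \<in> L. x \<in> C n}" for x and C :: "nat \<Rightarrow> 'a set"
    by (rule finite_subset[of _ "{n \<in> L. x \<in> C n} \<union> (L' - L)"]) (use that assms(2) in auto)
  with assms(1) show ?thesis
    unfolding separated_on_def by blast
qed

lemma oscillating_on_subset:
  "oscillating_on A B M S \<Longrightarrow> M' \<subseteq> M \<Longrightarrow> oscillating_on A B M' S"
  by (auto simp: oscillating_on_def)

lemma oscillating_on_nonempty:
  "oscillating_on A B M S \<Longrightarrow> infinite M \<Longrightarrow> S \<noteq> {}"
  by (auto simp: oscillating_on_def separated_on_def)

text \<open>If every choice of n failed, one could pick indices m k one after another, each with a
  smaller infinite set on which some S intersected with one of the two sets at m k is separated. As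
  there are finitely many pairs of S and side, one pair recurs for infinitely many k, and these m k
  form an infinite set along which S itself is separated.\<close>

lemma oscillating_on_split:
  assumes fin: "finite \<S>" and M: "infinite M" and osc: "\<And>S. S \<in> \<S> \<Longrightarrow> oscillating_on A B M S"
  shows "\<exists>n\<in>M. \<exists>M'\<subseteq>M. infinite M' \<and>
    (\<forall>S\<in>\<S>. oscillating_on A B M' (S \<inter> A n) \<and> oscillating_on A B M' (S \<inter> B n))"
proof (rule ccontr)
  assume neg: "\<not> ?thesis"
  define C where "C side = (if side then A else B)" for side
  have step: "\<exists>L\<subseteq>M'. infinite L \<and> (\<exists>S\<in>\<S>. \<exists>side. separated_on A B L (S \<inter> C side n))"
    if M': "n \<in> M" "M' \<subseteq> M" "infinite M'" for n M'
  proof -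
    obtain S where S: "S \<in> \<S>"
      and no: "\<not> (oscillating_on A B M' (S \<inter> A n) \<and> oscillating_on A B M' (S \<inter> B n))"
      using neg M' by blast
    then obtain side where "\<not> oscillating_on A B M' (S \<inter> C side n)"
      unfolding C_def by (metis (full_types))
    then show ?thesis
      using S unfolding oscillating_on_def by blast
  qed
  define P where "P = (\<lambda>(_::nat) (L, n). L \<subseteq> M \<and> infinite L \<and> n \<in> M)"
  define Q where "Q = (\<lambda>(_::nat) (L, n) (L', n'). L' \<subseteq> L \<and> n' \<in> L \<and> n < n' \<and>
    L' \<subseteq> {n'<..} \<and> (\<exists>S\<in>\<S>. \<exists>side. separated_on A B L' (S \<inter> C side n')))"
  \<comment> \<open>This index only starts the recursion; the indices used later are the second
    components from stage 1 on.\<close>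
  obtain n0 where n0: "n0 \<in> M"
    using M by (metis finite.emptyI ex_in_conv)
  have "\<exists>\<sigma>. \<forall>k. P k (\<sigma> k) \<and> Q k (\<sigma> k) (\<sigma> (Suc k))"
  proof (rule dependent_nat_choice)
    show "\<exists>z. P 0 z"
      using n0 M by (auto simp: P_def)
    fix z k assume "P k z"
    then obtain L n where z: "z = (L, n)" "L \<subseteq> M" "infinite L"
      by (auto simp: P_def)
    obtain n' where n': "n' \<in> L" "n < n'"
      using z(3) by (meson infinite_nat_iff_unbounded)
    have "infinite (L \<inter> {n'<..})"
    proof
      assume "finite (L \<inter> {n'<..})"
      then have "finite (L \<inter> {n'<..} \<union> {..n'})" by simp
      moreover have "L \<subseteq> L \<inter> {n'<..} \<union> {..n'}" by auto
      ultimately show False using z(3) finite_subset by blast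
    qed
    moreover have "n' \<in> M" "L \<inter> {n'<..} \<subseteq> M" using n' z by auto
    ultimately have "\<exists>L'\<subseteq>L \<inter> {n'<..}. infinite L' \<and>
        (\<exists>S\<in>\<S>. \<exists>side. separated_on A B L' (S \<inter> C side n'))"
      by (intro step)
    then obtain L' where L': "L' \<subseteq> L \<inter> {n'<..}" "infinite L'"
      "\<exists>S\<in>\<S>. \<exists>side. separated_on A B L' (S \<inter> C side n')"
      by (elim exE conjE)
    then have "P (Suc k) (L', n') \<and> Q k z (L', n')"
      using z n' by (auto simp: P_def Q_def)
    then show "\<exists>z'. P (Suc k) z' \<and> Q k z z'" ..
  qed
  then obtain \<sigma> where \<sigma>: "\<And>k. P k (\<sigma> k)" "\<And>k. Q k (\<sigma> k) (\<sigma> (Suc k))"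
    by blast
  define L where "L k = fst (\<sigma> k)" for k
  define m where "m k = snd (\<sigma> (Suc k))" for k
  have L: "L (Suc k) \<subseteq> L k" "m k \<in> L k" "L (Suc k) \<subseteq> {m k<..}" "L k \<subseteq> M" "infinite (L k)"
    and ex: "\<exists>S\<in>\<S>. \<exists>side. separated_on A B (L (Suc k)) (S \<inter> C side (m k))" for k
    using \<sigma>(1)[of k] \<sigma>(2)[of k] by (auto simp: P_def Q_def L_def m_def split: prod.splits)
  have decr: "L j \<subseteq> L i" if "i \<le> j" for i j
    using that L(1) by (metis lift_Suc_antimono_le)
  have mono: "strict_mono m"
    unfolding strict_mono_Suc_iff using L(2,3) by blast
  obtain S side where sel: "\<And>k. S k \<in> \<S>" "\<And>k. separated_on A B (L (Suc k)) (S k \<inter> C (side k) (m k))"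
    using ex by metis
  have "finite (range (\<lambda>k. (S k, side k)))"
    by (rule finite_subset[of _ "\<S> \<times> UNIV"]) (use fin sel in auto)
  then obtain k0 where inf: "infinite {k. (S k, side k) = (S k0, side k0)}"
    using pigeonhole_infinite[of "UNIV::nat set" "\<lambda>k. (S k, side k)"] by auto
  define J where "J = {k. S k = S k0 \<and> side k = side k0}"
  have J: "infinite J" using inf by (simp add: J_def)
  define N where "N = m ` J"
  have "infinite N"
    unfolding N_def using J mono by (metis finite_imageD strict_mono_imp_inj_on)
  have N: "N \<subseteq> M" using L(2,4) by (auto simp: N_def)
  have sep: "separated_on A B N (S k0)"
    unfolding separated_on_def
  proof
    fix x assume x: "x \<in> S k0"
    show "finite {n \<in> N. x \<in> A n} \<or> finite {n \<in> N. x \<in> B n}"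
    \<comment> \<open>If x lies in the set selected at stage k, then \<open>L (Suc k)\<close>, which
      contains almost all of N, was chosen to separate there. Otherwise x avoids every set of that
      side along N, and one of the two index sets is empty.\<close>
    proof (cases "\<exists>k\<in>J. x \<in> C (side k0) (m k)")
      case True
      then obtain k where k: "k \<in> J" "x \<in> C (side k0) (m k)" by blast
      have "N - L (Suc k) \<subseteq> m ` {..k}"
        using L(2) decr unfolding N_def by (auto simp: not_less_eq_eq) (metis atMost_iff image_iff not_less_eq_eq subsetD)
      then have "finite (N - L (Suc k))"
        using finite_surj by blast
      then have "separated_on A B N (S k \<inter> C (side k) (m k))"
        using separated_on_almost_subset sel by blast
      then show ?thesis
        using k x by (auto simp: J_def separated_on_def)
    next
      case False
      then have "{n \<in> N. x \<in> C (side k0) n} = {}" by (auto simp: N_def)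
      then have "finite {n \<in> N. x \<in> C (side k0) n}" by (simp only: finite.emptyI)
      then show ?thesis unfolding C_def by (cases "side k0") (simp_all only: if_True if_False simp_thms)
    qed
  qed
  show False
    using osc[OF sel(1)[of k0]] \<open>infinite N\<close> N sep unfolding oscillating_on_def by blast
qed

text \<open>Splitting is applied to the finite family of all intersections that belong to patterns
  of length k. Each of them keeps oscillating on the current index set and is therefore nonempty, so
  every finite branch of the binary tree ends in a point of S.\<close>

lemma oscillating_on_imp_independent:
  assumes "oscillating_on A B M S" "infinite M"
  shows "\<exists>r. strict_mono (r :: nat \<Rightarrow> nat) \<and> range r \<subseteq> M \<and>
    (\<forall>N \<epsilon>. \<exists>x\<in>S. \<forall>j<N. x \<in> (if \<epsilon> j then A (r j) else B (r j)))"
proof -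
  define P where "P = (\<lambda>(k::nat) (\<S>, L, n::nat). finite \<S> \<and> L \<subseteq> M \<and> infinite L \<and>
    (\<forall>T\<in>\<S>. oscillating_on A B L T) \<and> (k = 0 \<longrightarrow> \<S> = {S}))"
  define Q where "Q = (\<lambda>(_::nat) (\<S>, L, n::nat) (\<S>', L', n'). L' \<subseteq> L \<and> n' \<in> L \<and> L' \<subseteq> {n'<..} \<and>
    \<S>' = (\<lambda>T. T \<inter> A n') ` \<S> \<union> (\<lambda>T. T \<inter> B n') ` \<S>)"
  have "\<exists>\<sigma>. \<forall>k. P k (\<sigma> k) \<and> Q k (\<sigma> k) (\<sigma> (Suc k))"
  proof (rule dependent_nat_choice)
    show "\<exists>z. P 0 z"
      by (rule exI[of _ "({S}, M, 0)"]) (use assms in \<open>auto simp: P_def\<close>)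
    fix z k assume "P k z"
    then obtain \<S> L n where z: "z = (\<S>, L, n)" "finite \<S>" "L \<subseteq> M" "infinite L"
      "\<And>T. T \<in> \<S> \<Longrightarrow> oscillating_on A B L T"
      by (auto simp: P_def)
    obtain n' L' where n': "n' \<in> L" "L' \<subseteq> L" "infinite L'"
      "\<And>T. T \<in> \<S> \<Longrightarrow> oscillating_on A B L' (T \<inter> A n')"
      "\<And>T. T \<in> \<S> \<Longrightarrow> oscillating_on A B L' (T \<inter> B n')"
      using oscillating_on_split[OF z(2,4,5)] by metis
    define L'' where "L'' = L' \<inter> {n'<..}"
    have "infinite L''"
    proof
      assume "finite L''"
      then have "finite (L'' \<union> {..n'})" by simp
      moreover have "L' \<subseteq> L'' \<union> {..n'}" by (auto simp: L''_def)
      ultimately show False using n'(3) finite_subset by blast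
    qed
    then have "P (Suc k) ((\<lambda>T. T \<inter> A n') ` \<S> \<union> (\<lambda>T. T \<inter> B n') ` \<S>, L'', n')"
      using n' z oscillating_on_subset[of A B L' _ L''] by (auto simp: P_def L''_def)
    moreover have "Q k z ((\<lambda>T. T \<inter> A n') ` \<S> \<union> (\<lambda>T. T \<inter> B n') ` \<S>, L'', n')"
      using z n' by (auto simp: Q_def L''_def)
    ultimately show "\<exists>z'. P (Suc k) z' \<and> Q k z z'" by blast
  qed
  then obtain \<sigma> where \<sigma>: "\<And>k. P k (\<sigma> k)" "\<And>k. Q k (\<sigma> k) (\<sigma> (Suc k))"
    by blast
  define \<S> where "\<S> k = fst (\<sigma> k)" for k
  define L where "L k = fst (snd (\<sigma> k))" for k
  define r where "r k = snd (snd (\<sigma> (Suc k)))" for k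
  have L: "L (Suc k) \<subseteq> L k" "r k \<in> L k" "L (Suc k) \<subseteq> {r k<..}" "L k \<subseteq> M" "infinite (L k)"
    and S0: "\<S> 0 = {S}"
    and SS: "\<S> (Suc k) = (\<lambda>T. T \<inter> A (r k)) ` \<S> k \<union> (\<lambda>T. T \<inter> B (r k)) ` \<S> k"
    and osc: "T \<in> \<S> k \<Longrightarrow> oscillating_on A B (L k) T" for k T
    using \<sigma>(1)[of k] \<sigma>(1)[of 0] \<sigma>(2)[of k]
    by (auto simp: P_def Q_def L_def r_def \<S>_def split: prod.splits)
  have "strict_mono r"
    unfolding strict_mono_Suc_iff using L(2,3) by blast
  moreover have "range r \<subseteq> M" using L by blast
  moreover have "\<exists>x\<in>S. \<forall>j<N. x \<in> (if \<epsilon> j then A (r j) else B (r j))" for N \<epsilon>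
  proof -
    define T where "T = rec_nat S (\<lambda>j U. U \<inter> (if \<epsilon> j then A (r j) else B (r j)))"
    have T0: "T 0 = S" and TS: "T (Suc j) = T j \<inter> (if \<epsilon> j then A (r j) else B (r j))" for j
      by (simp_all add: T_def)
    have "T j \<in> \<S> j" for j
      by (induction j) (auto simp: T0 TS S0 SS)
    then have "T N \<noteq> {}"
      using osc oscillating_on_nonempty L(5) by blast
    moreover have "x \<in> T n \<Longrightarrow> x \<in> S \<and> (\<forall>j<n. x \<in> (if \<epsilon> j then A (r j) else B (r j)))" for n x
    proof (induction n)
      case (Suc n)
      then have "x \<in> T n" "x \<in> (if \<epsilon> n then A (r n) else B (r n))"
        unfolding TS by blast+
      with Suc.IH show ?case
        unfolding less_Suc_eq by blast
    qed (simp add: T0)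
    ultimately show ?thesis by blast
  qed
  ultimately show ?thesis by blast
qed

text \<open>A gap between the lower and the upper limit contains two rationals. Countably many pairs
  of thresholds thus decide convergence, which makes a diagonal argument possible.\<close>

lemma convergent_if_no_oscillation:
  fixes X :: "nat \<Rightarrow> real"
  assumes bdd: "\<And>n. \<bar>X n\<bar> \<le> C"
    and no: "\<And>a b. a \<in> \<rat> \<Longrightarrow> b \<in> \<rat> \<Longrightarrow> a < b \<Longrightarrow> finite {n. X n \<le> a} \<or> finite {n. b \<le> X n}"
  shows "convergent X"
proof -
  have "liminf (\<lambda>n. ereal (X n)) = limsup (\<lambda>n. ereal (X n))"
  proof (rule ccontr)
    assume "liminf (\<lambda>n. ereal (X n)) \<noteq> limsup (\<lambda>n. ereal (X n))"
    then have "liminf (\<lambda>n. ereal (X n)) < limsup (\<lambda>n. ereal (X n))"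
      using Liminf_le_Limsup[of sequentially "\<lambda>n. ereal (X n)"] by (simp add: order.not_eq_order_implies_strict)
    then obtain a' where a': "liminf (\<lambda>n. ereal (X n)) < ereal a'" "ereal a' < limsup (\<lambda>n. ereal (X n))"
      using ereal_dense2 by blast
    then obtain b' where b': "ereal a' < ereal b'" "ereal b' < limsup (\<lambda>n. ereal (X n))"
      using ereal_dense2 by blast
    obtain b where b: "b \<in> \<rat>" "a' < b" "b < b'" using b' Rats_dense_in_real by auto
    obtain a where a: "a \<in> \<rat>" "a' < a" "a < b" using b Rats_dense_in_real by blast
    have "\<not> finite {n. X n \<le> a}"
    proof
      assume "finite {n. X n \<le> a}"
      then have "eventually (\<lambda>n. \<not> X n \<le> a) sequentially"
        using eventually_cofinite[of "\<lambda>n. \<not> X n \<le> a"] by (simp add: cofinite_eq_sequentially)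
      then have "eventually (\<lambda>n. ereal a' \<le> ereal (X n)) sequentially"
        by (rule eventually_mono) (use a in auto)
      then have "ereal a' \<le> liminf (\<lambda>n. ereal (X n))"
        by (rule Liminf_bounded)
      then show False using a' by simp
    qed
    moreover have "\<not> finite {n. b \<le> X n}"
    proof
      assume "finite {n. b \<le> X n}"
      then have "eventually (\<lambda>n. \<not> b \<le> X n) sequentially"
        using eventually_cofinite[of "\<lambda>n. \<not> b \<le> X n"] by (simp add: cofinite_eq_sequentially)
      then have "eventually (\<lambda>n. ereal (X n) \<le> ereal b') sequentially"
        by (rule eventually_mono) (use b in auto)
      then have "limsup (\<lambda>n. ereal (X n)) \<le> ereal b'"
        by (rule Limsup_bounded)
      then show False using b' by simp
    qed
    ultimately show False using no a b by blast
  qed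
  then obtain l where l: "((\<lambda>n. ereal (X n)) \<longlongrightarrow> l) sequentially"
    using convergent_ereal[of "\<lambda>n. ereal (X n)"] lim_imp_Liminf by (metis convergent_def)
  have "ereal (-C) \<le> l" "l \<le> ereal C"
    using bdd by (auto intro!: tendsto_lowerbound[OF l] tendsto_upperbound[OF l] always_eventually simp: abs_le_iff minus_le_iff)
  then obtain l' where "l = ereal l'" by (cases l) auto
  then show ?thesis using l by (auto simp: convergent_def)
qed

text \<open>For each rational pair a < b the second hypothesis excludes independence, so every
  subsequence has a further one along which the two kinds of level sets are separated. A diagonal
  sequence serves all pairs at once.\<close>

lemma pointwise_convergent_or_independent:
  fixes f :: "nat \<Rightarrow> 'a \<Rightarrow> real"
  assumes bdd: "\<And>x. x \<in> S \<Longrightarrow> \<exists>C. \<forall>n. \<bar>f n x\<bar> \<le> C"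
    and no: "\<And>a b r. a < b \<Longrightarrow> strict_mono (r :: nat \<Rightarrow> nat) \<Longrightarrow>
      \<exists>N \<epsilon>. \<forall>x\<in>S. \<exists>j<N. \<not> (if \<epsilon> j then f (r j) x \<le> a else b \<le> f (r j) x)"
  shows "\<exists>r. strict_mono (r :: nat \<Rightarrow> nat) \<and> (\<forall>x\<in>S. convergent (\<lambda>n. f (r n) x))"
proof -
  define q where "q = from_nat_into {(a, b). a \<in> \<rat> \<and> b \<in> \<rat> \<and> a < (b::real)}"
  have "countable {(a, b). a \<in> \<rat> \<and> b \<in> \<rat> \<and> a < (b::real)}"
    by (rule countable_subset[of _ "\<rat> \<times> \<rat>"]) (auto simp: countable_rat)
  moreover have "(0::real, 1::real) \<in> {(a, b). a \<in> \<rat> \<and> b \<in> \<rat> \<and> a < (b::real)}" by auto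
  ultimately have range_q: "range q = {(a, b). a \<in> \<rat> \<and> b \<in> \<rat> \<and> a < (b::real)}"
    unfolding q_def by (intro range_from_nat_into) blast+
  define A where "A i n = {x. f n x \<le> fst (q i)}" for i n
  define B where "B i n = {x. snd (q i) \<le> f n x}" for i n
  interpret subseqs "\<lambda>i s. separated_on (A i) (B i) (range s) S"
  proof
    fix i and s :: "nat \<Rightarrow> nat" assume s: "strict_mono s"
    have "\<not> oscillating_on (A i) (B i) (range s) S"
    proof
      assume "oscillating_on (A i) (B i) (range s) S"
      moreover have "infinite (range s)"
        using s by (simp add: range_inj_infinite strict_mono_imp_inj_on)
      ultimately obtain r :: "nat \<Rightarrow> nat" where r: "strict_mono r"
        "\<And>N \<epsilon>. \<exists>x\<in>S. \<forall>j<N. x \<in> (if \<epsilon> j then A i (r j) else B i (r j))"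
        by (blast dest: oscillating_on_imp_independent)
      have "q i \<in> range q" by blast
      then have "fst (q i) < snd (q i)" unfolding range_q by auto
      from no[OF this r(1)] obtain N \<epsilon> where
        N: "\<forall>x\<in>S. \<exists>j<N. \<not> (if \<epsilon> j then f (r j) x \<le> fst (q i) else snd (q i) \<le> f (r j) x)"
        by blast
      obtain x where x: "x \<in> S" "\<forall>j<N. x \<in> (if \<epsilon> j then A i (r j) else B i (r j))"
        using r(2)[of N \<epsilon>] by blast
      obtain j where "j < N" "\<not> (if \<epsilon> j then f (r j) x \<le> fst (q i) else snd (q i) \<le> f (r j) x)"
        using N x(1) by blast
      then show False
        using x(2) by (cases "\<epsilon> j") (auto simp: A_def B_def)
    qed
    then obtain L where L: "L \<subseteq> range s" "infinite L" "separated_on (A i) (B i) L S"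
      unfolding oscillating_on_def by blast
    have "infinite (s -` L)"
      using L by (metis finite_imageI image_vimage_eq inf.absorb_iff1)
    then obtain r' :: "nat \<Rightarrow> nat" where r': "strict_mono r'" "\<forall>n. r' n \<in> s -` L"
      using infinite_enumerate by blast
    have "range (s \<circ> r') \<subseteq> L" using r' by auto
    then have "separated_on (A i) (B i) (range (s \<circ> r')) S"
      using separated_on_almost_subset[OF L(3)] by (metis Diff_eq_empty_iff finite.emptyI)
    then show "\<exists>r'. strict_mono (r' :: nat \<Rightarrow> nat) \<and> separated_on (A i) (B i) (range (s \<circ> r')) S"
      using r' by blast
  qed
  have sep: "separated_on (A k) (B k) (range (diagseq \<circ> ((+) (Suc k)))) S" for k
  proof (rule diagseq_holds)
    fix r s :: "nat \<Rightarrow> nat" and n assume "separated_on (A n) (B n) (range s) S"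
    moreover have "range (s \<circ> r) - range s = {}" by auto
    ultimately show "separated_on (A n) (B n) (range (s \<circ> r)) S"
      using separated_on_almost_subset by (metis finite.emptyI)
  qed
  \<comment> \<open>Beyond index k the diagonal sequence is controlled by the stage of the k-th
    pair; the finitely many earlier terms do not affect separation.\<close>
  have sep: "separated_on (A k) (B k) (range diagseq) S" for k
  proof (rule separated_on_almost_subset[OF sep])
    have "range diagseq - range (diagseq \<circ> (+) (Suc k)) \<subseteq> diagseq ` {..k}"
    proof
      fix y assume "y \<in> range diagseq - range (diagseq \<circ> (+) (Suc k))"
      then obtain n where n: "y = diagseq n" "y \<notin> range (diagseq \<circ> (+) (Suc k))" by auto
      have "n \<le> k"
      proof (rule ccontr)
        assume "\<not> n \<le> k"
        then have "n = Suc k + (n - Suc k)" by simp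
        then have "y = (diagseq \<circ> (+) (Suc k)) (n - Suc k)" using n by simp
        then show False using n by blast
      qed
      then show "y \<in> diagseq ` {..k}" using n by auto
    qed
    then show "finite (range diagseq - range (diagseq \<circ> (+) (Suc k)))"
      using finite_surj by blast
  qed
  have "convergent (\<lambda>n. f (diagseq n) x)" if x: "x \<in> S" for x
  proof -
    obtain C where C: "\<And>n. \<bar>f n x\<bar> \<le> C" using bdd x by blast
    show ?thesis
    proof (rule convergent_if_no_oscillation)
      show "\<bar>f (diagseq n) x\<bar> \<le> C" for n by (rule C)
      fix a b :: real assume "a \<in> \<rat>" "b \<in> \<rat>" "a < b"
      then have "(a, b) \<in> range q" using range_q by auto
      then obtain i where i: "q i = (a, b)" by (metis imageE)
      have inj: "inj diagseq" using subseq_diagseq strict_mono_imp_inj_on by blast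
      have *: "finite {n. diagseq n \<in> {m \<in> range diagseq. x \<in> D m}}"
        if "finite {m \<in> range diagseq. x \<in> D m}" for D
        using finite_vimageI[OF that inj] by (simp add: vimage_def)
      show "finite {n. f (diagseq n) x \<le> a} \<or> finite {n. b \<le> f (diagseq n) x}"
        using sep[of i] x *[of "A i"] *[of "B i"] by (auto simp: separated_on_def A_def B_def i)
    qed
  qed
  then show ?thesis using subseq_diagseq by blast
qed


section \<open>Simons' inequality\<close>

text \<open>The bound is assumed from index n on only. This covers both the uniform tail estimate
  and the end of the proof of Simons' inequality, where the terms at one point are small only
  eventually.\<close>

lemma dyadic_series_tail:
  fixes a :: "nat \<Rightarrow> real"
  assumes B: "\<And>i. n \<le> i \<Longrightarrow> \<bar>a i\<bar> \<le> B"
  shows "summable (\<lambda>i. a i / 2 ^ i)"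
    and "\<bar>(\<Sum>i. a i / 2 ^ i) - (\<Sum>i<n. a i / 2 ^ i)\<bar> \<le> 2 * B / 2 ^ n"
proof -
  have g: "(\<lambda>i. B / 2 ^ n * (1 / 2) ^ i) sums (B / 2 ^ n * 2)"
    using geometric_sums[of "1/2::real"] by (intro sums_mult) simp
  have le: "norm (a (i + n) / 2 ^ (i + n)) \<le> B / 2 ^ n * (1 / 2) ^ i" for i
    using B[of "i + n"] by (simp add: power_add power_one_over divide_simps abs_mult)
  have s: "summable (\<lambda>i. norm (a (i + n) / 2 ^ (i + n)))"
    by (rule summable_comparison_test'[OF sums_summable[OF g], of 0]) (use le in auto)
  show s': "summable (\<lambda>i. a i / 2 ^ i)"
    using summable_norm_cancel[OF s] summable_iff_shift[of "\<lambda>i. a i / 2 ^ i" n] by simp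
  have "(\<Sum>i. a i / 2 ^ i) - (\<Sum>i<n. a i / 2 ^ i) = (\<Sum>i. a (i + n) / 2 ^ (i + n))"
    using suminf_minus_initial_segment[OF s', of n] by simp
  also have "\<bar>\<dots>\<bar> \<le> (\<Sum>i. norm (a (i + n) / 2 ^ (i + n)))"
    using summable_norm[OF s] by simp
  also have "\<dots> \<le> (\<Sum>i. B / 2 ^ n * (1 / 2) ^ i)"
    by (intro suminf_le s sums_summable[OF g] le)
  also have "\<dots> = 2 * B / 2 ^ n" unfolding sums_unique[OF g, symmetric] by simp
  finally show "\<bar>(\<Sum>i. a i / 2 ^ i) - (\<Sum>i<n. a i / 2 ^ i)\<bar> \<le> 2 * B / 2 ^ n" .
qed

lemma sum_lessThan_add:
  "(\<Sum>i<n + M. f i) = (\<Sum>i<n. f i) + (\<Sum>j<M. f (n + j))" for f :: "nat \<Rightarrow> real"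
  by (induction M) (auto simp: add.assoc)

text \<open>
  A form of Simons' inequality.  The \<open>g n\<close> are chosen successively so that
  \<open>\<Sum>i\<le>n. g i / 2 ^ i + g n / 2 ^ n\<close> has almost minimal norm; a point at which the modulus of
  \<open>\<Sum>i. g i / 2 ^ i\<close> is maximal then works.
\<close>

lemma simons_not_pointwise_null:
  fixes C :: "nat \<Rightarrow> ('a::topological_space \<Rightarrow> real) set"
  assumes X: "compact X" "X \<noteq> {}"
    and cont: "\<And>g. g \<in> C 0 \<Longrightarrow> continuous_on X g"
    and bdd: "\<And>g x. g \<in> C 0 \<Longrightarrow> x \<in> X \<Longrightarrow> \<bar>g x\<bar> \<le> K"
    and decr: "\<And>n. C (Suc n) \<subseteq> C n"
    and ne: "\<And>n. C n \<noteq> {}"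
    and conv: "\<And>n g h t. g \<in> C n \<Longrightarrow> h \<in> C n \<Longrightarrow> (\<lambda>x. (g x + h x) / 2) \<in> C n"
    and low: "\<And>g. g \<in> C 0 \<Longrightarrow> \<exists>x\<in>X. m \<le> \<bar>g x\<bar>" and "m > 0"
  shows "\<exists>g. \<exists>x\<in>X. (\<forall>n. g n \<in> C n) \<and> \<not> (\<lambda>n. g n x) \<longlonglongrightarrow> 0"
proof -
  define S where "S h = (SUP x\<in>X. \<bar>h x\<bar>)" for h :: "'a \<Rightarrow> real"
  have S_le: "S h \<le> B" if "\<And>x. x \<in> X \<Longrightarrow> \<bar>h x\<bar> \<le> B" for h B
    unfolding S_def by (rule cSUP_least) (use X that in auto)
  have le_S: "\<bar>h x\<bar> \<le> S h" if "\<And>x. x \<in> X \<Longrightarrow> \<bar>h x\<bar> \<le> B" "x \<in> X" for h B x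
    unfolding S_def by (rule cSUP_upper) (use X that in \<open>auto intro!: bdd_aboveI[of _ B]\<close>)
  have C0: "C n \<subseteq> C 0" for n
    using decr by (metis lift_Suc_antimono_le zero_le)
  have Cmono: "C j \<subseteq> C i" if "i \<le> j" for i j
    using decr that by (metis lift_Suc_antimono_le)
  \<comment> \<open>In the recursion for y below, the n-th error is multiplied by
    \<open>2 ^ n\<close> and becomes \<open>m / 2 ^ Suc n\<close>. All errors together cost m, half
    of the initial value, which is at least 2 m.\<close>
  define \<epsilon> where "\<epsilon> n = m / (2 * 4 ^ n)" for n :: nat
  have \<epsilon>: "\<epsilon> n > 0" for n using \<open>m > 0\<close> by (simp add: \<epsilon>_def)
  define P where "P = (\<lambda>n (z, g). g \<in> C n \<and> (\<exists>B. \<forall>x\<in>X. \<bar>z x\<bar> \<le> B) \<and> (n = 0 \<longrightarrow> z = (\<lambda>_. 0)) \<and>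
    (\<forall>h\<in>C n. S (\<lambda>x. z x + 2 / 2 ^ n * g x) \<le> S (\<lambda>x. z x + 2 / 2 ^ n * h x) + \<epsilon> n))"
  define Q where "Q = (\<lambda>n (z, g) (z' :: 'a \<Rightarrow> real, g' :: 'a \<Rightarrow> real). z' = (\<lambda>x. z x + g x / 2 ^ n))"
  have opt: "\<exists>g\<in>C n. \<forall>h\<in>C n. S (\<lambda>x. z x + 2 / 2 ^ n * g x) \<le> S (\<lambda>x. z x + 2 / 2 ^ n * h x) + \<epsilon> n"
    if z: "\<And>x. x \<in> X \<Longrightarrow> \<bar>z x\<bar> \<le> B" for z B n
  proof -
    define \<Phi> where "\<Phi> h = S (\<lambda>x. z x + 2 / 2 ^ n * h x)" for h
    have nonneg: "0 \<le> \<Phi> h" if h: "h \<in> C n" for h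
    proof -
      obtain x where x: "x \<in> X" using X by auto
      have "\<bar>z y + 2 / 2 ^ n * h y\<bar> \<le> B + 2 / 2 ^ n * K" if "y \<in> X" for y
      proof -
        have "\<bar>2 / 2 ^ n * h y\<bar> \<le> 2 / 2 ^ n * K"
          using bdd[of h y] h C0[of n] that by (auto simp: abs_mult intro!: mult_left_mono divide_right_mono)
        then show ?thesis using z[OF that] by linarith
      qed
      from le_S[where h = "\<lambda>y. z y + 2 / 2 ^ n * h y", OF this x] show ?thesis
        unfolding \<Phi>_def by linarith
    qed
    have "bdd_below (\<Phi> ` C n)" using nonneg by (auto intro!: bdd_belowI[of _ 0])
    moreover have "Inf (\<Phi> ` C n) < Inf (\<Phi> ` C n) + \<epsilon> n" using \<epsilon> by simp
    ultimately obtain g where g: "g \<in> C n" "\<Phi> g < Inf (\<Phi> ` C n) + \<epsilon> n"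
      using cInf_lessD[of "\<Phi> ` C n"] ne[of n] by blast
    moreover have "Inf (\<Phi> ` C n) \<le> \<Phi> h" if "h \<in> C n" for h
      using \<open>bdd_below (\<Phi> ` C n)\<close> that by (simp add: cINF_lower)
    ultimately have "\<forall>h\<in>C n. \<Phi> g \<le> \<Phi> h + \<epsilon> n" by force
    then show ?thesis unfolding \<Phi>_def using g(1) by blast
  qed
  have "\<exists>\<sigma>. \<forall>n. P n (\<sigma> n) \<and> Q n (\<sigma> n) (\<sigma> (Suc n))"
  proof (rule dependent_nat_choice)
    obtain g where "g \<in> C 0" "\<forall>h\<in>C 0. S (\<lambda>x. 0 + 2 / 2 ^ 0 * g x) \<le> S (\<lambda>x. 0 + 2 / 2 ^ 0 * h x) + \<epsilon> 0"
      using opt[of "\<lambda>_. 0" 0 0] by auto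
    then show "\<exists>z. P 0 z"
      by (intro exI[of _ "(\<lambda>_. 0, g)"]) (auto simp: P_def intro: exI[of _ 0])
    fix \<sigma> n assume "P n \<sigma>"
    then obtain z g B where \<sigma>: "\<sigma> = (z, g)" "g \<in> C n" "\<And>x. x \<in> X \<Longrightarrow> \<bar>z x\<bar> \<le> B"
      by (auto simp: P_def)
    have B': "\<bar>z x + g x / 2 ^ n\<bar> \<le> B + K / 2 ^ n" if "x \<in> X" for x
    proof -
      have "\<bar>g x / 2 ^ n\<bar> \<le> K / 2 ^ n"
        using bdd[of g x] \<sigma>(2) C0[of n] that by (auto simp: divide_right_mono)
      then show ?thesis using \<sigma>(3)[OF that] by linarith
    qed
    from opt[of "\<lambda>x. z x + g x / 2 ^ n", OF B'] obtain g' where "g' \<in> C (Suc n)"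
      "\<forall>h\<in>C (Suc n). S (\<lambda>x. z x + g x / 2 ^ n + 2 / 2 ^ Suc n * g' x)
        \<le> S (\<lambda>x. z x + g x / 2 ^ n + 2 / 2 ^ Suc n * h x) + \<epsilon> (Suc n)"
      by blast
    then have "P (Suc n) (\<lambda>x. z x + g x / 2 ^ n, g') \<and> Q n \<sigma> (\<lambda>x. z x + g x / 2 ^ n, g')"
      using B' \<sigma> by (auto simp: P_def Q_def)
    then show "\<exists>\<sigma>'. P (Suc n) \<sigma>' \<and> Q n \<sigma> \<sigma>'" ..
  qed
  then obtain \<sigma> where \<sigma>: "\<And>n. P n (\<sigma> n)" "\<And>n. Q n (\<sigma> n) (\<sigma> (Suc n))" by blast
  define g where "g n = snd (\<sigma> n)" for n
  define z where "z n x = (\<Sum>i<n. g i x / 2 ^ i)" for n x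
  have g: "g n \<in> C n" for n
    using \<sigma>(1)[of n] by (auto simp: P_def g_def)
  have fz: "fst (\<sigma> n) = z n" for n
  proof (induction n)
    case 0
    then show ?case using \<sigma>(1)[of 0] by (auto simp: P_def z_def)
  next
    case (Suc n)
    then show ?case using \<sigma>(2)[of n] by (auto simp: Q_def z_def g_def split: prod.splits)
  qed
  have min: "S (\<lambda>x. z n x + 2 / 2 ^ n * g n x) \<le> S (\<lambda>x. z n x + 2 / 2 ^ n * h x) + \<epsilon> n"
    if "h \<in> C n" for n h
    using \<sigma>(1)[of n] that fz[of n] by (cases "\<sigma> n") (simp add: P_def g_def)
  have gK: "\<bar>g n x\<bar> \<le> K" if "x \<in> X" for n x
    using bdd g C0 that by blast
  define zz where "zz x = (\<Sum>i. g i x / 2 ^ i)" for x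
  have tail: "\<bar>zz x - z n x\<bar> \<le> 2 * K / 2 ^ n" if "x \<in> X" for n x
    unfolding zz_def z_def by (rule dyadic_series_tail) (use gK that in auto)
  have "K \<ge> 0" using X gK[of _ 0] by (meson abs_ge_zero all_not_in_conv order_trans)
  have contz: "continuous_on X (z n)" for n
    unfolding z_def using cont g C0 by (intro continuous_intros) auto
  have "continuous_on X zz"
  proof (rule uniform_limit_theorem[of _ z sequentially])
    show "uniform_limit X z zz sequentially"
    proof (rule uniform_limitI)
      fix e :: real assume "0 < e"
      have "(\<lambda>n. 2 * K * (1 / 2) ^ n) \<longlonglongrightarrow> 2 * K * 0"
        by (intro tendsto_mult LIMSEQ_power_zero tendsto_const) simp
      then have "\<forall>\<^sub>F n in sequentially. 2 * K * (1 / 2) ^ n < e"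
        using order_tendstoD(2)[of "\<lambda>n. 2 * K * (1 / 2) ^ n" 0 sequentially e] \<open>0 < e\<close> by simp
      then show "\<forall>\<^sub>F n in sequentially. \<forall>x\<in>X. dist (z n x) (zz x) < e"
      proof (rule eventually_mono, intro ballI)
        fix n y assume "2 * K * (1 / 2) ^ n < e" "y \<in> X"
        then show "dist (z n y) (zz y) < e"
          using tail[of y n] by (simp add: dist_real_def abs_minus_commute power_one_over)
      qed
    qed
  qed (use contz in auto)
  then obtain x where x: "x \<in> X" "\<And>y. y \<in> X \<Longrightarrow> \<bar>zz y\<bar> \<le> \<bar>zz x\<bar>"
    using continuous_attains_sup[of X "\<lambda>y. \<bar>zz y\<bar>"] X continuous_on_rabs by blast
  \<comment> \<open>Iterated midpoints: the weights 1/2, ..., \<open>1 / 2 ^ M\<close> together with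
    the remaining \<open>1 / 2 ^ M\<close> on q add up to 1. These finite combinations stand in for
    the infinite series, whose sum need not belong to \<open>C n\<close>.\<close>
  have comb: "(\<lambda>y. (\<Sum>j<M. g (n + j) y / 2 ^ (j + 1)) + q y / 2 ^ M) \<in> C n" if "q \<in> C n" for n M q
    using that
  proof (induction M arbitrary: q)
    case (Suc M)
    have "(\<lambda>y. (g (n + M) y + q y) / 2) \<in> C n"
      using conv g Cmono[of n "n + M"] Suc.prems by (simp add: subset_eq)
    from Suc.IH[OF this] show ?case
      by (simp add: add_divide_distrib algebra_simps)
  qed (simp add: eta_contract_eq)
  \<comment> \<open>Inserted as h into the quantity being minimised, the combination reproduces the
    whole series zz up to an error that vanishes with M.\<close>
  have near: "\<bar>z n y + 2 / 2 ^ n * ((\<Sum>j<M. g (n + j) y / 2 ^ (j + 1)) + q y / 2 ^ M) - zz y\<bar> \<le> 4 * K / 2 ^ M"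
    if "q \<in> C n" "y \<in> X" for n M q y
  proof -
    have "2 / 2 ^ n * (\<Sum>j<M. g (n + j) y / 2 ^ (j + 1)) = (\<Sum>j<M. g (n + j) y / 2 ^ (n + j))"
      by (simp add: sum_distrib_left power_add field_simps)
    then have "z n y + 2 / 2 ^ n * (\<Sum>j<M. g (n + j) y / 2 ^ (j + 1)) = z (n + M) y"
      unfolding z_def sum_lessThan_add by simp
    then have *: "z n y + 2 / 2 ^ n * ((\<Sum>j<M. g (n + j) y / 2 ^ (j + 1)) + q y / 2 ^ M)
        = z (n + M) y + 2 / 2 ^ n * (q y / 2 ^ M)"
      by (simp add: algebra_simps)
    have "\<bar>q y\<bar> \<le> K" using bdd that C0 by blast
    then have "\<bar>2 / 2 ^ n * (q y / 2 ^ M)\<bar> \<le> 2 * K / 2 ^ (n + M)"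
      by (simp add: power_add abs_mult divide_right_mono)
    moreover have "2 * K / 2 ^ (n + M) \<le> 2 * K / 2 ^ M"
      using \<open>K \<ge> 0\<close> by (intro divide_left_mono) (auto intro: power_increasing)
    ultimately show ?thesis
      unfolding * using tail[OF that(2), of "n + M"] by linarith
  qed
  have lim: "(\<lambda>M. B + 4 * K / 2 ^ M) \<longlonglongrightarrow> B" for B
  proof -
    have "(\<lambda>M. B + 4 * K * (1 / 2) ^ M) \<longlonglongrightarrow> B + 4 * K * 0"
      by (intro tendsto_intros LIMSEQ_power_zero) simp
    then show ?thesis by (simp add: power_one_over)
  qed
  \<comment> \<open>Near-minimality of \<open>g n\<close> is tested against the combinations above.
    As M grows, the right side tends to the norm of zz, attained at x, plus the error.\<close>
  have key: "\<bar>z n y + 2 / 2 ^ n * g n y\<bar> \<le> \<bar>zz x\<bar> + \<epsilon> n" if y: "y \<in> X" for n y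
  proof -
    have bz: "\<bar>z n u\<bar> \<le> \<bar>zz x\<bar> + 2 * K / 2 ^ n" if "u \<in> X" for u
      using tail[OF that, of n] x(2)[OF that] by linarith
    have "\<bar>z n u + 2 / 2 ^ n * g n u\<bar> \<le> \<bar>zz x\<bar> + 2 * K / 2 ^ n + 2 / 2 ^ n * K" if "u \<in> X" for u
    proof -
      have "\<bar>2 / 2 ^ n * g n u\<bar> \<le> 2 / 2 ^ n * K"
        using gK[OF that] by (auto simp: abs_mult intro!: mult_left_mono divide_right_mono)
      then show ?thesis using bz[OF that] by linarith
    qed
    from le_S[where h = "\<lambda>u. z n u + 2 / 2 ^ n * g n u", OF this y] have 1: "\<bar>z n y + 2 / 2 ^ n * g n y\<bar> \<le> S (\<lambda>x. z n x + 2 / 2 ^ n * g n x)" .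
    have 2: "S (\<lambda>y. z n y + 2 / 2 ^ n * ((\<Sum>j<M. g (n + j) y / 2 ^ (j + 1)) + g n y / 2 ^ M)) \<le> \<bar>zz x\<bar> + 4 * K / 2 ^ M" for M
      using near[OF g, of _ n M] x(2) by (intro S_le) (smt (verit))
    have "\<bar>z n y + 2 / 2 ^ n * g n y\<bar> \<le> (\<bar>zz x\<bar> + \<epsilon> n) + 4 * K / 2 ^ M" for M
      using 1 2[of M] min[OF comb[OF g], of n M] by linarith
    then show ?thesis
      by (intro LIMSEQ_le_const[OF lim[of "\<bar>zz x\<bar> + \<epsilon> n"]]) auto
  qed
  \<comment> \<open>The series zz is nearly twice a combination in \<open>C 0\<close>, and such a
    combination reaches m in modulus somewhere.\<close>
  have "2 * m \<le> \<bar>zz x\<bar>"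
  proof -
    have "2 * m \<le> \<bar>zz x\<bar> + 4 * K / 2 ^ M" for M
    proof -
      obtain y where y: "y \<in> X" "m \<le> \<bar>(\<Sum>j<M. g (0 + j) y / 2 ^ (j + 1)) + g 0 y / 2 ^ M\<bar>"
        using low[OF comb[OF g[of 0], of M]] by blast
      have "\<bar>2 * ((\<Sum>j<M. g (0 + j) y / 2 ^ (j + 1)) + g 0 y / 2 ^ M) - zz y\<bar> \<le> 4 * K / 2 ^ M"
        using near[OF g[of 0] y(1), of M] by (simp add: z_def)
      moreover have "2 * m \<le> a + c" if "\<bar>2 * q - b\<bar> \<le> c" "m \<le> \<bar>q\<bar>" "\<bar>b\<bar> \<le> a" for a b c q :: real
        using that by arith
      ultimately show ?thesis using y(2) x(2)[OF y(1)] by blast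
    qed
    then show ?thesis by (intro LIMSEQ_le_const[OF lim]) auto
  qed
  define \<theta> :: real where "\<theta> = (if zz x \<ge> 0 then 1 else -1)"
  have \<theta>: "\<bar>zz x\<bar> = \<theta> * zz x" "\<bar>\<theta>\<bar> = 1" by (auto simp: \<theta>_def)
  \<comment> \<open>This is the rescaled tail of the series at x. It satisfies
    \<open>y (Suc n) = 2 * y n - 2 * \<theta> * g n x\<close>, while \<open>key\<close> at x gives
    \<open>2 * \<theta> * g n x \<le> y n + 2 ^ n * \<epsilon> n\<close>. Hence y loses at most
    \<open>2 ^ n * \<epsilon> n\<close> per step and stays above m, although it would fall to m / 2
    or less if the terms \<open>g n x\<close> tended to 0.\<close>
  define y where "y n = 2 ^ n * (\<theta> * (zz x - z n x))" for n
  have y_lower: "m + m / 2 ^ n \<le> y n" for n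
  proof (induction n)
    case 0
    then show ?case using \<open>2 * m \<le> \<bar>zz x\<bar>\<close> \<theta> by (simp add: y_def z_def)
  next
    case (Suc n)
    have "\<theta> * (z n x + 2 / 2 ^ n * g n x) \<le> \<theta> * zz x + \<epsilon> n"
      using key[OF x(1), of n] \<theta> by (auto simp: \<theta>_def split: if_splits)
    then have "2 ^ n * (\<theta> * (z n x + 2 / 2 ^ n * g n x)) \<le> 2 ^ n * (\<theta> * zz x + \<epsilon> n)"
      by (intro mult_left_mono) auto
    then have "2 ^ n * \<theta> * z n x + 2 * \<theta> * g n x \<le> 2 ^ n * \<theta> * zz x + 2 ^ n * \<epsilon> n"
      by (simp add: algebra_simps)
    moreover have "y (Suc n) = 2 * (2 ^ n * \<theta> * zz x) - 2 * (2 ^ n * \<theta> * z n x) - 2 * \<theta> * g n x"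
      by (simp add: y_def z_def algebra_simps)
    moreover have "y n = 2 ^ n * \<theta> * zz x - 2 ^ n * \<theta> * z n x"
      by (simp add: y_def algebra_simps)
    moreover have "2 ^ n * \<epsilon> n = m / 2 ^ Suc n"
    proof -
      have "(4::real) ^ n = 2 ^ n * 2 ^ n" by (simp flip: power_mult_distrib)
      then show ?thesis by (simp add: \<epsilon>_def)
    qed
    ultimately have "y (Suc n) \<ge> y n - m / 2 ^ Suc n" by linarith
    then show ?case using Suc by (simp add: field_simps)
  qed
  have ym: "m \<le> y n" for n
  proof -
    have "0 \<le> m / 2 ^ n" using \<open>m > 0\<close> by simp
    then show ?thesis using y_lower[of n] by linarith
  qed
  have "\<not> (\<lambda>n. g n x) \<longlonglongrightarrow> 0"
  proof
    assume "(\<lambda>n. g n x) \<longlonglongrightarrow> 0"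
    then obtain n where n: "\<And>i. i \<ge> n \<Longrightarrow> \<bar>g i x\<bar> < m / 4"
      using LIMSEQ_D[of "\<lambda>n. g n x" 0 "m / 4"] \<open>m > 0\<close> by auto
    have "\<bar>zz x - z n x\<bar> \<le> 2 * (m / 4) / 2 ^ n"
      unfolding zz_def z_def by (rule dyadic_series_tail) (use n in \<open>auto intro: less_imp_le\<close>)
    then have "2 ^ n * \<bar>zz x - z n x\<bar> \<le> 2 ^ n * (2 * (m / 4) / 2 ^ n)"
      by (intro mult_left_mono) auto
    then have "\<bar>y n\<bar> \<le> m / 2"
      using \<theta> by (simp add: y_def abs_mult)
    then show False using ym[of n] \<open>m > 0\<close> by linarith
  qed
  then show ?thesis using g x(1) by blast
qed

section \<open>Lower l1-estimates in the supremum norm\<close>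

definition sup_ell1_lower :: "'a set \<Rightarrow> (nat \<Rightarrow> 'a \<Rightarrow> real) \<Rightarrow> real \<Rightarrow> bool"
  where "sup_ell1_lower X w \<delta> \<longleftrightarrow>
    (\<forall>I c s. finite I \<longrightarrow> (\<forall>x\<in>X. \<bar>\<Sum>k\<in>I. c k * w k x\<bar> \<le> s) \<longrightarrow> \<delta> * (\<Sum>k\<in>I. \<bar>c k\<bar>) \<le> s)"

lemma sup_ell1_lower_subseq:
  assumes "sup_ell1_lower X w \<delta>" "inj r"
  shows "sup_ell1_lower X (\<lambda>n. w (r n)) \<delta>"
  unfolding sup_ell1_lower_def
proof (intro allI impI)
  fix I c s assume I: "finite I" "\<forall>x\<in>X. \<bar>\<Sum>k\<in>I. c k * w (r k) x\<bar> \<le> s"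
  have inj: "inj_on r I" using assms(2) inj_on_subset by blast
  have "(\<Sum>k\<in>r ` I. c (inv_into UNIV r k) * w k x) = (\<Sum>k\<in>I. c k * w (r k) x)" for x
    by (simp add: sum.reindex[OF inj] assms(2) o_def)
  moreover have "(\<Sum>k\<in>r ` I. \<bar>c (inv_into UNIV r k)\<bar>) = (\<Sum>k\<in>I. \<bar>c k\<bar>)"
    by (simp add: sum.reindex[OF inj] assms(2) o_def)
  ultimately show "\<delta> * (\<Sum>k\<in>I. \<bar>c k\<bar>) \<le> s"
    using assms(1)[unfolded sup_ell1_lower_def, rule_format, of "r ` I" "\<lambda>k. c (inv_into UNIV r k)" s] I by simp
qed

lemma sum_lessThan_double:
  "(\<Sum>j<2 * N. f j) = (\<Sum>k<N. f (2 * k) + f (2 * k + 1))" for f :: "nat \<Rightarrow> real"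
  by (induction N) auto

text \<open>Pointwise convergence would make differences of consecutive terms pointwise null, and
  then every choice of convex combinations of their tails would be pointwise null too. The lower
  l1-estimate keeps all these combinations away from 0 in the supremum norm, so Simons' inequality
  yields a choice and a point that contradict this.\<close>

lemma sup_ell1_lower_not_pointwise_convergent:
  fixes w :: "nat \<Rightarrow> 'a::topological_space \<Rightarrow> real"
  assumes X: "compact X" "X \<noteq> {}" and cont: "\<And>k. continuous_on X (w k)"
    and bdd: "\<And>k x. x \<in> X \<Longrightarrow> \<bar>w k x\<bar> \<le> K"
    and low: "sup_ell1_lower X w \<delta>" and "\<delta> > 0"
  shows "\<not> (\<forall>x\<in>X. convergent (\<lambda>n. w n x))"
proof
  assume conv: "\<forall>x\<in>X. convergent (\<lambda>n. w n x)"
  \<comment> \<open>The d k involve disjoint pairs of terms of w, so a convex combination of them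
    has coefficient mass exactly 2 with respect to w.\<close>
  define d where "d k x = w (2 * k) x - w (2 * k + 1) x" for k x
  define R where "R n g N \<rho> \<longleftrightarrow> (\<forall>k. 0 \<le> \<rho> k) \<and> (\<forall>k. k < n \<or> N \<le> k \<longrightarrow> \<rho> k = 0) \<and>
    (\<Sum>k<N. \<rho> k) = 1 \<and> g = (\<lambda>x. \<Sum>k<N. \<rho> k * d k x)" for n g N and \<rho> :: "nat \<Rightarrow> real"
  define C where "C n = {g. \<exists>N \<rho>. R n g N \<rho>}" for n
  have ext: "(\<Sum>k<N. \<rho> k * f k) = (\<Sum>k<N'. \<rho> k * f k)"
    if "N \<le> N'" "\<forall>k. N \<le> k \<longrightarrow> \<rho> k = 0" for N N' and \<rho> f :: "nat \<Rightarrow> real"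
    using that by (intro sum.mono_neutral_left) auto
  have dK: "\<bar>d k x\<bar> \<le> 2 * K" if "x \<in> X" for k x
    using bdd[OF that, of "2 * k"] bdd[OF that, of "2 * k + 1"] by (auto simp: d_def)
  have Cbd: "\<bar>g x\<bar> \<le> B" if gC: "g \<in> C n" "\<And>k. n \<le> k \<Longrightarrow> \<bar>d k x\<bar> \<le> B" for g n x B
  proof -
    obtain N \<rho> where "R n g N \<rho>" using gC(1) unfolding C_def by blast
    then have *: "\<forall>k. 0 \<le> \<rho> k" "\<forall>k. k < n \<or> N \<le> k \<longrightarrow> \<rho> k = 0" "(\<Sum>k<N. \<rho> k) = 1"
      "g = (\<lambda>x. \<Sum>k<N. \<rho> k * d k x)" by (simp_all add: R_def)
    have "\<bar>g x\<bar> \<le> (\<Sum>k<N. \<bar>\<rho> k * d k x\<bar>)" unfolding *(4) by (rule sum_abs)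
    also have "\<dots> \<le> (\<Sum>k<N. \<rho> k * B)"
    proof (rule sum_mono)
      fix k
      show "\<bar>\<rho> k * d k x\<bar> \<le> \<rho> k * B"
        using *(1,2) that(2)[of k] by (cases "n \<le> k") (auto simp: abs_mult intro: mult_left_mono)
    qed
    also have "\<dots> = B" using *(3) by (simp flip: sum_distrib_right)
    finally show ?thesis .
  qed
  have "\<exists>g. \<exists>x\<in>X. (\<forall>n. g n \<in> C n) \<and> \<not> (\<lambda>n. g n x) \<longlonglongrightarrow> 0"
  proof (rule simons_not_pointwise_null[OF X])
    fix g assume "g \<in> C 0"
    then obtain N \<rho> where "R 0 g N \<rho>" unfolding C_def by blast
    then have *: "\<forall>k. 0 \<le> \<rho> k" "\<forall>k. N \<le> k \<longrightarrow> \<rho> k = 0" "(\<Sum>k<N. \<rho> k) = 1"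
      "g = (\<lambda>x. \<Sum>k<N. \<rho> k * d k x)" by (simp_all add: R_def)
    show "continuous_on X g"
      unfolding *(4) d_def using cont by (intro continuous_intros) auto
    show "\<exists>x\<in>X. \<delta> \<le> \<bar>g x\<bar>"
    proof (rule ccontr)
      assume "\<not> ?thesis"
      then have le: "\<forall>x\<in>X. \<bar>g x\<bar> \<le> \<delta>" by auto
      define c where "c j = (if even j then \<rho> (j div 2) else - \<rho> (j div 2))" for j
      have "(\<Sum>j<2 * N. c j * w j x) = g x" for x
        unfolding sum_lessThan_double *(4) by (intro sum.cong) (auto simp: c_def d_def algebra_simps)
      moreover have "(\<Sum>j<2 * N. \<bar>c j\<bar>) = 2"
        unfolding sum_lessThan_double using *(1,3) by (simp add: c_def flip: sum_distrib_left)
      ultimately have "\<delta> * 2 \<le> \<delta>"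
        using low[unfolded sup_ell1_lower_def, rule_format, of "{..<2 * N}" c \<delta>] le by simp
      then show False using \<open>\<delta> > 0\<close> by simp
    qed
  next
    show "\<bar>g x\<bar> \<le> 2 * K" if "g \<in> C 0" "x \<in> X" for g x
      using Cbd[OF that(1)] dK[OF that(2)] by blast
    show "C (Suc n) \<subseteq> C n" for n
      unfolding C_def R_def using less_SucI by blast
    show "C n \<noteq> {}" for n
    proof -
      have "d n \<in> C n"
        unfolding C_def R_def
        by (intro CollectI exI[of _ "Suc n"] exI[of _ "\<lambda>k. if k = n then 1 else 0"]) (auto simp: fun_eq_iff)
      then show ?thesis by blast
    qed
    show "(\<lambda>x. (g x + h x) / 2) \<in> C n" if gC: "g \<in> C n" "h \<in> C n" for n g h
    proof -
      obtain N \<rho> where "R n g N \<rho>" using gC(1) unfolding C_def by blast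
      then have *: "\<forall>k. 0 \<le> \<rho> k" "\<forall>k. k < n \<or> N \<le> k \<longrightarrow> \<rho> k = 0" "(\<Sum>k<N. \<rho> k) = 1"
        "g = (\<lambda>x. \<Sum>k<N. \<rho> k * d k x)" by (simp_all add: R_def)
      obtain N' \<mu> where "R n h N' \<mu>" using gC(2) unfolding C_def by blast
      then have **: "\<forall>k. 0 \<le> \<mu> k" "\<forall>k. k < n \<or> N' \<le> k \<longrightarrow> \<mu> k = 0" "(\<Sum>k<N'. \<mu> k) = 1"
        "h = (\<lambda>x. \<Sum>k<N'. \<mu> k * d k x)" by (simp_all add: R_def)
      define M where "M = max N N'"
      have g: "g = (\<lambda>x. \<Sum>k<M. \<rho> k * d k x)" "(\<Sum>k<M. \<rho> k) = 1"
        using ext[of N M \<rho>] ext[of N M \<rho> "\<lambda>_. 1"] * by (auto simp: M_def)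
      have h: "h = (\<lambda>x. \<Sum>k<M. \<mu> k * d k x)" "(\<Sum>k<M. \<mu> k) = 1"
        using ext[of N' M \<mu>] ext[of N' M \<mu> "\<lambda>_. 1"] ** by (auto simp: M_def)
      show ?thesis
        unfolding C_def R_def g(1) h(1)
      proof (intro CollectI exI[of _ M] exI[of _ "\<lambda>k. (\<rho> k + \<mu> k) / 2"] conjI)
        show "(\<Sum>k<M. (\<rho> k + \<mu> k) / 2) = 1"
          using g h by (simp add: sum.distrib flip: sum_divide_distrib)
        show "(\<lambda>x. ((\<Sum>k<M. \<rho> k * d k x) + (\<Sum>k<M. \<mu> k * d k x)) / 2) = (\<lambda>x. \<Sum>k<M. (\<rho> k + \<mu> k) / 2 * d k x)"
          by (simp add: fun_eq_iff sum_divide_distrib algebra_simps add_divide_distrib flip: sum.distrib)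
      qed (use * ** in \<open>auto simp: M_def\<close>)
    qed
  qed (rule \<open>\<delta> > 0\<close>)
  then obtain g x where gx: "x \<in> X" "\<And>n. g n \<in> C n" "\<not> (\<lambda>n. g n x) \<longlonglongrightarrow> 0" by blast
  obtain l where l: "(\<lambda>n. w n x) \<longlonglongrightarrow> l"
    using conv gx(1) by (auto simp: convergent_def)
  have "(\<lambda>k. d k x) \<longlonglongrightarrow> l - l"
    unfolding d_def
    by (intro tendsto_diff LIMSEQ_subseq_LIMSEQ[OF l, of "\<lambda>k. 2 * k", unfolded o_def]
        LIMSEQ_subseq_LIMSEQ[OF l, of "\<lambda>k. 2 * k + 1", unfolded o_def]) (auto simp: strict_mono_def)
  then have d0: "(\<lambda>k. d k x) \<longlonglongrightarrow> 0" by simp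
  have "(\<lambda>n. g n x) \<longlonglongrightarrow> 0"
  proof (rule LIMSEQ_I)
    fix e :: real assume "0 < e"
    then obtain n0 where n0: "\<And>k. n0 \<le> k \<Longrightarrow> \<bar>d k x\<bar> < e / 2"
      using LIMSEQ_D[OF d0, of "e / 2"] by auto
    have "norm (g n x - 0) < e" if "n0 \<le> n" for n
    proof -
      have "\<bar>g n x\<bar> \<le> e / 2"
        by (rule Cbd[OF gx(2)]) (use n0 that in \<open>auto intro: less_imp_le\<close>)
      then show ?thesis using \<open>0 < e\<close> by simp
    qed
    then show "\<exists>n0. \<forall>n\<ge>n0. norm (g n x - 0) < e" by blast
  qed
  then show False using gx(3) by blast
qed


section \<open>Tameness and independence\<close>

lemma (in group_action) action_maps_to: "g \<in> carrier G \<Longrightarrow> \<phi> g \<in> E \<rightarrow>\<^sub>E E"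
proof -
  assume "g \<in> carrier G"
  then have "\<phi> g \<in> Bij E"
    using group_hom.hom_closed[OF group_hom] by (simp add: BijGroup_def)
  then show ?thesis
    using Bij_imp_funcset Bij_imp_extensional by (auto simp: PiE_def)
qed

text \<open>Tychonoff's theorem gives a cluster point of the translations, although a pointwise
  convergent subsequence need not exist. The clause on closed sets replaces convergence: whatever
  holds at x eventually and is a closed condition passes to p x.\<close>

lemma enveloping_semigroup_cluster:
  fixes X :: "'x::topological_space set"
  assumes X: "compact X" and act: "group_action G X \<phi>" and g: "\<And>n::nat. g n \<in> carrier G"
  shows "\<exists>p. p \<in> enveloping_semigroup G X \<phi> \<and> p \<in> X \<rightarrow>\<^sub>E X \<and>
    (\<forall>x\<in>X. \<forall>n C. closedin (top_of_set X) C \<and> (\<forall>j\<ge>n. \<phi> (g j) x \<in> C) \<longrightarrow> p x \<in> C)"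
proof -
  interpret group_action G X \<phi> by (rule act)
  let ?T = "product_topology (\<lambda>_. top_of_set X) X"
  have top: "topspace ?T = X \<rightarrow>\<^sub>E X" by simp
  have sub: "\<phi> ` g ` {n..} \<subseteq> topspace ?T" for n
    unfolding top using action_maps_to g by blast
  have "compact_space ?T"
    using X by (simp add: compact_space_product_topology compact_space_subtopology)
  then have "\<Inter> (range (\<lambda>n. ?T closure_of (\<phi> ` g ` {n..}))) \<noteq> {}"
    unfolding compact_space_fip
  proof (elim allE impE, intro conjI)
    show "\<forall>C\<in>range (\<lambda>n. ?T closure_of \<phi> ` g ` {n..}). closedin ?T C" by auto
    show "\<forall>\<F>. finite \<F> \<and> \<F> \<subseteq> range (\<lambda>n. ?T closure_of \<phi> ` g ` {n..}) \<longrightarrow> \<Inter> \<F> \<noteq> {}"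
    proof (intro allI impI)
      fix \<F> assume "finite \<F> \<and> \<F> \<subseteq> range (\<lambda>n. ?T closure_of \<phi> ` g ` {n..})"
      then obtain I where I: "finite I" "\<F> = (\<lambda>n. ?T closure_of \<phi> ` g ` {n..}) ` I"
        by (meson finite_subset_image)
      obtain N where N: "\<And>n. n \<in> I \<Longrightarrow> n \<le> N" using I(1) by (meson finite_nat_set_iff_bounded_le)
      have "\<phi> (g N) \<in> ?T closure_of \<phi> ` g ` {n..}" if "n \<in> I" for n
        using closure_of_subset[OF sub[of n]] N[OF that] by auto
      then show "\<Inter> \<F> \<noteq> {}" using I by blast
    qed
  qed simp
  then obtain p where p: "\<And>n. p \<in> ?T closure_of (\<phi> ` g ` {n..})" by blast
  have "p \<in> enveloping_semigroup G X \<phi>"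
    using p[of 0] closure_of_mono[of "\<phi> ` g ` {0..}" "\<phi> ` carrier G" ?T] g
    unfolding enveloping_semigroup_def by blast
  moreover have pX: "p \<in> X \<rightarrow>\<^sub>E X"
    using p[of 0] unfolding in_closure_of top by blast
  moreover have "p x \<in> C" if "x \<in> X" "closedin (top_of_set X) C" "\<forall>j\<ge>n. \<phi> (g j) x \<in> C" for x n C
  proof -
    have "continuous_map ?T (top_of_set X) (\<lambda>q. q x)"
      using that(1) by (rule continuous_map_product_projection)
    then have "closedin ?T {q \<in> topspace ?T. q x \<in> C}"
      using that(2) by (rule closedin_continuous_map_preimage)
    moreover have "\<phi> ` g ` {n..} \<subseteq> {q \<in> topspace ?T. q x \<in> C}"
      using sub[of n] that(3) by auto
    ultimately show ?thesis
      using closure_of_minimal p[of n] by blast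
  qed
  ultimately show ?thesis by blast
qed

lemma compact_Int_INT_nonempty:
  fixes E :: "nat \<Rightarrow> 'x::t2_space set"
  assumes "compact K" "\<And>j. closed (E j)" "\<And>N. K \<inter> (\<Inter>j<N. E j) \<noteq> {}"
  shows "K \<inter> (\<Inter>j. E j) \<noteq> {}"
proof (rule compact_imp_fip_image[OF assms(1,2)])
  fix I :: "nat set" assume "finite I"
  then obtain N where "I \<subseteq> {..<N}" by (meson finite_nat_iff_bounded)
  then have "(\<Inter>j<N. E j) \<subseteq> (\<Inter>j\<in>I. E j)" by (intro INF_superset_mono) auto
  with assms(3)[of N] show "K \<inter> (\<Inter>j\<in>I. E j) \<noteq> {}" by (metis Int_mono subset_empty subset_refl)
qed

text \<open>By Zorn's lemma: the intersection of a chain still meets each D i, because D i is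
  compact and finitely many members of the chain have a smallest one.\<close>

lemma minimal_full_set:
  fixes X :: "'x::t2_space set"
  assumes X: "compact X" and D: "\<And>i. compact (D i)" and full: "\<And>i. X \<inter> D i \<noteq> {}"
  shows "\<exists>C\<subseteq>X. compact C \<and> (\<forall>i. C \<inter> D i \<noteq> {}) \<and>
    (\<forall>C'\<subseteq>C. compact C' \<and> (\<forall>i. C' \<inter> D i \<noteq> {}) \<longrightarrow> C' = C)"
proof -
  define \<C> where "\<C> = {C. C \<subseteq> X \<and> compact C \<and> (\<forall>i. C \<inter> D i \<noteq> {})}"
  \<comment> \<open>Passing to complements turns the search for a minimal set into one for a maximal
    set.\<close>
  have "\<exists>M\<in>uminus ` \<C>. \<forall>U\<in>uminus ` \<C>. M \<subseteq> U \<longrightarrow> U = M"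
  proof (rule subset_Zorn_nonempty)
    show "uminus ` \<C> \<noteq> {}" using X full by (auto simp: \<C>_def)
    fix \<K> assume K: "\<K> \<noteq> {}" "subset.chain (uminus ` \<C>) \<K>"
    define \<D> where "\<D> = uminus ` \<K>"
    have sub: "\<D> \<subseteq> \<C>" using K(2) by (auto simp: \<D>_def subset.chain_def)
    have ne: "\<D> \<noteq> {}" using K(1) by (simp add: \<D>_def)
    have chain: "C \<subseteq> C' \<or> C' \<subseteq> C" if CC: "C \<in> \<D>" "C' \<in> \<D>" for C C'
    proof -
      obtain U U' where "U \<in> \<K>" "U' \<in> \<K>" "C = - U" "C' = - U'"
        using CC by (auto simp: \<D>_def)
      moreover from this have "U \<subseteq> U' \<or> U' \<subseteq> U"
        using K(2) subset.chain_total[of "uminus ` \<C>" \<K> U U'] by blast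
      ultimately show ?thesis by blast
    qed
    obtain C0 where C0: "C0 \<in> \<D>" using ne by blast
    have "\<Inter>\<D> \<in> \<C>"
      unfolding \<C>_def
    proof (intro CollectI conjI allI)
      show "\<Inter>\<D> \<subseteq> X" using C0 sub by (auto simp: \<C>_def)
      have "compact (C0 \<inter> \<Inter>\<D>)"
        using C0 sub by (intro compact_Int_closed closed_Inter) (auto simp: \<C>_def compact_imp_closed)
      then show "compact (\<Inter>\<D>)"
        using C0 by (simp add: inf.absorb2 Inter_lower)
      fix i
      have "D i \<inter> \<Inter>\<D> \<noteq> {}"
      proof (rule compact_imp_fip[OF D])
        show "closed T" if "T \<in> \<D>" for T
          using that sub compact_imp_closed by (auto simp: \<C>_def)
        fix \<F> assume F: "finite \<F>" "\<F> \<subseteq> \<D>"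
        have "\<exists>C\<in>\<D>. C \<subseteq> \<Inter>\<F>"
          using F
        proof (induction \<F> rule: finite_induct)
          case empty
          then show ?case using C0 by auto
        next
          case (insert F \<F>)
          then obtain C where "C \<in> \<D>" "C \<subseteq> \<Inter>\<F>" by auto
          then show ?case using chain[of C F] insert.prems by auto
        qed
        then obtain C where C: "C \<in> \<D>" "C \<subseteq> \<Inter>\<F>" by blast
        then have "C \<inter> D i \<noteq> {}" using sub by (auto simp: \<C>_def)
        then show "D i \<inter> \<Inter>\<F> \<noteq> {}" using C(2) by blast
      qed
      then show "\<Inter>\<D> \<inter> D i \<noteq> {}" by blast
    qed
    moreover have "\<Union>\<K> = - \<Inter>\<D>" by (auto simp: \<D>_def)
    ultimately show "\<Union>\<K> \<in> uminus ` \<C>" by simp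
  qed
  then obtain M where M: "M \<in> uminus ` \<C>" "\<forall>U\<in>uminus ` \<C>. M \<subseteq> U \<longrightarrow> U = M"
    by (elim bexE)
  from M(1) obtain C where C: "M = - C" "C \<in> \<C>" by (rule imageE)
  have "C' = C" if "C' \<in> \<C>" "C' \<subseteq> C" for C'
    using M(2)[rule_format, of "- C'"] C(1) that by simp
  then have "\<forall>C'\<subseteq>C. compact C' \<and> (\<forall>i. C' \<inter> D i \<noteq> {}) \<longrightarrow> C' = C"
    using C by (auto simp: \<C>_def)
  moreover have "C \<subseteq> X" "compact C" "\<forall>i. C \<inter> D i \<noteq> {}"
    using C by (simp_all add: \<C>_def)
  ultimately have "C \<subseteq> X \<and> compact C \<and> (\<forall>i. C \<inter> D i \<noteq> {}) \<and>
    (\<forall>C'\<subseteq>C. compact C' \<and> (\<forall>i. C' \<inter> D i \<noteq> {}) \<longrightarrow> C' = C)"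
    by (intro conjI)
  then show ?thesis by (rule exI)
qed

text \<open>
  On a minimal compact set realising all patterns, every relatively open set contains points whose
  patterns are eventually constant, of both kinds.  A cluster point of the \<open>\<phi> (g n)\<close> is therefore
  discontinuous on that set.
\<close>

lemma tame_imp_not_independent:
  fixes X :: "'x::metric_space set" and f :: "'x \<Rightarrow> real"
  assumes X: "compact X" and act: "group_action G X \<phi>"
    and cont: "\<And>g. g \<in> carrier G \<Longrightarrow> continuous_on X (\<phi> g)"
    and tame: "tame_system G X \<phi>" and f: "continuous_on X f"
    and g: "\<And>n::nat. g n \<in> carrier G" and ab: "a < b"
  shows "\<exists>N \<epsilon>. \<forall>x\<in>X. \<exists>j<N. \<not> (if \<epsilon> j then f (\<phi> (g j) x) \<le> a else b \<le> f (\<phi> (g j) x))"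
proof (rule ccontr)
  assume neg: "\<not> ?thesis"
  have ind: "\<exists>x\<in>X. \<forall>j<N. if \<epsilon> j then f (\<phi> (g j) x) \<le> a else b \<le> f (\<phi> (g j) x)" for N \<epsilon>
  proof (rule ccontr)
    assume "\<not> ?thesis"
    then have "\<forall>x\<in>X. \<exists>j<N. \<not> (if \<epsilon> j then f (\<phi> (g j) x) \<le> a else b \<le> f (\<phi> (g j) x))"
      by blast
    with neg show False by (elim notE, intro exI[of _ N] exI[of _ \<epsilon>])
  qed
  interpret group_action G X \<phi> by (rule act)
  define E where "E \<epsilon> j = {x\<in>X. if \<epsilon> j then f (\<phi> (g j) x) \<le> a else b \<le> f (\<phi> (g j) x)}" for \<epsilon> :: "nat \<Rightarrow> bool" and j
  have closed_X: "closed X" using X compact_imp_closed by blast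
  have contf: "continuous_on X (\<lambda>x. f (\<phi> (g j) x))" for j
    using continuous_on_compose2[OF f cont[OF g[of j]]] action_maps_to[OF g[of j]] by auto
  have closed_E: "closed (E \<epsilon> j)" for \<epsilon> j
    unfolding E_def using contf[of j] closed_X
    by (cases "\<epsilon> j") (simp_all add: continuous_on_closed_Collect_le)
  \<comment> \<open>These are the points realising an entire infinite pattern. Independence concerns
    finite patterns only; compactness makes these sets nonempty.\<close>
  define D where "D \<epsilon> = (\<Inter>j. E \<epsilon> j)" for \<epsilon>
  have DX: "D \<epsilon> \<subseteq> X" for \<epsilon> by (auto simp: D_def E_def)
  have fin: "\<exists>N. C \<inter> (\<Inter>j<N. E \<epsilon> j) = {}" if "compact C" "C \<inter> D \<epsilon> = {}" for C \<epsilon>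
  proof (rule ccontr)
    assume neg: "\<nexists>N. C \<inter> (\<Inter>j<N. E \<epsilon> j) = {}"
    then have "C \<inter> (\<Inter>j. E \<epsilon> j) \<noteq> {}"
      by (intro compact_Int_INT_nonempty[OF that(1) closed_E]) simp
    then show False using that(2) by (simp add: D_def)
  qed
  have "X \<inter> (\<Inter>j<N. E \<epsilon> j) \<noteq> {}" for N \<epsilon>
  proof -
    obtain x where "x \<in> X" "\<forall>j<N. if \<epsilon> j then f (\<phi> (g j) x) \<le> a else b \<le> f (\<phi> (g j) x)"
      using ind[of N \<epsilon>] by (elim bexE)
    then have "x \<in> X \<inter> (\<Inter>j<N. E \<epsilon> j)" unfolding E_def by simp
    then show ?thesis by (metis empty_iff)
  qed
  then have full: "X \<inter> D \<epsilon> \<noteq> {}" for \<epsilon>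
    using fin[OF X, of \<epsilon>] by (metis (no_types, lifting))
  have "compact (D \<epsilon>)" for \<epsilon>
    using compact_Int_closed[OF X, of "D \<epsilon>"] closed_E DX[of \<epsilon>] by (simp add: D_def closed_INT inf.absorb2)
  from minimal_full_set[of X D, OF X this full] obtain C where C: "C \<subseteq> X" "compact C" "\<And>\<epsilon>. C \<inter> D \<epsilon> \<noteq> {}"
    and min: "\<forall>C'\<subseteq>C. compact C' \<and> (\<forall>\<epsilon>. C' \<inter> D \<epsilon> \<noteq> {}) \<longrightarrow> C' = C"
    by (elim exE conjE) blast
  obtain p where p: "p \<in> enveloping_semigroup G X \<phi>" "p \<in> X \<rightarrow>\<^sub>E X"
    and lim: "\<And>x n K. x \<in> X \<Longrightarrow> closedin (top_of_set X) K \<Longrightarrow> (\<forall>j\<ge>n. \<phi> (g j) x \<in> K) \<Longrightarrow> p x \<in> K"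
    using enveloping_semigroup_cluster[of X G \<phi> g, OF X act g] by (elim exE conjE) simp
  have pX: "p x \<in> X" if "x \<in> X" for x using p(2) that by blast
  have "uniformly_continuous_on X f" using f X compact_uniformly_continuous by blast
  then obtain d where d: "d > 0" "\<And>x y. x \<in> X \<Longrightarrow> y \<in> X \<Longrightarrow> dist x y < d \<Longrightarrow> dist (f x) (f y) < b - a"
    unfolding uniformly_continuous_on_def using ab by (metis diff_gt_0_iff_gt)
  have "eventually (\<lambda>(x, y). dist x y < d) (uniformity :: ('x \<times> 'x) filter)"
    unfolding eventually_uniformity_metric using d(1) by auto
  moreover have "C \<noteq> {}" using C(3)[of "\<lambda>_. True"] by blast
  moreover have "fragmented_map X p" using tame p(1) by (simp add: tame_system_def)
  ultimately have "\<exists>U. openin (top_of_set X) U \<and> U \<inter> C \<noteq> {} \<and>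
      (\<forall>y\<in>p ` (U \<inter> C). \<forall>z\<in>p ` (U \<inter> C). (\<lambda>(x, y). dist x y < d) (y, z))"
    unfolding fragmented_map_def using C(1)
    by (elim allE[of _ C] allE[of _ "\<lambda>(x, y). dist x y < d"] impE) auto
  then obtain U where U: "openin (top_of_set X) U" "U \<inter> C \<noteq> {}"
    and small: "\<And>y z. y \<in> U \<inter> C \<Longrightarrow> z \<in> U \<inter> C \<Longrightarrow> dist (p y) (p z) < d"
    by auto
  have "compact (C - U)"
  proof -
    have "closedin (top_of_set X) (X - U)" using U(1) by (simp add: openin_closedin_eq)
    then have "closed (X - U)" using closed_X closedin_closed_trans by blast
    then have "compact (C \<inter> (X - U))" using C(2) by (simp add: compact_Int_closed)
    moreover have "C \<inter> (X - U) = C - U" using C(1) by blast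
    ultimately show ?thesis by simp
  qed
  moreover have "C - U \<noteq> C" using U(2) by blast
  ultimately have "\<not> (\<forall>\<epsilon>. (C - U) \<inter> D \<epsilon> \<noteq> {})" using min[rule_format, of "C - U"] by auto
  then obtain \<epsilon> where "(C - U) \<inter> D \<epsilon> = {}" by auto
  \<comment> \<open>The compact set C - U is a proper subset of the minimal C, so it misses some
    complete pattern, and by compactness already the first N conditions of it.\<close>
  then obtain N where N: "(C - U) \<inter> (\<Inter>j<N. E \<epsilon> j) = {}"
    using fin[OF \<open>compact (C - U)\<close>, of \<epsilon>] by auto
  \<comment> \<open>The excluded initial pattern is continued by the constant v. A point of C
    realising the result cannot lie in C - U, so U contains points of C of both eventual
    kinds.\<close>
  have key: "\<exists>x\<in>U \<inter> C. \<forall>j\<ge>N. x \<in> E (\<lambda>_. v) j" for v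
  proof -
    obtain x where x: "x \<in> C" "x \<in> D (\<lambda>j. if j < N then \<epsilon> j else v)" using C(3)[of "\<lambda>j. if j < N then \<epsilon> j else v"] by blast
    have "x \<in> E (\<lambda>j. if j < N then \<epsilon> j else v) j" for j using x by (auto simp: D_def)
    then have *: "x \<in> X" "if (if j < N then \<epsilon> j else v) then f (\<phi> (g j) x) \<le> a else b \<le> f (\<phi> (g j) x)" for j
      unfolding E_def by auto
    have "x \<in> E \<epsilon> j" if "j < N" for j
      using *(1) *(2)[of j] that unfolding E_def by simp
    then have "x \<in> (\<Inter>j<N. E \<epsilon> j)" by simp
    then have "x \<in> U" using N x(1) by (metis DiffI IntI empty_iff)
    moreover have "x \<in> E (\<lambda>_. v) j" if "N \<le> j" for j
      using *(1) *(2)[of j] that unfolding E_def by (simp add: not_less)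
    ultimately show ?thesis using x by blast
  qed
  obtain x where x: "x \<in> U \<inter> C" "\<forall>j\<ge>N. x \<in> E (\<lambda>_. True) j" using key[of True] by (elim bexE)
  obtain y where y: "y \<in> U \<inter> C" "\<forall>j\<ge>N. y \<in> E (\<lambda>_. False) j" using key[of False] by (elim bexE)
  have xy: "x \<in> X" "y \<in> X" using x y C by auto
  have gX: "\<phi> (g j) z \<in> X" if "z \<in> X" for j z using action_maps_to[OF g[of j]] that by blast
  \<comment> \<open>Both level sets are closed, so the cluster point p sends x into the lower and y
    into the upper one. As x and y lie in the same set U, where p varies by less than d, the gap b -
    a is violated.\<close>
  have "closedin (top_of_set X) {z \<in> X. f z \<le> a}" "closedin (top_of_set X) {z \<in> X. b \<le> f z}"
    using f closed_X by (auto intro!: closed_subset continuous_on_closed_Collect_le continuous_on_const)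
  then have "p x \<in> {z \<in> X. f z \<le> a}" "p y \<in> {z \<in> X. b \<le> f z}"
    using x(2) y(2) xy gX lim[of x "{z \<in> X. f z \<le> a}" N] lim[of y "{z \<in> X. b \<le> f z}" N]
    by (simp_all add: E_def)
  moreover have "dist (f (p x)) (f (p y)) < b - a"
    using d(2) small[OF x(1) y(1)] pX xy by blast
  ultimately show False by (auto simp: dist_real_def abs_less_iff)
qed

text \<open>Independence was excluded for one fixed function f, whereas here the base points y n
  vary. Along a subsequence they converge to some y0; the distance to y0 serves as f, and replacing
  y0 by y n costs an error tending to 0.\<close>

lemma tame_imp_pointwise_convergent_subseq:
  fixes X :: "'x::metric_space set"
  assumes X: "compact X" and act: "group_action G X \<phi>"
    and cont: "\<And>g. g \<in> carrier G \<Longrightarrow> continuous_on X (\<phi> g)"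
    and tame: "tame_system G X \<phi>"
    and g: "\<And>n::nat. g n \<in> carrier G" and y: "\<And>n. y n \<in> X"
  shows "\<exists>r. strict_mono (r :: nat \<Rightarrow> nat) \<and>
    (\<forall>x\<in>X. convergent (\<lambda>n. dist (\<phi> (g (r n)) x) (y (r n))))"
proof -
  interpret group_action G X \<phi> by (rule act)
  obtain y0 and s :: "nat \<Rightarrow> nat" where s: "y0 \<in> X" "strict_mono s" "(y \<circ> s) \<longlonglongrightarrow> y0"
    using seq_compactE[OF compact_imp_seq_compact[OF X], of y] y by (metis (no_types))
  have gX: "\<phi> (g j) z \<in> X" if "z \<in> X" for j z using action_maps_to[OF g[of j]] that by blast
  obtain C where C: "\<And>u. u \<in> X \<Longrightarrow> dist y0 u \<le> C"
    using compact_imp_bounded[OF X] unfolding bounded_any_center[of _ y0] by blast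
  have "\<exists>r. strict_mono (r :: nat \<Rightarrow> nat) \<and> (\<forall>x\<in>X. convergent (\<lambda>n. dist (\<phi> (g (s (r n))) x) y0))"
  proof (rule pointwise_convergent_or_independent)
    show "\<exists>C. \<forall>n. \<bar>dist (\<phi> (g (s n)) x) y0\<bar> \<le> C" if "x \<in> X" for x
      by (intro exI[of _ C]) (simp add: C gX that dist_commute[of _ y0])
    fix a b :: real and r :: "nat \<Rightarrow> nat" assume "a < b"
    then show "\<exists>N \<epsilon>. \<forall>x\<in>X. \<exists>j<N. \<not> (if \<epsilon> j then dist (\<phi> (g (s (r j))) x) y0 \<le> a
        else b \<le> dist (\<phi> (g (s (r j))) x) y0)"
      by (intro tame_imp_not_independent[OF X act cont tame, where f = "\<lambda>z. dist z y0"] continuous_intros g)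
  qed
  then obtain r :: "nat \<Rightarrow> nat" where r: "strict_mono r"
    "\<And>x. x \<in> X \<Longrightarrow> convergent (\<lambda>n. dist (\<phi> (g (s (r n))) x) y0)" by blast
  have ys: "(\<lambda>n. y (s (r n))) \<longlonglongrightarrow> y0"
    using LIMSEQ_subseq_LIMSEQ[OF s(3) r(1)] by (simp add: o_def)
  have "convergent (\<lambda>n. dist (\<phi> (g (s (r n))) x) (y (s (r n))))" if x: "x \<in> X" for x
  proof -
    obtain l where l: "(\<lambda>n. dist (\<phi> (g (s (r n))) x) y0) \<longlonglongrightarrow> l"
      using r(2)[OF x] by (auto simp: convergent_def)
    have "(\<lambda>n. dist (\<phi> (g (s (r n))) x) (y (s (r n))) - dist (\<phi> (g (s (r n))) x) y0) \<longlonglongrightarrow> 0"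
    proof (rule tendsto_0_le[where K = 1])
      show "(\<lambda>n. dist (y (s (r n))) y0) \<longlonglongrightarrow> 0"
        by (rule tendsto_dist_iff[THEN iffD1, OF ys])
      show "\<forall>\<^sub>F n in sequentially. norm (dist (\<phi> (g (s (r n))) x) (y (s (r n))) - dist (\<phi> (g (s (r n))) x) y0)
          \<le> norm (dist (y (s (r n))) y0) * 1"
      proof (intro always_eventually allI)
        fix n
        show "norm (dist (\<phi> (g (s (r n))) x) (y (s (r n))) - dist (\<phi> (g (s (r n))) x) y0)
            \<le> norm (dist (y (s (r n))) y0) * 1"
          using abs_dist_diff_le[of "y (s (r n))" "\<phi> (g (s (r n))) x" y0]
          by (simp add: dist_commute[of "y (s (r n))" "\<phi> (g (s (r n))) x"])
      qed
    qed
    from tendsto_add[OF this l] show ?thesis by (auto simp: convergent_def)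
  qed
  moreover have "strict_mono (s \<circ> r)" using s(2) r(1) by (simp add: strict_mono_o)
  ultimately show ?thesis by (intro exI[of _ "s \<circ> r"]) simp
qed


section \<open>Absolutely convex combinations of tame families\<close>

text \<open>The number r is the coefficient mass of one particular representation of w, with
  repetitions allowed, so the same w may carry many values of r.\<close>

inductive abs_combination :: "('a \<Rightarrow> real) set \<Rightarrow> ('a \<Rightarrow> real) \<Rightarrow> real \<Rightarrow> bool" for F where
  zero: "abs_combination F (\<lambda>_. 0) 0"
| add: "abs_combination F w r \<Longrightarrow> f \<in> F \<Longrightarrow> abs_combination F (\<lambda>x. w x + c * f x) (r + \<bar>c\<bar>)"

section \<open>Rademacher functions on the coin-tossing space\<close>

definition coin_space :: "(nat \<Rightarrow> bool) measure"
  where "coin_space = PiM UNIV (\<lambda>_. measure_pmf (bernoulli_pmf (1/2)))"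

text \<open>The sign is chosen to agree with patterns, in which True stands for a value at most a
  and False for a value at least b: functions following the pattern then correlate
  positively.\<close>

definition rademacher :: "nat \<Rightarrow> (nat \<Rightarrow> bool) \<Rightarrow> real"
  where "rademacher k \<omega> = (if \<omega> k then -1 else 1)"

interpretation coin_space: prob_space coin_space
  unfolding coin_space_def by (intro prob_space_PiM prob_space_measure_pmf)

lemma space_coin_space [simp]: "space coin_space = UNIV"
  by (simp add: coin_space_def space_PiM)

lemma prob_UNIV_coin_space [simp]: "measure coin_space UNIV = 1"
  using coin_space.prob_space by simp

lemma measurable_coin [measurable]: "Measurable.pred coin_space (\<lambda>\<omega>. \<omega> k)"
proof -
  have "(\<lambda>\<omega>. \<omega> k) \<in> measurable coin_space (measure_pmf (bernoulli_pmf (1/2)))"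
    unfolding coin_space_def by (rule measurable_component_singleton) simp
  then show ?thesis by (simp add: pred_def) measurable
qed

lemma measurable_rademacher [measurable]: "rademacher k \<in> borel_measurable coin_space"
  unfolding rademacher_def by measurable

lemma prob_coin_subset:
  assumes "finite J"
  shows "measure coin_space {\<omega>. \<forall>j\<in>J. \<omega> j} = (1/2) ^ card J"
proof -
  interpret P: product_prob_space "\<lambda>_::nat. measure_pmf (bernoulli_pmf (1/2))" UNIV
    by unfold_locales
  have "{\<omega>. \<forall>j\<in>J. \<omega> j} = P.emb UNIV J (PiE J (\<lambda>_. {True}))"
    by (auto simp: prod_emb_def PiE_iff restrict_def extensional_def fun_eq_iff space_PiM)
  then show ?thesis
    using P.measure_PiM_emb[of J "\<lambda>_. {True}"] assms
    by (simp add: coin_space_def measure_pmf_single)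
qed

lemma rademacher_indicator: "rademacher k \<omega> = 1 - 2 * indicat_real {\<omega>. \<omega> k} \<omega>"
  by (simp add: rademacher_def)

lemma integrable_coin:
  fixes f :: "(nat \<Rightarrow> bool) \<Rightarrow> real"
  assumes "f \<in> borel_measurable coin_space" "\<And>\<omega>. \<bar>f \<omega>\<bar> \<le> B"
  shows "integrable coin_space f"
  by (rule coin_space.integrable_const_bound[of _ B]) (use assms in auto)

lemma sets_coin [measurable]: "{\<omega>. \<omega> k} \<in> sets coin_space"
  using measurable_coin[of k] by (simp add: pred_def)

lemma integral_rademacher: "(\<integral>\<omega>. rademacher k \<omega> \<partial>coin_space) = 0"
proof -
  have "integrable coin_space (\<lambda>\<omega>. indicat_real {\<omega>. \<omega> k} \<omega>)"
    by (rule integrable_coin[of _ 1]) (auto simp: indicator_def)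
  then show ?thesis
    using prob_coin_subset[of "{k}"] unfolding rademacher_indicator by simp
qed

lemma integral_rademacher_mult:
  "(\<integral>\<omega>. rademacher j \<omega> * rademacher k \<omega> \<partial>coin_space) = (if j = k then 1 else 0)"
proof (cases "j = k")
  case True
  have "(\<lambda>\<omega>. rademacher k \<omega> * rademacher k \<omega>) = (\<lambda>_. 1)"
    by (auto simp: rademacher_def)
  with True show ?thesis by simp
next
  case False
  let ?I = "\<lambda>S. indicat_real S :: (nat \<Rightarrow> bool) \<Rightarrow> real"
  have eq: "rademacher j \<omega> * rademacher k \<omega> = 1 - 2 * ?I {\<omega>. \<omega> j} \<omega> - 2 * ?I {\<omega>. \<omega> k} \<omega>
      + 4 * ?I ({\<omega>. \<omega> j} \<inter> {\<omega>. \<omega> k}) \<omega>" for \<omega>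
    by (simp add: rademacher_def indicator_def)
  have int: "integrable coin_space (?I S)" if [measurable]: "S \<in> sets coin_space" for S
    by (rule integrable_coin[of _ 1]) (auto simp: indicator_def)
  have "{\<omega>::nat \<Rightarrow> bool. \<omega> j} \<inter> {\<omega>. \<omega> k} = {\<omega>. \<forall>i\<in>{j, k}. \<omega> i}" by auto
  then have "measure coin_space ({\<omega>. \<omega> j} \<inter> {\<omega>. \<omega> k}) = 1 / 4"
    using prob_coin_subset[of "{j, k}"] False by (simp add: power2_eq_square)
  then show ?thesis
    using prob_coin_subset[of "{j}"] prob_coin_subset[of "{k}"] False int[of "{\<omega>. \<omega> j}"] int[of "{\<omega>. \<omega> k}"]
      int[of "{\<omega>. \<omega> j} \<inter> {\<omega>. \<omega> k}"]
    unfolding eq by simp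
qed

text \<open>The Rademacher functions are orthonormal, so by Bessel's inequality the squared
  coefficients add up to at most the square of C, and at most \<open>C\<^sup>2 / c\<^sup>2\<close>
  of them can reach c.\<close>

lemma rademacher_coefficients_finite:
  assumes h [measurable]: "h \<in> borel_measurable coin_space" and C: "\<And>\<omega>. \<bar>h \<omega>\<bar> \<le> C" and "c > 0"
  shows "finite {k. c \<le> \<bar>\<integral>\<omega>. h \<omega> * rademacher k \<omega> \<partial>coin_space\<bar>}"
proof -
  define a where "a k = (\<integral>\<omega>. h \<omega> * rademacher k \<omega> \<partial>coin_space)" for k
  have rad: "\<bar>rademacher k \<omega>\<bar> = 1" for k \<omega> by (simp add: rademacher_def)
  have bessel: "(\<Sum>k\<in>K. (a k)\<^sup>2) \<le> C\<^sup>2" if "finite K" for K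
  proof -
    let ?S = "\<lambda>\<omega>. \<Sum>k\<in>K. a k * rademacher k \<omega>"
    have i1: "integrable coin_space (\<lambda>\<omega>. h \<omega> * rademacher k \<omega>)" for k
      by (rule integrable_coin[of _ C]) (auto simp: abs_mult rad C)
    have i2: "integrable coin_space (\<lambda>\<omega>. rademacher j \<omega> * rademacher k \<omega>)" for j k
      by (rule integrable_coin[of _ 1]) (auto simp: abs_mult rad)
    have hC: "(h \<omega>)\<^sup>2 \<le> C\<^sup>2" for \<omega> using power_mono[OF C[of \<omega>], of 2] by simp
    have i3: "integrable coin_space (\<lambda>\<omega>. (h \<omega>)\<^sup>2)"
      by (rule integrable_coin[of _ "C\<^sup>2"]) (auto simp: hC)
    have hS: "h \<omega> * ?S \<omega> = (\<Sum>k\<in>K. a k * (h \<omega> * rademacher k \<omega>))" for \<omega>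
      by (simp add: sum_distrib_left algebra_simps)
    have SS: "?S \<omega> * ?S \<omega> = (\<Sum>j\<in>K. \<Sum>k\<in>K. a j * a k * (rademacher j \<omega> * rademacher k \<omega>))" for \<omega>
      by (simp add: sum_product algebra_simps)
    have "0 \<le> (\<integral>\<omega>. (h \<omega> - ?S \<omega>)\<^sup>2 \<partial>coin_space)" by simp
    also have "(\<lambda>\<omega>. (h \<omega> - ?S \<omega>)\<^sup>2) = (\<lambda>\<omega>. (h \<omega>)\<^sup>2 - 2 * (h \<omega> * ?S \<omega>) + ?S \<omega> * ?S \<omega>)"
      by (simp add: fun_eq_iff power2_eq_square algebra_simps)
    also have "(\<integral>\<omega>. (h \<omega>)\<^sup>2 - 2 * (h \<omega> * ?S \<omega>) + ?S \<omega> * ?S \<omega> \<partial>coin_space)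
        = (\<integral>\<omega>. (h \<omega>)\<^sup>2 \<partial>coin_space) - 2 * (\<Sum>k\<in>K. a k * a k) + (\<Sum>j\<in>K. \<Sum>k\<in>K. a j * a k * (if j = k then 1 else 0))"
      unfolding hS SS using i1 i2 i3 by (simp add: integral_rademacher_mult flip: a_def)
    also have "(\<Sum>j\<in>K. \<Sum>k\<in>K. a j * a k * (if j = k then 1 else 0)) = (\<Sum>k\<in>K. a k * a k)"
      using that by (simp add: if_distrib[of "\<lambda>t. _ * t"] sum.delta cong: if_cong)
    also have "(\<integral>\<omega>. (h \<omega>)\<^sup>2 \<partial>coin_space) \<le> C\<^sup>2"
      using coin_space.integral_le_const[OF i3] hC by simp
    finally show ?thesis by (simp add: power2_eq_square)
  qed
  have "card K \<le> C\<^sup>2 / c\<^sup>2" if K: "finite K" "K \<subseteq> {k. c \<le> \<bar>a k\<bar>}" for K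
  proof -
    have "card K * c\<^sup>2 \<le> (\<Sum>k\<in>K. (a k)\<^sup>2)"
    proof -
      have "c\<^sup>2 \<le> (a k)\<^sup>2" if "k \<in> K" for k
        using K(2) that power_mono[of c "\<bar>a k\<bar>" 2] \<open>c > 0\<close> by auto
      then show ?thesis using sum_bounded_below[of K "c\<^sup>2" "\<lambda>k. (a k)\<^sup>2"] by simp
    qed
    then show ?thesis using bessel[OF K(1)] \<open>c > 0\<close> by (simp add: field_simps)
  qed
  then have "\<And>K. K \<subseteq> {k. c \<le> \<bar>a k\<bar>} \<Longrightarrow> finite K \<Longrightarrow> card K \<le> nat \<lfloor>C\<^sup>2 / c\<^sup>2\<rfloor>"
    by (intro le_nat_floor) simp
  then have "finite {k. c \<le> \<bar>a k\<bar>}"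
    using finite_if_finite_subsets_card_bdd[of "{k. c \<le> \<bar>a k\<bar>}" "nat \<lfloor>C\<^sup>2 / c\<^sup>2\<rfloor>"] by blast
  then show ?thesis by (simp add: a_def)
qed

text \<open>
  The selection is the limit of choices, among finitely many balls of radius \<open>1 / 2 ^ n\<close>, of the
  first one that still meets the set of admissible points.
\<close>

lemma measurable_selection:
  fixes X :: "'a::metric_space set" and w :: "nat \<Rightarrow> 'a \<Rightarrow> real"
  assumes X: "compact X" and cont: "\<And>j. continuous_on X (w j)"
    and ind: "\<And>N \<omega>. \<exists>x\<in>X. \<forall>j<N. if \<omega> j then w j x \<le> a else b \<le> w j x"
  shows "\<exists>s. (\<forall>\<omega>. s \<omega> \<in> X \<and> (\<forall>j. if \<omega> j then w j (s \<omega>) \<le> a else b \<le> w j (s \<omega>))) \<and>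
    (\<forall>f. continuous_on X f \<longrightarrow> (\<lambda>\<omega>. f (s \<omega>) :: real) \<in> borel_measurable coin_space)"
proof -
  have closed_X: "closed X" using X compact_imp_closed by blast
  define E where "E \<omega> j = {x\<in>X. if \<omega> j then w j x \<le> a else b \<le> w j x}" for \<omega> :: "nat \<Rightarrow> bool" and j
  have closed_E: "closed (E \<omega> j)" for \<omega> j
    unfolding E_def using cont[of j] closed_X
    by (cases "\<omega> j") (simp_all add: continuous_on_closed_Collect_le)
  define D where "D \<omega> = (\<Inter>j. E \<omega> j)" for \<omega>
  have closed_D: "closed (D \<omega>)" for \<omega> unfolding D_def using closed_E by blast
  have fin: "(K \<inter> D \<omega> \<noteq> {}) \<longleftrightarrow> (\<forall>N. \<exists>x\<in>K. \<forall>j<N. x \<in> E \<omega> j)" if K: "compact K" for K \<omega>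
  proof
    assume "K \<inter> D \<omega> \<noteq> {}"
    then obtain x where "x \<in> K" "x \<in> D \<omega>" by (meson IntE equals0I)
    then show "\<forall>N. \<exists>x\<in>K. \<forall>j<N. x \<in> E \<omega> j" by (auto simp: D_def)
  next
    assume all: "\<forall>N. \<exists>x\<in>K. \<forall>j<N. x \<in> E \<omega> j"
    have "K \<inter> (\<Inter>j. E \<omega> j) \<noteq> {}"
    proof (rule compact_Int_INT_nonempty[OF K closed_E])
      fix N
      obtain x where "x \<in> K" "\<forall>j<N. x \<in> E \<omega> j" using all by meson
      then have "x \<in> K \<inter> (\<Inter>j<N. E \<omega> j)" by simp
      then show "K \<inter> (\<Inter>j<N. E \<omega> j) \<noteq> {}" by (metis empty_iff)
    qed
    then show "K \<inter> D \<omega> \<noteq> {}" by (simp add: D_def)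
  qed
  \<comment> \<open>By compactness, \<open>D \<omega>\<close> meets K iff for every N some point of
    K satisfies the first N conditions. For fixed N this depends on finitely many coordinates of
    \<omega>, so the event is a finite union of cylinders, indexed by the set T of coordinates that
    are True.\<close>
  have meas_hit: "Measurable.pred coin_space (\<lambda>\<omega>. K \<inter> D \<omega> \<noteq> {})" if K: "compact K" for K
  proof -
    have eq: "(\<exists>x\<in>K. \<forall>j<N. x \<in> E \<omega> j) \<longleftrightarrow>
        (\<exists>T\<in>Pow {..<N}. (\<forall>j\<in>{..<N}. \<omega> j \<longleftrightarrow> j \<in> T) \<and> (\<exists>x\<in>K. \<forall>j<N. x \<in> E (\<lambda>j. j \<in> T) j))" for N \<omega>
    proof
      assume "\<exists>x\<in>K. \<forall>j<N. x \<in> E \<omega> j"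
      then show "\<exists>T\<in>Pow {..<N}. (\<forall>j\<in>{..<N}. \<omega> j \<longleftrightarrow> j \<in> T) \<and> (\<exists>x\<in>K. \<forall>j<N. x \<in> E (\<lambda>j. j \<in> T) j)"
        by (intro bexI[of _ "{j. j < N \<and> \<omega> j}"]) (auto simp: E_def)
    next
      assume "\<exists>T\<in>Pow {..<N}. (\<forall>j\<in>{..<N}. \<omega> j \<longleftrightarrow> j \<in> T) \<and> (\<exists>x\<in>K. \<forall>j<N. x \<in> E (\<lambda>j. j \<in> T) j)"
      then show "\<exists>x\<in>K. \<forall>j<N. x \<in> E \<omega> j" by (auto simp: E_def)
    qed
    have pat: "Measurable.pred coin_space (\<lambda>\<omega>. (\<forall>j\<in>{..<N}. \<omega> j \<longleftrightarrow> j \<in> T) \<and> (\<exists>x\<in>K. \<forall>j<N. x \<in> E (\<lambda>j. j \<in> T) j))"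
      for N T by measurable
    have "Measurable.pred coin_space (\<lambda>\<omega>. \<exists>x\<in>K. \<forall>j<N. x \<in> E \<omega> j)" for N
      by (subst eq) (rule pred_intros_finite(4)[OF _ pat], simp)
    then show ?thesis unfolding fin[OF K] by (rule pred_intros_countable(1))
  qed
  have "\<exists>p :: (nat \<Rightarrow> 'a) \<times> nat. (\<forall>i<snd p. fst p i \<in> X) \<and> X \<subseteq> (\<Union>i<snd p. cball (fst p i) (1 / 2 ^ n))" for n :: nat
  proof -
    obtain k where k: "k \<subseteq> X" "finite k" "X \<subseteq> (\<Union>x\<in>k. ball x (1 / 2 ^ n))"
      using X by (rule compactE_image[of X X "\<lambda>x. ball x (1 / 2 ^ n)"]) auto
    obtain c where c: "k = c ` {i. i < card k}"
      using finite_imp_nat_seg_image_inj_on[OF k(2)] by (metis card_Collect_less_nat card_image)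
    have "X \<subseteq> (\<Union>i<card k. cball (c i) (1 / 2 ^ n))"
    proof
      fix x assume "x \<in> X"
      then obtain y where "y \<in> k" "x \<in> ball y (1 / 2 ^ n)" using k(3) by auto
      moreover from this obtain i where "i < card k" "y = c i" using c by auto
      ultimately show "x \<in> (\<Union>i<card k. cball (c i) (1 / 2 ^ n))" by (auto intro: less_imp_le)
    qed
    moreover have "\<forall>i<card k. c i \<in> X" using c k(1) by auto
    ultimately show ?thesis by (intro exI[of _ "(c, card k)"]) simp
  qed
  then obtain p :: "nat \<Rightarrow> (nat \<Rightarrow> 'a) \<times> nat" where p: "\<forall>n. (\<forall>i<snd (p n). fst (p n) i \<in> X) \<and>
      X \<subseteq> (\<Union>i<snd (p n). cball (fst (p n) i) (1 / 2 ^ n))"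
    using choice[of "\<lambda>n p. (\<forall>i<snd p. fst p i \<in> X) \<and> X \<subseteq> (\<Union>i<snd p. cball (fst p i) (1 / 2 ^ n))"]
    by auto
  define c where "c n = fst (p n)" for n
  define m where "m n = snd (p n)" for n
  have cX: "\<And>n i. i < m n \<Longrightarrow> c n i \<in> X"
    and cover: "\<And>n. X \<subseteq> (\<Union>i<m n. cball (c n i) (1 / 2 ^ n))"
    using p unfolding c_def m_def by (blast, simp)
  define F where "F l = (\<Inter>n\<in>{..<length l}. cball (c n (l ! n)) (1 / 2 ^ n))" for l
  have F_Nil: "F [] = UNIV" by (simp add: F_def)
  have F_snoc: "F (l @ [i]) = F l \<inter> cball (c (length l) i) (1 / 2 ^ length l)" for l i
  proof -
    have "(\<Inter>n\<in>{..<length l}. cball (c n ((l @ [i]) ! n)) (1 / 2 ^ n)) = F l"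
      unfolding F_def by (intro INF_cong) (auto simp: nth_append)
    then show ?thesis by (simp add: F_def lessThan_Suc Int_commute)
  qed
  have compact_F: "compact (X \<inter> F l)" for l
    using X unfolding F_def by (intro compact_Int_closed) auto
  define hit where "hit l \<omega> \<longleftrightarrow> X \<inter> F l \<inter> D \<omega> \<noteq> {} \<and> (\<forall>n<length l. l ! n < m n)" for l \<omega>
  have [measurable]: "Measurable.pred coin_space (hit l)" for l
    using meas_hit[OF compact_F[of l]] unfolding hit_def by simp
  \<comment> \<open>Always taking the least admissible index makes the choice measurable. Since the
    values are lists of naturals, a countable type, measurability follows by induction on the
    length.\<close>
  define L where "L = rec_nat (\<lambda>_. []) (\<lambda>_ l \<omega>. l \<omega> @ [LEAST i. hit (l \<omega> @ [i]) \<omega>])"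
  have L0: "L 0 \<omega> = []" and LS: "L (Suc n) \<omega> = L n \<omega> @ [LEAST i. hit (L n \<omega> @ [i]) \<omega>]" for n \<omega>
    by (simp_all add: L_def)
  have len: "length (L n \<omega>) = n" for n \<omega> by (induction n) (auto simp: L0 LS)
  have hit: "hit (L n \<omega>) \<omega>" for n \<omega>
  proof (induction n)
    case 0
    have "\<exists>x\<in>X. \<forall>j<N. x \<in> E \<omega> j" for N using ind[of N \<omega>] by (auto simp: E_def)
    then have "X \<inter> D \<omega> \<noteq> {}" using fin[OF X, of \<omega>] by simp
    then show ?case by (simp add: hit_def L0 F_Nil)
  next
    case (Suc n)
    then obtain x where x: "x \<in> X" "x \<in> F (L n \<omega>)" "x \<in> D \<omega>"
      and m: "\<forall>k<n. L n \<omega> ! k < m k" by (auto simp: hit_def len)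
    obtain i where i: "i < m n" "x \<in> cball (c n i) (1 / 2 ^ n)" using cover[of n] x(1) by auto
    have "x \<in> X \<inter> F (L n \<omega> @ [i]) \<inter> D \<omega>" using x i by (simp add: F_snoc len)
    then have "X \<inter> F (L n \<omega> @ [i]) \<inter> D \<omega> \<noteq> {}" by (metis empty_iff)
    then have "hit (L n \<omega> @ [i]) \<omega>" using m i(1) by (simp add: hit_def len less_Suc_eq nth_append)
    then show ?case unfolding LS by (rule LeastI)
  qed
  have [measurable]: "L n \<in> measurable coin_space (count_space UNIV)" for n
  proof (induction n)
    case 0
    then show ?case by (simp add: L0[abs_def])
  next
    case (Suc n)
    have "(\<lambda>\<omega>. (\<lambda>l \<omega>. l @ [LEAST i. hit (l @ [i]) \<omega>]) (L n \<omega>) \<omega>) \<in> measurable coin_space (count_space UNIV)"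
    proof (rule measurable_compose_countable[OF _ Suc])
      fix l :: "nat list"
      have "(\<lambda>\<omega>. LEAST i. hit (l @ [i]) \<omega>) \<in> measurable coin_space (count_space UNIV)" by measurable
      from measurable_compose[OF this, of "\<lambda>i. l @ [i]" "count_space UNIV"]
      show "(\<lambda>\<omega>. l @ [LEAST i. hit (l @ [i]) \<omega>]) \<in> measurable coin_space (count_space UNIV)" by simp
    qed
    then show ?case by (simp add: LS[abs_def])
  qed
  have decr: "F (L (n + k) \<omega>) \<subseteq> F (L n \<omega>)" for n k \<omega>
    by (induction k) (auto simp: LS F_snoc)
  have "\<exists>x. x \<in> X \<inter> D \<omega> \<and> (\<forall>n. x \<in> F (L n \<omega>))" for \<omega>
  proof -
    have "(X \<inter> D \<omega>) \<inter> (\<Inter>n\<in>UNIV. F (L n \<omega>)) \<noteq> {}"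
    proof (rule compact_imp_fip_image)
      show "compact (X \<inter> D \<omega>)" using X closed_D by (rule compact_Int_closed)
      show "closed (F (L n \<omega>))" for n unfolding F_def by auto
      fix I :: "nat set" assume "finite I"
      then obtain N where N: "I \<subseteq> {..<N}" by (meson finite_nat_iff_bounded)
      obtain x where x: "x \<in> X" "x \<in> F (L N \<omega>)" "x \<in> D \<omega>" using hit[of N \<omega>] by (auto simp: hit_def)
      have "x \<in> F (L n \<omega>)" if "n \<in> I" for n
      proof -
        have "n + (N - n) = N" using N that by auto
        then show ?thesis using decr[of n "N - n" \<omega>] x(2) by (simp only:) (rule subsetD)
      qed
      then have "x \<in> X \<inter> D \<omega> \<inter> (\<Inter>n\<in>I. F (L n \<omega>))" using x by auto
      then show "X \<inter> D \<omega> \<inter> (\<Inter>n\<in>I. F (L n \<omega>)) \<noteq> {}" by (metis empty_iff)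
    qed
    then show ?thesis by auto
  qed
  then obtain s where s: "\<And>\<omega>. s \<omega> \<in> X" "\<And>\<omega>. s \<omega> \<in> D \<omega>" "\<And>\<omega> n. s \<omega> \<in> F (L n \<omega>)"
    by (metis IntE)
  \<comment> \<open>The centre of the n-th chosen ball is a measurable function of \<omega> with
    countably many values and lies within \<open>1 / 2 ^ n\<close> of \<open>s \<omega>\<close>.
    Entry n first exists in the list of length Suc n.\<close>
  define t where "t n \<omega> = c n (L (Suc n) \<omega> ! n)" for n \<omega>
  have t: "t n \<omega> \<in> X" "dist (t n \<omega>) (s \<omega>) \<le> 1 / 2 ^ n" for n \<omega>
  proof -
    show "t n \<omega> \<in> X" using hit[of "Suc n" \<omega>] cX by (simp add: t_def hit_def len)
    show "dist (t n \<omega>) (s \<omega>) \<le> 1 / 2 ^ n"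
      using s(3)[of \<omega> "Suc n"] by (auto simp: F_def len t_def)
  qed
  have "(\<lambda>\<omega>. f (s \<omega>)) \<in> borel_measurable coin_space" if f: "continuous_on X f" for f :: "'a \<Rightarrow> real"
  proof (rule borel_measurable_LIMSEQ_real)
    show "(\<lambda>n. f (t n \<omega>)) \<longlonglongrightarrow> f (s \<omega>)" for \<omega>
    proof (rule continuous_on_tendsto_compose[OF f])
      have "(\<lambda>n. dist (t n \<omega>) (s \<omega>)) \<longlonglongrightarrow> 0"
      proof (rule tendsto_sandwich[of "\<lambda>_. 0" _ _ "\<lambda>n. (1 / 2) ^ n"])
        show "(\<lambda>n. (1 / 2 :: real) ^ n) \<longlonglongrightarrow> 0" by (rule LIMSEQ_power_zero) simp
      qed (use t in \<open>auto simp: power_one_over\<close>)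
      then show "(\<lambda>n. t n \<omega>) \<longlonglongrightarrow> s \<omega>" by (rule tendsto_dist_iff[THEN iffD2])
    qed (use s t in auto)
    show "(\<lambda>\<omega>. f (t n \<omega>)) \<in> borel_measurable coin_space" for n
      unfolding t_def
      by (rule measurable_compose[of "L (Suc n)" _ "count_space UNIV" "\<lambda>l. f (c n (l ! n))"]) auto
  qed
  moreover have "if \<omega> j then w j (s \<omega>) \<le> a else b \<le> w j (s \<omega>)" for \<omega> j
    using s(2)[of \<omega>] by (auto simp: D_def E_def)
  ultimately show ?thesis using s(1) by blast
qed

lemma abs_combination_continuous:
  assumes "abs_combination F w r" "\<And>f. f \<in> F \<Longrightarrow> continuous_on X f"
  shows "continuous_on X w"
  using assms(1)
proof induction
  case (add w r f c)
  then show ?case using assms(2)[OF add.hyps(2)] by (intro continuous_intros)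
qed simp

lemma abs_combination_bounded:
  assumes "abs_combination F w r" "\<And>f. f \<in> F \<Longrightarrow> \<bar>f x\<bar> \<le> D"
  shows "\<bar>w x\<bar> \<le> D * r"
  using assms(1)
proof induction
  case (add w r f c)
  have "\<bar>c * f x\<bar> \<le> \<bar>c\<bar> * D" using assms(2)[OF add.hyps(2)] by (simp add: abs_mult mult_left_mono)
  then show ?case using add.IH by (simp add: algebra_simps)
qed simp

lemma abs_combination_nonneg: "abs_combination F w r \<Longrightarrow> 0 \<le> r"
  by (induction rule: abs_combination.induct) auto

text \<open>
  An \<open>\<ell>\<^sub>1\<close>-sequence of combinations would have an independent subsequence \<open>w\<close>.  Along a random point
  with Rademacher pattern, \<open>w k\<close> correlates with the \<open>k\<close>-th Rademacher function, hence so does one of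
  the \<open>f k \<in> F\<close> it is built from; for a pointwise convergent subsequence of \<open>f\<close> this contradicts
  Bessel's inequality.
\<close>

lemma abs_combination_not_ell1:
  fixes X :: "'a::metric_space set"
  assumes X: "compact X" "X \<noteq> {}"
    and cont: "\<And>f. f \<in> F \<Longrightarrow> continuous_on X f" and D: "\<And>f x. f \<in> F \<Longrightarrow> x \<in> X \<Longrightarrow> \<bar>f x\<bar> \<le> D"
    and conv: "\<And>f. (\<And>n::nat. f n \<in> F) \<Longrightarrow>
      \<exists>r. strict_mono (r :: nat \<Rightarrow> nat) \<and> (\<forall>x\<in>X. convergent (\<lambda>n. f (r n) x))"
    and w: "\<And>k::nat. \<exists>r\<le>1. abs_combination F (w k) r" and "\<delta> > 0"
  shows "\<not> sup_ell1_lower X w \<delta>"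
proof
  assume low: "sup_ell1_lower X w \<delta>"
  have contw: "continuous_on X (w k)" for k
    using w[of k] abs_combination_continuous cont by blast
  have wD: "\<bar>w k x\<bar> \<le> \<bar>D\<bar>" if x: "x \<in> X" for k x
  proof -
    obtain r where r: "r \<le> 1" "abs_combination F (w k) r" using w by blast
    have "\<bar>w k x\<bar> \<le> \<bar>D\<bar> * r"
      by (rule abs_combination_bounded[OF r(2)]) (use D x in \<open>fastforce intro: order_trans\<close>)
    also have "\<dots> \<le> \<bar>D\<bar> * 1" using r(1) by (intro mult_left_mono) auto
    finally show ?thesis by simp
  qed
  have no: "\<nexists>r. strict_mono (r :: nat \<Rightarrow> nat) \<and> (\<forall>x\<in>X. convergent (\<lambda>n. w (r n) x))"
  proof
    assume "\<exists>r. strict_mono (r :: nat \<Rightarrow> nat) \<and> (\<forall>x\<in>X. convergent (\<lambda>n. w (r n) x))"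
    then obtain r :: "nat \<Rightarrow> nat" where r: "strict_mono r" "\<forall>x\<in>X. convergent (\<lambda>n. w (r n) x)" by blast
    have "sup_ell1_lower X (\<lambda>n. w (r n)) \<delta>"
      by (rule sup_ell1_lower_subseq[OF low strict_mono_imp_inj_on[OF r(1)]])
    from sup_ell1_lower_not_pointwise_convergent[where w = "\<lambda>n. w (r n)", OF X contw wD this \<open>\<delta> > 0\<close>] r(2)
    show False by (rule notE)
  qed
  have "\<not> (\<forall>a b r. a < b \<longrightarrow> strict_mono (r :: nat \<Rightarrow> nat) \<longrightarrow>
      (\<exists>N \<epsilon>. \<forall>x\<in>X. \<exists>j<N. \<not> (if \<epsilon> j then w (r j) x \<le> a else b \<le> w (r j) x)))"
  proof
    assume all: "\<forall>a b r. a < b \<longrightarrow> strict_mono (r :: nat \<Rightarrow> nat) \<longrightarrow>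
      (\<exists>N \<epsilon>. \<forall>x\<in>X. \<exists>j<N. \<not> (if \<epsilon> j then w (r j) x \<le> a else b \<le> w (r j) x))"
    have "\<exists>r. strict_mono (r :: nat \<Rightarrow> nat) \<and> (\<forall>x\<in>X. convergent (\<lambda>n. w (r n) x))"
    proof (rule pointwise_convergent_or_independent)
      show "\<exists>C. \<forall>n. \<bar>w n x\<bar> \<le> C" if "x \<in> X" for x using wD[OF that] by (intro exI allI)
      fix a b :: real and r :: "nat \<Rightarrow> nat" assume "a < b" "strict_mono r"
      then show "\<exists>N \<epsilon>. \<forall>x\<in>X. \<exists>j<N. \<not> (if \<epsilon> j then w (r j) x \<le> a else b \<le> w (r j) x)"
        by (rule all[rule_format])
    qed
    with no show False by (rule notE)
  qed
  then obtain a b and r :: "nat \<Rightarrow> nat" where ab: "a < b" and r: "strict_mono r"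
    and neg: "\<not> (\<exists>N \<epsilon>. \<forall>x\<in>X. \<exists>j<N. \<not> (if \<epsilon> j then w (r j) x \<le> a else b \<le> w (r j) x))"
    by (simp only: not_all not_imp) blast
  have ind: "\<exists>x\<in>X. \<forall>j<N. if \<epsilon> j then w (r j) x \<le> a else b \<le> w (r j) x" for N \<epsilon>
  proof (rule ccontr)
    assume "\<not> ?thesis"
    then have "\<forall>x\<in>X. \<exists>j<N. \<not> (if \<epsilon> j then w (r j) x \<le> a else b \<le> w (r j) x)"
      by blast
    with neg show False by (elim notE, intro exI[of _ N] exI[of _ \<epsilon>])
  qed
  obtain s where s: "\<And>\<omega>. s \<omega> \<in> X" "\<And>\<omega> j. if \<omega> j then w (r j) (s \<omega>) \<le> a else b \<le> w (r j) (s \<omega>)"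
    and meas: "\<And>f. continuous_on X f \<Longrightarrow> (\<lambda>\<omega>. f (s \<omega>) :: real) \<in> borel_measurable coin_space"
    using measurable_selection[OF X(1), of "\<lambda>j. w (r j)" a b, OF contw ind] by blast
  have rad: "\<bar>rademacher k \<omega>\<bar> = 1" for k \<omega> by (simp add: rademacher_def)
  define I where "I f k = (\<integral>\<omega>. f (s \<omega>) * rademacher k \<omega> \<partial>coin_space)" for f k
  have integ: "integrable coin_space (\<lambda>\<omega>. f (s \<omega>) * rademacher k \<omega>)"
    if [measurable]: "(\<lambda>\<omega>. f (s \<omega>)) \<in> borel_measurable coin_space" and "\<And>x. x \<in> X \<Longrightarrow> \<bar>f x\<bar> \<le> B" for f k B
    by (rule integrable_coin[of _ B]) (use that(2) s(1) in \<open>auto simp: abs_mult rad\<close>)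
  \<comment> \<open>Half of the correlation (b - a) / 2 established for w next; the slack gives a
    strict contradiction if no member of F reaches c.\<close>
  define c where "c = (b - a) / 4"
  have "c > 0" using ab by (simp add: c_def)
  have w_large: "(b - a) / 2 \<le> I (w (r k)) k" for k
  proof -
    have i: "integrable coin_space (\<lambda>\<omega>. w (r k) (s \<omega>) * rademacher k \<omega>)"
      by (rule integ[OF meas[OF contw] wD])
    have i': "integrable coin_space (rademacher k)" by (rule integrable_coin[of _ 1]) (auto simp: rad)
    \<comment> \<open>The Rademacher function has mean 0, so subtracting the midpoint of a and b
      from w leaves the correlation unchanged. After that the integrand is at least (b - a) / 2
      everywhere, whichever way the coin falls.\<close>
    have "(b - a) / 2 \<le> (\<integral>\<omega>. w (r k) (s \<omega>) * rademacher k \<omega> - (a + b) / 2 * rademacher k \<omega> \<partial>coin_space)"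
    proof (rule coin_space.integral_ge_const)
      show "integrable coin_space (\<lambda>\<omega>. w (r k) (s \<omega>) * rademacher k \<omega> - (a + b) / 2 * rademacher k \<omega>)"
        using i i' by simp
      show "AE \<omega> in coin_space. (b - a) / 2 \<le> w (r k) (s \<omega>) * rademacher k \<omega> - (a + b) / 2 * rademacher k \<omega>"
      proof (rule AE_I2)
        fix \<omega>
        show "(b - a) / 2 \<le> w (r k) (s \<omega>) * rademacher k \<omega> - (a + b) / 2 * rademacher k \<omega>"
          using s(2)[of \<omega> k] by (cases "\<omega> k") (auto simp: rademacher_def field_simps)
      qed
    qed
    also have "\<dots> = I (w (r k)) k"
      using i i' by (simp add: I_def integral_rademacher)
    finally show ?thesis .
  qed
  have "\<exists>f\<in>F. c \<le> \<bar>I f k\<bar>" for k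
  proof (rule ccontr)
    assume "\<not> (\<exists>f\<in>F. c \<le> \<bar>I f k\<bar>)"
    then have le: "\<And>f. f \<in> F \<Longrightarrow> \<bar>I f k\<bar> \<le> c" by force
    \<comment> \<open>Linearity of \<open>I\<close> in the function carries a bound on F over to
      combinations, in proportion to their weight. Weight at most 1 then contradicts the size of the
      correlation of w.\<close>
    have *: "\<bar>I v k\<bar> \<le> c * \<rho>" if "abs_combination F v \<rho>" for v \<rho>
      using that
    proof induction
      case zero
      then show ?case by (simp add: I_def)
    next
      case (add v \<rho> f t)
      have "integrable coin_space (\<lambda>\<omega>. v (s \<omega>) * rademacher k \<omega>)"
      proof (rule integ[OF meas])
        show "continuous_on X v" using abs_combination_continuous[OF add.hyps(1)] cont by blast
        show "\<bar>v x\<bar> \<le> \<bar>D\<bar> * \<rho>" if "x \<in> X" for x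
          by (rule abs_combination_bounded[OF add.hyps(1)]) (use D that in \<open>fastforce intro: order_trans\<close>)
      qed
      moreover have "integrable coin_space (\<lambda>\<omega>. f (s \<omega>) * rademacher k \<omega>)"
        by (rule integ[OF meas[OF cont[OF add.hyps(2)]] D[OF add.hyps(2)]])
      ultimately have "I (\<lambda>x. v x + t * f x) k = I v k + t * I f k"
        by (simp add: I_def distrib_right mult.assoc)
      moreover have "\<bar>t * I f k\<bar> \<le> \<bar>t\<bar> * c" using le[OF add.hyps(2)] by (simp add: abs_mult mult_left_mono)
      ultimately show ?case using add.IH by (simp add: algebra_simps)
    qed
    obtain \<rho> where "\<rho> \<le> 1" "abs_combination F (w (r k)) \<rho>" using w by blast
    then have "\<bar>I (w (r k)) k\<bar> \<le> c * 1"
      using * \<open>c > 0\<close> by (meson less_imp_le mult_left_mono order_trans)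
    then show False using w_large[of k] ab by (simp add: c_def)
  qed
  then obtain f where f: "\<And>k. f k \<in> F" "\<And>k. c \<le> \<bar>I (f k) k\<bar>" by metis
  obtain q :: "nat \<Rightarrow> nat" where q: "strict_mono q" "\<forall>x\<in>X. convergent (\<lambda>n. f (q n) x)"
    using conv[of f] f(1) by blast
  define h where "h x = lim (\<lambda>n. f (q n) x)" for x
  have h: "(\<lambda>n. f (q n) x) \<longlonglongrightarrow> h x" if "x \<in> X" for x
    using q(2) that unfolding h_def by (simp add: convergent_LIMSEQ_iff)
  have fm [measurable]: "(\<lambda>\<omega>. f k (s \<omega>)) \<in> borel_measurable coin_space" for k
    using meas cont f(1) by blast
  have hm [measurable]: "(\<lambda>\<omega>. h (s \<omega>)) \<in> borel_measurable coin_space"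
    by (rule borel_measurable_LIMSEQ_real[of _ "\<lambda>n \<omega>. f (q n) (s \<omega>)"]) (use h s(1) in auto)
  have hD: "\<bar>h x\<bar> \<le> D" if "x \<in> X" for x
    using D f(1) that by (intro tendsto_upperbound[OF tendsto_rabs[OF h[OF that]]]) auto
  \<comment> \<open>Convergence in mean is the right notion: the Rademacher function changes with n,
    but all of them have modulus 1, so the error in the coefficient is bounded uniformly. Hence the
    single function h has infinitely many coefficients of modulus at least c / 2.\<close>
  have "(\<lambda>n. \<integral>\<omega>. \<bar>f (q n) (s \<omega>) - h (s \<omega>)\<bar> \<partial>coin_space) \<longlonglongrightarrow> (\<integral>\<omega>. 0 \<partial>coin_space)"
  proof (rule integral_dominated_convergence[where w = "\<lambda>_. 2 * D"])
    show "AE \<omega> in coin_space. (\<lambda>n. \<bar>f (q n) (s \<omega>) - h (s \<omega>)\<bar>) \<longlonglongrightarrow> 0"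
      using h s(1) by (intro AE_I2 tendsto_rabs_zero) (simp add: LIM_zero)
    show "AE \<omega> in coin_space. norm \<bar>f (q n) (s \<omega>) - h (s \<omega>)\<bar> \<le> 2 * D" for n
    proof (rule AE_I2)
      fix \<omega>
      show "norm \<bar>f (q n) (s \<omega>) - h (s \<omega>)\<bar> \<le> 2 * D"
        using D[OF f(1) s(1), of "q n" \<omega>] hD[OF s(1), of \<omega>] by simp
    qed
  qed auto
  then have "(\<lambda>n. \<integral>\<omega>. \<bar>f (q n) (s \<omega>) - h (s \<omega>)\<bar> \<partial>coin_space) \<longlonglongrightarrow> 0" by simp
  then have "\<forall>\<^sub>F n in sequentially. (\<integral>\<omega>. \<bar>f (q n) (s \<omega>) - h (s \<omega>)\<bar> \<partial>coin_space) < c / 2"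
    using \<open>c > 0\<close> by (intro order_tendstoD) auto
  then obtain n0 where n0: "\<And>n. n0 \<le> n \<Longrightarrow> (\<integral>\<omega>. \<bar>f (q n) (s \<omega>) - h (s \<omega>)\<bar> \<partial>coin_space) < c / 2"
    by (auto simp: eventually_sequentially)
  have "q n \<in> {k. c / 2 \<le> \<bar>I h k\<bar>}" if "n0 \<le> n" for n
  proof -
    have 1: "integrable coin_space (\<lambda>\<omega>. f (q n) (s \<omega>) * rademacher (q n) \<omega>)"
      by (rule integ[OF fm D[OF f(1)]])
    have 2: "integrable coin_space (\<lambda>\<omega>. h (s \<omega>) * rademacher (q n) \<omega>)"
      by (rule integ[OF hm hD])
    have "\<bar>I (f (q n)) (q n) - I h (q n)\<bar> = \<bar>\<integral>\<omega>. f (q n) (s \<omega>) * rademacher (q n) \<omega> - h (s \<omega>) * rademacher (q n) \<omega> \<partial>coin_space\<bar>"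
      using 1 2 by (simp add: I_def)
    also have "\<dots> \<le> (\<integral>\<omega>. \<bar>f (q n) (s \<omega>) * rademacher (q n) \<omega> - h (s \<omega>) * rademacher (q n) \<omega>\<bar> \<partial>coin_space)"
      by (rule integral_abs_bound)
    also have "\<dots> = (\<integral>\<omega>. \<bar>f (q n) (s \<omega>) - h (s \<omega>)\<bar> \<partial>coin_space)"
      by (simp add: abs_mult rad flip: left_diff_distrib)
    finally show ?thesis using n0[OF that] f(2)[of "q n"] by simp
  qed
  then have "q ` {n0..} \<subseteq> {k. c / 2 \<le> \<bar>I h k\<bar>}" by auto
  moreover have "infinite (q ` {n0..})"
    using q(1) infinite_Ici[of n0] by (metis finite_imageD strict_mono_imp_inj_on inj_on_subset subset_UNIV)
  moreover have "finite {k. c / 2 \<le> \<bar>I h k\<bar>}"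
    unfolding I_def by (rule rademacher_coefficients_finite[of _ D]) (use hm hD s(1) \<open>c > 0\<close> in auto)
  ultimately show False using finite_subset by blast
qed


section \<open>Linear maps of normed spaces\<close>

context real_normed_space
begin

lemma zero_smult: "v \<in> carrier V \<Longrightarrow> (0::real) \<odot> v = \<zero>"
  using smult_l_null by (simp add: real_ring_def)

lemma one_smult: "v \<in> carrier V \<Longrightarrow> (1::real) \<odot> v = v"
  using smult_one by (simp add: real_ring_def)

lemma smult_smult: "v \<in> carrier V \<Longrightarrow> (a::real) \<odot> (b \<odot> v) = (a * b) \<odot> v"
  using smult_assoc1[of a b v] by (simp add: real_ring_def)

lemma smult_add_left: "v \<in> carrier V \<Longrightarrow> ((a::real) + b) \<odot> v = a \<odot> v \<oplus> b \<odot> v"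
  using smult_l_distr[of a b v] by (simp add: real_ring_def)

lemma smult_add_right: "v \<in> carrier V \<Longrightarrow> w \<in> carrier V \<Longrightarrow> (a::real) \<odot> (v \<oplus> w) = a \<odot> v \<oplus> a \<odot> w"
  using smult_r_distr[of a v w] by (simp add: real_ring_def)

lemma neg_one_smult:
  assumes "v \<in> carrier V" shows "(-1::real) \<odot> v = \<ominus> v"
proof -
  have "(-1::real) \<odot> v \<oplus> v = \<zero>"
    using smult_add_left[OF assms, of "-1" 1] assms by (simp add: zero_smult one_smult)
  then show ?thesis
    using M.minus_equality real_smult_closed assms by metis
qed

lemma minus_eq: "v \<in> carrier V \<Longrightarrow> w \<in> carrier V \<Longrightarrow> v \<ominus> w = v \<oplus> (-1::real) \<odot> w"
  by (simp add: a_minus_def neg_one_smult)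

lemma minus_self: "v \<in> carrier V \<Longrightarrow> v \<ominus> v = \<zero>"
  by (simp add: a_minus_def M.r_neg)

lemma minus_zero: "v \<in> carrier V \<Longrightarrow> v \<ominus> \<zero> = v"
  by (simp add: a_minus_def)

lemma eq_if_minus_zero:
  assumes "v \<in> carrier V" "w \<in> carrier V" "v \<ominus> w = \<zero>"
  shows "v = w"
  using assms M.minus_equality[of v "\<ominus> w"] by (metis M.a_inv_closed M.minus_minus a_minus_def)

lemma vnorm_minus_commute: "v \<in> carrier V \<Longrightarrow> w \<in> carrier V \<Longrightarrow> vnorm V (v \<ominus> w) = vnorm V (w \<ominus> v)"
  using Metric_space.commute[OF Metric_space_vdist, of v w] by (simp add: vdist_def)

lemma minus_add_cancel:
  "u \<in> carrier V \<Longrightarrow> v \<in> carrier V \<Longrightarrow> w \<in> carrier V \<Longrightarrow> u \<ominus> w = (u \<ominus> v) \<oplus> (v \<ominus> w)"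
  by (simp add: a_minus_def M.a_assoc M.r_neg1 M.r_neg2)

lemma vnorm_triangle_minus:
  "u \<in> carrier V \<Longrightarrow> v \<in> carrier V \<Longrightarrow> w \<in> carrier V \<Longrightarrow>
    vnorm V (u \<ominus> w) \<le> vnorm V (u \<ominus> v) + vnorm V (v \<ominus> w)"
  using vnorm_triangle[of "u \<ominus> v" "v \<ominus> w"] minus_add_cancel[of u v w] by simp

lemma topspace_norm_topology: "topspace (norm_topology V) = carrier V"
  by (simp add: norm_topology_def Metric_space.topspace_mtopology[OF Metric_space_vdist])

lemma norm_topology_mball:
  "u \<in> carrier V \<Longrightarrow> Metric_space.mball (carrier V) (vdist V) u r = {v \<in> carrier V. vnorm V (u \<ominus> v) < r}"
  by (auto simp: Metric_space.mball_def[OF Metric_space_vdist] vdist_def)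

lemma openin_norm_topology:
  "openin (norm_topology V) U \<longleftrightarrow> U \<subseteq> carrier V \<and>
    (\<forall>u\<in>U. \<exists>r>0. \<forall>v\<in>carrier V. vnorm V (u \<ominus> v) < r \<longrightarrow> v \<in> U)"
proof -
  have "Metric_space.mball (carrier V) (vdist V) u r \<subseteq> U \<longleftrightarrow>
      (\<forall>v\<in>carrier V. vnorm V (u \<ominus> v) < r \<longrightarrow> v \<in> U)" if "u \<in> carrier V" for u r
    using norm_topology_mball[OF that] by auto
  then show ?thesis
    unfolding norm_topology_def Metric_space.openin_mtopology[OF Metric_space_vdist]
    by (auto simp: subset_eq)
qed

lemma openin_norm_ball:
  assumes u: "u \<in> carrier V"
  shows "openin (norm_topology V) {v \<in> carrier V. vnorm V (u \<ominus> v) < r}"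
  using Metric_space.openin_mball[OF Metric_space_vdist, of u r] norm_topology_mball[OF u]
  by (simp add: norm_topology_def)

lemma continuous_map_to_norm_topology:
  "continuous_map T (norm_topology V) f \<longleftrightarrow> f \<in> topspace T \<rightarrow> carrier V \<and>
    (\<forall>x\<in>topspace T. \<forall>\<epsilon>>0. \<exists>U. openin T U \<and> x \<in> U \<and> (\<forall>y\<in>U. vnorm V (f x \<ominus> f y) < \<epsilon>))"
proof
  assume L: "continuous_map T (norm_topology V) f"
  then have f: "f \<in> topspace T \<rightarrow> carrier V"
    by (metis continuous_map_funspace topspace_norm_topology)
  moreover have "\<exists>U. openin T U \<and> x \<in> U \<and> (\<forall>y\<in>U. vnorm V (f x \<ominus> f y) < \<epsilon>)"
    if x: "x \<in> topspace T" and "\<epsilon> > 0" for x \<epsilon>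
  proof -
    have "\<exists>U. openin T U \<and> x \<in> U \<and> (\<forall>y\<in>U. f y \<in> Metric_space.mball (carrier V) (vdist V) (f x) \<epsilon>)"
      using L that unfolding norm_topology_def Metric_space.continuous_map_to_metric[OF Metric_space_vdist]
      by blast
    moreover have "f x \<in> carrier V" using f x by blast
    ultimately show ?thesis by (auto simp: norm_topology_mball)
  qed
  ultimately show "f \<in> topspace T \<rightarrow> carrier V \<and>
    (\<forall>x\<in>topspace T. \<forall>\<epsilon>>0. \<exists>U. openin T U \<and> x \<in> U \<and> (\<forall>y\<in>U. vnorm V (f x \<ominus> f y) < \<epsilon>))" by blast
next
  assume R: "f \<in> topspace T \<rightarrow> carrier V \<and>
    (\<forall>x\<in>topspace T. \<forall>\<epsilon>>0. \<exists>U. openin T U \<and> x \<in> U \<and> (\<forall>y\<in>U. vnorm V (f x \<ominus> f y) < \<epsilon>))"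
  show "continuous_map T (norm_topology V) f"
    unfolding norm_topology_def Metric_space.continuous_map_to_metric[OF Metric_space_vdist]
  proof (intro ballI allI impI)
    fix x and \<epsilon> :: real assume x: "x \<in> topspace T" and "\<epsilon> > 0"
    then obtain U where U: "openin T U" "x \<in> U" "\<forall>y\<in>U. vnorm V (f x \<ominus> f y) < \<epsilon>"
      using R by blast
    have "f x \<in> carrier V" using R x by blast
    moreover have "f y \<in> carrier V" if "y \<in> U" for y using R openin_subset[OF U(1)] that by blast
    ultimately have "\<forall>y\<in>U. f y \<in> Metric_space.mball (carrier V) (vdist V) (f x) \<epsilon>"
      using U(3) by (simp add: norm_topology_mball)
    with U show "\<exists>U. openin T U \<and> x \<in> U \<and> (\<forall>y\<in>U. f y \<in> Metric_space.mball (carrier V) (vdist V) (f x) \<epsilon>)"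
      by blast
  qed
qed

lemma mcomplete_iff:
  "Metric_space.mcomplete (carrier V) (vdist V) \<longleftrightarrow>
    (\<forall>\<sigma>. (\<forall>n::nat. \<sigma> n \<in> carrier V) \<and> (\<forall>\<epsilon>>0. \<exists>N. \<forall>n\<ge>N. \<forall>n'\<ge>N. vnorm V (\<sigma> n \<ominus> \<sigma> n') < \<epsilon>) \<longrightarrow>
      (\<exists>v\<in>carrier V. \<forall>\<epsilon>>0. \<exists>N. \<forall>n\<ge>N. vnorm V (\<sigma> n \<ominus> v) < \<epsilon>))"
proof -
  have C: "Metric_space.MCauchy (carrier V) (vdist V) \<sigma> \<longleftrightarrow> (\<forall>n::nat. \<sigma> n \<in> carrier V) \<and>
      (\<forall>\<epsilon>>0. \<exists>N. \<forall>n\<ge>N. \<forall>n'\<ge>N. vnorm V (\<sigma> n \<ominus> \<sigma> n') < \<epsilon>)" for \<sigma>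
  proof (cases "\<forall>n::nat. \<sigma> n \<in> carrier V")
    case True
    then show ?thesis
      unfolding Metric_space.MCauchy_def[OF Metric_space_vdist] vdist_def by auto
  next
    case False
    then show ?thesis
      unfolding Metric_space.MCauchy_def[OF Metric_space_vdist] by auto
  qed
  have L: "limitin (Metric_space.mtopology (carrier V) (vdist V)) \<sigma> v sequentially \<longleftrightarrow>
      v \<in> carrier V \<and> (\<forall>\<epsilon>>0. \<exists>N. \<forall>n\<ge>N. vnorm V (\<sigma> n \<ominus> v) < \<epsilon>)" if "\<forall>n. \<sigma> n \<in> carrier V" for \<sigma> v
    unfolding Metric_space.limit_metric_sequentially[OF Metric_space_vdist] vdist_def using that
    by auto
  show ?thesis
    unfolding Metric_space.mcomplete_def[OF Metric_space_vdist] C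
    using L by (intro iff_allI) (metis (no_types, lifting))
qed

end

locale linear_map_of_normed_spaces =
  W: real_normed_space W + V: real_normed_space V
  for W :: "('w, 'k) normed_module_scheme" and V :: "('v, 'm) normed_module_scheme" +
  fixes S assumes linear: "linear_operator W V S"
begin

lemma closed: "a \<in> carrier W \<Longrightarrow> S a \<in> carrier V"
  and add: "a \<in> carrier W \<Longrightarrow> b \<in> carrier W \<Longrightarrow> S (a \<oplus>\<^bsub>W\<^esub> b) = S a \<oplus>\<^bsub>V\<^esub> S b"
  and smult: "a \<in> carrier W \<Longrightarrow> S (c \<odot>\<^bsub>W\<^esub> a) = c \<odot>\<^bsub>V\<^esub> S a"
  using linear by (auto simp: linear_operator_def)

lemma minus: "a \<in> carrier W \<Longrightarrow> b \<in> carrier W \<Longrightarrow> S (a \<ominus>\<^bsub>W\<^esub> b) = S a \<ominus>\<^bsub>V\<^esub> S b"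
  by (simp add: W.minus_eq V.minus_eq closed add smult W.real_smult_closed)

lemma zero: "S \<zero>\<^bsub>W\<^esub> = \<zero>\<^bsub>V\<^esub>"
  using minus[of "\<zero>\<^bsub>W\<^esub>" "\<zero>\<^bsub>W\<^esub>"] closed[of "\<zero>\<^bsub>W\<^esub>"] by (simp add: W.minus_self V.minus_self)

lemma bounded_of_continuous:
  assumes "continuous_map (norm_topology W) (norm_topology V) S"
  shows "\<exists>M>0. \<forall>a\<in>carrier W. vnorm V (S a) \<le> M * vnorm W a"
proof -
  have "\<exists>U. openin (norm_topology W) U \<and> \<zero>\<^bsub>W\<^esub> \<in> U \<and> (\<forall>b\<in>U. vnorm V (S \<zero>\<^bsub>W\<^esub> \<ominus>\<^bsub>V\<^esub> S b) < 1)"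
    using assms unfolding V.continuous_map_to_norm_topology
    by (simp add: W.topspace_norm_topology)
  then obtain U where U: "openin (norm_topology W) U" "\<zero>\<^bsub>W\<^esub> \<in> U"
      "\<And>b. b \<in> U \<Longrightarrow> vnorm V (S \<zero>\<^bsub>W\<^esub> \<ominus>\<^bsub>V\<^esub> S b) < 1" by blast
  obtain r where r: "r > 0" "\<And>b. b \<in> carrier W \<Longrightarrow> vnorm W (\<zero>\<^bsub>W\<^esub> \<ominus>\<^bsub>W\<^esub> b) < r \<Longrightarrow> b \<in> U"
    using U(1,2) unfolding W.openin_norm_topology by blast
  have small: "vnorm V (S b) < 1" if "b \<in> carrier W" "vnorm W b < r" for b
  proof -
    have "b \<in> U"
      using r(2)[OF that(1)] that W.vnorm_minus_commute[of "\<zero>\<^bsub>W\<^esub>" b] by (simp add: W.minus_zero)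
    then show ?thesis
      using U(3)[of b] V.vnorm_minus_commute[of "S b" "\<zero>\<^bsub>V\<^esub>"] closed[OF that(1)] by (simp add: zero V.minus_zero)
  qed
  have "vnorm V (S a) \<le> 2 / r * vnorm W a" if a: "a \<in> carrier W" for a
  proof (cases "vnorm W a = 0")
    case True
    then have "a = \<zero>\<^bsub>W\<^esub>" using W.vnorm_eq_zero a by blast
    then show ?thesis by (simp add: zero V.vnorm_zero W.vnorm_zero)
  next
    case False
    then have pos: "vnorm W a > 0" using W.vnorm_nonneg[OF a] by simp
    let ?c = "r / (2 * vnorm W a)"
    have "vnorm W (?c \<odot>\<^bsub>W\<^esub> a) < r" using pos r(1) by (simp add: W.vnorm_smult[OF a])
    then have "vnorm V (S (?c \<odot>\<^bsub>W\<^esub> a)) < 1" using small W.real_smult_closed[OF a] by blast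
    then have "?c * vnorm V (S a) < 1" using pos r(1) by (simp add: smult a V.vnorm_smult closed)
    then show ?thesis using pos r(1) by (simp add: field_simps)
  qed
  then show ?thesis using r(1) by (intro exI[of _ "2 / r"]) auto
qed

text \<open>An embedding is open onto its image, so the image of the unit ball contains all points
  of the range within some r of 0. Scaling turns this into a lower bound.\<close>

lemma bounded_below_of_embedding:
  assumes "embedding_map (norm_topology W) (norm_topology V) S"
  shows "\<exists>\<rho>>0. \<forall>a\<in>carrier W. \<rho> * vnorm W a \<le> vnorm V (S a)"
proof -
  have hom: "homeomorphic_map (norm_topology W) (subtopology (norm_topology V) (S ` carrier W)) S"
    using assms by (simp add: embedding_map_def W.topspace_norm_topology)
  have inj: "inj_on S (carrier W)"
    using homeomorphic_imp_injective_map[OF hom] by (simp add: W.topspace_norm_topology)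
  let ?U = "{b \<in> carrier W. vnorm W (\<zero>\<^bsub>W\<^esub> \<ominus>\<^bsub>W\<^esub> b) < 1}"
  have "openin (subtopology (norm_topology V) (S ` carrier W)) (S ` ?U)"
    using homeomorphic_imp_open_map[OF hom] W.openin_norm_ball[of "\<zero>\<^bsub>W\<^esub>" 1] by (simp add: open_map_def)
  then obtain T where T: "openin (norm_topology V) T" "S ` ?U = T \<inter> S ` carrier W"
    by (auto simp: openin_subtopology)
  have "S \<zero>\<^bsub>W\<^esub> \<in> S ` ?U" by (intro imageI) (simp add: W.minus_zero W.vnorm_zero)
  then have "\<zero>\<^bsub>V\<^esub> \<in> T" using T(2) by (simp add: zero)
  then obtain r where r: "r > 0" "\<And>v. v \<in> carrier V \<Longrightarrow> vnorm V (\<zero>\<^bsub>V\<^esub> \<ominus>\<^bsub>V\<^esub> v) < r \<Longrightarrow> v \<in> T"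
    using T(1) unfolding V.openin_norm_topology by blast
  have small: "vnorm W a < 1" if a: "a \<in> carrier W" and n: "vnorm V (S a) < r" for a
  proof -
    have "S a \<in> T"
      using r(2)[OF closed[OF a]] n V.vnorm_minus_commute[of "\<zero>\<^bsub>V\<^esub>" "S a"] closed[OF a]
      by (simp add: V.minus_zero)
    then have "S a \<in> S ` ?U" using T(2) a by blast
    then obtain b where b: "b \<in> ?U" "S a = S b" by blast
    then have "a \<in> ?U" using inj a by (metis (mono_tags, lifting) inj_on_eq_iff mem_Collect_eq)
    then show ?thesis using W.vnorm_minus_commute[of "\<zero>\<^bsub>W\<^esub>" a] a by (simp add: W.minus_zero)
  qed
  have "r * vnorm W a \<le> vnorm V (S a)" if a: "a \<in> carrier W" for a
  proof (cases "vnorm W a = 0")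
    case True
    then show ?thesis using V.vnorm_nonneg[OF closed[OF a]] by simp
  next
    case False
    then have pos: "vnorm W a > 0" using W.vnorm_nonneg[OF a] by simp
    let ?c = "1 / vnorm W a"
    have "vnorm W (?c \<odot>\<^bsub>W\<^esub> a) = 1" using pos by (simp add: W.vnorm_smult[OF a])
    then have "\<not> vnorm V (S (?c \<odot>\<^bsub>W\<^esub> a)) < r" using small W.real_smult_closed[OF a, of ?c] by force
    then have "r \<le> ?c * vnorm V (S a)" using pos by (simp add: smult a V.vnorm_smult closed)
    then show ?thesis using pos by (simp add: field_simps)
  qed
  then show ?thesis using r(1) by blast
qed

text \<open>With its counterparts above, this translates between the topological notion of
  isomorphic copy and two-sided norm estimates: the lower bound makes the inverse Lipschitz on the
  range.\<close>

lemma embedding_of_bounded_below: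
  assumes "\<rho> > 0" and low: "\<And>a. a \<in> carrier W \<Longrightarrow> \<rho> * vnorm W a \<le> vnorm V (S a)"
    and "M > 0" and up: "\<And>a. a \<in> carrier W \<Longrightarrow> vnorm V (S a) \<le> M * vnorm W a"
  shows "embedding_map (norm_topology W) (norm_topology V) S"
proof -
  let ?TV = "subtopology (norm_topology V) (S ` carrier W)"
  have low': "\<rho> * vnorm W (a \<ominus>\<^bsub>W\<^esub> b) \<le> vnorm V (S a \<ominus>\<^bsub>V\<^esub> S b)" if "a \<in> carrier W" "b \<in> carrier W" for a b
    using low[of "a \<ominus>\<^bsub>W\<^esub> b"] that by (simp add: minus)
  have inj: "inj_on S (carrier W)"
  proof (rule inj_onI)
    fix a b assume ab: "a \<in> carrier W" "b \<in> carrier W" "S a = S b"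
    then have "\<rho> * vnorm W (a \<ominus>\<^bsub>W\<^esub> b) \<le> 0"
      using low'[OF ab(1,2)] closed by (simp add: V.minus_self V.vnorm_zero)
    then have "vnorm W (a \<ominus>\<^bsub>W\<^esub> b) = 0"
      using \<open>\<rho> > 0\<close> W.vnorm_nonneg[of "a \<ominus>\<^bsub>W\<^esub> b"] ab by (simp add: mult_le_0_iff)
    then show "a = b" using W.eq_if_minus_zero W.vnorm_eq_zero ab by (meson W.M.minus_closed)
  qed
  define g where "g = inv_into (carrier W) S"
  have g: "g (S a) = a" if "a \<in> carrier W" for a using inj that by (simp add: g_def)
  have top: "topspace ?TV = S ` carrier W"
    using closed by (auto simp: V.topspace_norm_topology)
  have "continuous_map (norm_topology W) (norm_topology V) S"
    unfolding V.continuous_map_to_norm_topology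
  proof (intro conjI ballI allI impI)
    show "S \<in> topspace (norm_topology W) \<rightarrow> carrier V" using closed by (simp add: W.topspace_norm_topology)
    fix a and \<epsilon> :: real assume a: "a \<in> topspace (norm_topology W)" and "\<epsilon> > 0"
    then have aW: "a \<in> carrier W" by (simp add: W.topspace_norm_topology)
    let ?U = "{b \<in> carrier W. vnorm W (a \<ominus>\<^bsub>W\<^esub> b) < \<epsilon> / M}"
    have "vnorm V (S a \<ominus>\<^bsub>V\<^esub> S b) < \<epsilon>" if "b \<in> ?U" for b
    proof -
      have "vnorm V (S a \<ominus>\<^bsub>V\<^esub> S b) \<le> M * vnorm W (a \<ominus>\<^bsub>W\<^esub> b)"
        using up[of "a \<ominus>\<^bsub>W\<^esub> b"] that aW by (simp add: minus)
      also have "\<dots> < M * (\<epsilon> / M)" using that \<open>M > 0\<close> by (intro mult_strict_left_mono) auto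
      finally show ?thesis using \<open>M > 0\<close> by simp
    qed
    then show "\<exists>U. openin (norm_topology W) U \<and> a \<in> U \<and> (\<forall>b\<in>U. vnorm V (S a \<ominus>\<^bsub>V\<^esub> S b) < \<epsilon>)"
      using W.openin_norm_ball[OF aW, of "\<epsilon> / M"] aW \<open>\<epsilon> > 0\<close> \<open>M > 0\<close>
      by (intro exI[of _ ?U]) (simp add: W.minus_self W.vnorm_zero)
  qed
  then have "continuous_map (norm_topology W) ?TV S"
    by (simp add: continuous_map_in_subtopology W.topspace_norm_topology image_subset_iff_funcset)
  moreover have "continuous_map ?TV (norm_topology W) g"
    unfolding W.continuous_map_to_norm_topology top
  proof (intro conjI ballI allI impI)
    show "g \<in> S ` carrier W \<rightarrow> carrier W" using g by auto
    fix y and \<epsilon> :: real assume "y \<in> S ` carrier W" and "\<epsilon> > 0"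
    then obtain a where a: "a \<in> carrier W" "y = S a" by blast
    let ?B = "{v \<in> carrier V. vnorm V (S a \<ominus>\<^bsub>V\<^esub> v) < \<rho> * \<epsilon>}"
    have "openin ?TV (?B \<inter> S ` carrier W)"
      using V.openin_norm_ball[OF closed[OF a(1)]] by (auto simp: openin_subtopology)
    moreover have "y \<in> ?B \<inter> S ` carrier W"
      using a closed \<open>\<rho> > 0\<close> \<open>\<epsilon> > 0\<close> by (simp add: V.minus_self V.vnorm_zero)
    moreover have "vnorm W (g y \<ominus>\<^bsub>W\<^esub> g z) < \<epsilon>" if z: "z \<in> ?B \<inter> S ` carrier W" for z
    proof -
      obtain b where b: "b \<in> carrier W" "z = S b" using z by blast
      have "\<rho> * vnorm W (a \<ominus>\<^bsub>W\<^esub> b) < \<rho> * \<epsilon>" using low'[OF a(1) b(1)] z b by simp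
      then show ?thesis using \<open>\<rho> > 0\<close> a b by (simp add: g)
    qed
    ultimately show "\<exists>U. openin ?TV U \<and> y \<in> U \<and> (\<forall>z\<in>U. vnorm W (g y \<ominus>\<^bsub>W\<^esub> g z) < \<epsilon>)" by blast
  qed
  ultimately have "homeomorphic_maps (norm_topology W) ?TV S g"
    using g unfolding homeomorphic_maps_def top by (auto simp: W.topspace_norm_topology)
  then have "homeomorphic_map (norm_topology W) ?TV S"
    using homeomorphic_map_maps by blast
  then show ?thesis by (simp add: embedding_map_def W.topspace_norm_topology)
qed

end


section \<open>The interpolation space\<close>

lemma abs_combination_plus:
  assumes "abs_combination F v q" "abs_combination F w r"
  shows "abs_combination F (\<lambda>x. v x + w x) (q + r)"
  using assms(2)
proof induction
  case (add w r f c)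
  from abs_combination.add[OF add.IH add.hyps(2), of c] show ?case by (simp add: add.assoc)
qed (simp add: assms(1))

lemma abs_combination_scale:
  assumes "abs_combination F w r"
  shows "abs_combination F (\<lambda>x. t * w x) (\<bar>t\<bar> * r)"
  using assms
proof induction
  case zero
  then show ?case using abs_combination.zero by simp
next
  case (add w r f c)
  from abs_combination.add[OF add.IH add.hyps(2), of "t * c"] show ?case
    by (simp add: algebra_simps abs_mult)
qed

lemma abs_combination_single:
  assumes "f \<in> F" shows "abs_combination F f 1"
  using abs_combination.add[OF abs_combination.zero assms, of 1] by simp

definition bounded_fun :: "('i \<Rightarrow> real) \<Rightarrow> bool"
  where "bounded_fun a \<longleftrightarrow> (\<exists>C. \<forall>i. \<bar>a i\<bar> \<le> C)"

text \<open>
  Up to a factor \<open>2\<close> this is the gauge of \<open>2 ^ n W + 2 ^ -n B\<close> from the construction of Davis, Figiel,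
  Johnson and Pelczynski, where \<open>W\<close> is the absolutely convex hull of \<open>F\<close> and \<open>B\<close> the unit ball of
  the supremum norm.
\<close>

definition interpolation_norm :: "('i \<Rightarrow> real) set \<Rightarrow> nat \<Rightarrow> ('i \<Rightarrow> real) \<Rightarrow> real"
  where "interpolation_norm F n a =
    Inf {r / 2 ^ n + 2 ^ n * s | w r s. abs_combination F w r \<and> (\<forall>i. \<bar>a i - w i\<bar> \<le> s)}"

text \<open>
  The \<open>\<ell>\<^sub>2\<close>-sum of the original construction is replaced by a \<open>c\<^sub>0\<close>-sum.
\<close>

definition interpolation_space :: "('i \<Rightarrow> real) set \<Rightarrow> ('i \<Rightarrow> real) normed_module"
  where "interpolation_space F =
    \<lparr>carrier = {a. bounded_fun a \<and> (\<lambda>n. interpolation_norm F n a) \<longlonglongrightarrow> 0},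
     mult = undefined, one = undefined,
     zero = (\<lambda>i. 0), add = (\<lambda>a b i. a i + b i), smult = (\<lambda>c a i. c * a i),
     vnorm = (\<lambda>a. SUP n. interpolation_norm F n a)\<rparr>"

locale bounded_family =
  fixes F :: "('i \<Rightarrow> real) set" and D :: real
  assumes bound: "f \<in> F \<Longrightarrow> \<bar>f i\<bar> \<le> D" and D_nonneg: "0 \<le> D"
begin

abbreviation p where "p \<equiv> interpolation_norm F"
abbreviation V where "V \<equiv> interpolation_space F"

lemma combination_bound: "abs_combination F w r \<Longrightarrow> \<bar>w i\<bar> \<le> D * r"
  by (rule abs_combination_bounded) (auto intro: bound)

lemma p_set_nonneg:
  "t \<in> {r / 2 ^ n + 2 ^ n * s | w r s. abs_combination F w r \<and> (\<forall>i. \<bar>a i - w i\<bar> \<le> s)} \<Longrightarrow> 0 \<le> t"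
proof -
  assume "t \<in> {r / 2 ^ n + 2 ^ n * s | w r s. abs_combination F w r \<and> (\<forall>i. \<bar>a i - w i\<bar> \<le> s)}"
  then obtain w r s where *: "t = r / 2 ^ n + 2 ^ n * s" "abs_combination F w r" "\<forall>i. \<bar>a i - w i\<bar> \<le> s"
    by blast
  have "0 \<le> r" using *(2) by (rule abs_combination_nonneg)
  moreover have "0 \<le> s" using *(3) abs_ge_zero order_trans by blast
  ultimately show ?thesis by (simp add: *(1))
qed

lemma p_le:
  assumes "abs_combination F w r" "\<And>i. \<bar>a i - w i\<bar> \<le> s"
  shows "p n a \<le> r / 2 ^ n + 2 ^ n * s"
  unfolding interpolation_norm_def
  by (rule cInf_lower) (use assms in blast, rule bdd_belowI[of _ 0], rule p_set_nonneg, assumption)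

lemma p_less:
  assumes "bounded_fun a" "p n a < t"
  obtains w r s where "abs_combination F w r" "\<And>i. \<bar>a i - w i\<bar> \<le> s" "r / 2 ^ n + 2 ^ n * s < t"
proof -
  let ?S = "{r / 2 ^ n + 2 ^ n * s | w r s. abs_combination F w r \<and> (\<forall>i. \<bar>a i - w i\<bar> \<le> s)}"
  obtain C where C: "\<And>i. \<bar>a i\<bar> \<le> C" using assms(1) by (auto simp: bounded_fun_def)
  have "0 / 2 ^ n + 2 ^ n * C \<in> ?S"
    using C by (intro CollectI exI[of _ "\<lambda>_. 0"] exI[of _ 0] exI[of _ C]) (simp add: abs_combination.zero)
  then have "?S \<noteq> {}" by (metis (no_types, lifting) empty_iff)
  from cInf_lessD[OF this assms(2)[unfolded interpolation_norm_def]]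
  show thesis using that by blast
qed

lemma p_nonneg:
  assumes "bounded_fun a" shows "0 \<le> p n a"
proof (rule ccontr)
  assume "\<not> 0 \<le> p n a"
  then have "p n a < 0" by simp
  then obtain w r s where "abs_combination F w r" "\<And>i. \<bar>a i - w i\<bar> \<le> s" "r / 2 ^ n + 2 ^ n * s < 0"
    using p_less[OF assms] by blast
  moreover from this have "r / 2 ^ n + 2 ^ n * s \<ge> 0" by (intro p_set_nonneg[of _ n a]) blast
  ultimately show False by simp
qed

lemma p_le_sup:
  assumes "\<And>i. \<bar>a i\<bar> \<le> C" shows "p n a \<le> 2 ^ n * C"
  using p_le[OF abs_combination.zero, of a C n] assms by simp

text \<open>A generator needs no correction in the supremum norm, and weight 1 is discounted by
  \<open>2 ^ n\<close>. This decay places F inside the sum.\<close>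

lemma p_generator: "f \<in> F \<Longrightarrow> p n f \<le> 1 / 2 ^ n"
  using p_le[OF abs_combination_single, of f f 0 n] by simp

text \<open>An approximating w of weight r is bounded by D r, and the decomposition bounds r by
  \<open>2 ^ n * t\<close> and the remainder by t. Together with \<open>p_le_sup\<close>, each
  single p n is thus equivalent to the supremum norm; only the behaviour as n grows distinguishes
  elements of the space.\<close>

lemma sup_le_p:
  assumes "bounded_fun a" shows "\<bar>a i\<bar> \<le> (D * 2 ^ n + 1) * p n a"
proof (rule field_le_epsilon)
  fix e :: real assume "e > 0"
  define t where "t = p n a + e / (D * 2 ^ n + 1)"
  have pos: "D * 2 ^ n + 1 > 0" using D_nonneg by (simp add: add_nonneg_pos)
  have "p n a < t" using \<open>e > 0\<close> pos by (simp add: t_def)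
  then obtain w r s where *: "abs_combination F w r" "\<And>i. \<bar>a i - w i\<bar> \<le> s" "r / 2 ^ n + 2 ^ n * s < t"
    using p_less[OF assms] by blast
  have r: "0 \<le> r" using *(1) by (rule abs_combination_nonneg)
  have s: "0 \<le> s" using *(2)[of i] by linarith
  have "r / 2 ^ n \<le> t" using *(3) s by (smt (verit) mult_nonneg_nonneg zero_le_power)
  then have "r \<le> 2 ^ n * t" by (simp add: field_simps)
  then have Dr: "D * r \<le> D * 2 ^ n * t" using D_nonneg by (simp add: mult.assoc mult_left_mono)
  have "1 * s \<le> 2 ^ n * s" using s by (intro mult_right_mono) auto
  moreover have "0 \<le> r / 2 ^ n" using r by simp
  ultimately have "s \<le> t" using *(3) by linarith
  then have "\<bar>a i\<bar> \<le> D * 2 ^ n * t + t"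
    using *(2)[of i] combination_bound[OF *(1), of i] Dr by linarith
  also have "\<dots> = (D * 2 ^ n + 1) * t" by (simp add: algebra_simps)
  also have "\<dots> = (D * 2 ^ n + 1) * p n a + e" using pos by (simp add: t_def distrib_left)
  finally show "\<bar>a i\<bar> \<le> (D * 2 ^ n + 1) * p n a + e" .
qed

lemma bounded_fun_plus: "bounded_fun a \<Longrightarrow> bounded_fun b \<Longrightarrow> bounded_fun (\<lambda>i. a i + b i)" for a b :: "'i \<Rightarrow> real"
  unfolding bounded_fun_def by (meson abs_triangle_ineq add_mono order_trans)

lemma bounded_fun_scale: "bounded_fun a \<Longrightarrow> bounded_fun (\<lambda>i. c * a i)" for a :: "'i \<Rightarrow> real"
  unfolding bounded_fun_def by (metis abs_ge_zero abs_mult mult_left_mono)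

lemma p_triangle:
  assumes "bounded_fun a" "bounded_fun b"
  shows "p n (\<lambda>i. a i + b i) \<le> p n a + p n b"
proof (rule field_le_epsilon)
  fix e :: real assume e: "e > 0"
  obtain w r s where 1: "abs_combination F w r" "\<And>i. \<bar>a i - w i\<bar> \<le> s" "r / 2 ^ n + 2 ^ n * s < p n a + e / 2"
    using p_less[OF assms(1), of n "p n a + e / 2"] e by auto
  obtain w' r' s' where 2: "abs_combination F w' r'" "\<And>i. \<bar>b i - w' i\<bar> \<le> s'" "r' / 2 ^ n + 2 ^ n * s' < p n b + e / 2"
    using p_less[OF assms(2), of n "p n b + e / 2"] e by auto
  have "p n (\<lambda>i. a i + b i) \<le> (r + r') / 2 ^ n + 2 ^ n * (s + s')"
  proof (rule p_le[OF abs_combination_plus[OF 1(1) 2(1)]])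
    show "\<bar>a i + b i - (w i + w' i)\<bar> \<le> s + s'" for i using 1(2)[of i] 2(2)[of i] by linarith
  qed
  then show "p n (\<lambda>i. a i + b i) \<le> p n a + p n b + e"
    using 1(3) 2(3) by (simp add: add_divide_distrib distrib_left)
qed

lemma p_scale_le:
  assumes "bounded_fun a" shows "p n (\<lambda>i. c * a i) \<le> \<bar>c\<bar> * p n a"
proof (rule field_le_epsilon)
  fix e :: real assume e: "e > 0"
  define e' where "e' = e / (\<bar>c\<bar> + 1)"
  have e': "e' > 0" "\<bar>c\<bar> * e' \<le> e" using e by (auto simp: e'_def field_simps)
  obtain w r s where 1: "abs_combination F w r" "\<And>i. \<bar>a i - w i\<bar> \<le> s" "r / 2 ^ n + 2 ^ n * s < p n a + e'"
    using p_less[OF assms(1), of n "p n a + e'"] e' by auto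
  have "p n (\<lambda>i. c * a i) \<le> (\<bar>c\<bar> * r) / 2 ^ n + 2 ^ n * (\<bar>c\<bar> * s)"
  proof (rule p_le[OF abs_combination_scale[OF 1(1)]])
    show "\<bar>c * a i - c * w i\<bar> \<le> \<bar>c\<bar> * s" for i
      using mult_left_mono[OF 1(2)[of i], of "\<bar>c\<bar>"] by (simp add: right_diff_distrib flip: abs_mult)
  qed
  also have "\<dots> = \<bar>c\<bar> * (r / 2 ^ n + 2 ^ n * s)" by (simp add: algebra_simps)
  also have "\<dots> \<le> \<bar>c\<bar> * (p n a + e')" using 1(3) by (intro mult_left_mono) auto
  also have "\<dots> \<le> \<bar>c\<bar> * p n a + e" using e' by (simp add: distrib_left)
  finally show "p n (\<lambda>i. c * a i) \<le> \<bar>c\<bar> * p n a + e" .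
qed

lemma p_zero: "p n (\<lambda>_. 0) = 0"
  using p_le_sup[of "\<lambda>_. 0" 0 n] p_nonneg[of "\<lambda>_. 0" n] by (force simp: bounded_fun_def)

lemma p_scale:
  assumes "bounded_fun a" shows "p n (\<lambda>i. c * a i) = \<bar>c\<bar> * p n a"
proof (cases "c = 0")
  case True
  then show ?thesis by (simp add: p_zero)
next
  case False
  have "p n (\<lambda>i. (1 / c) * (c * a i)) \<le> \<bar>1 / c\<bar> * p n (\<lambda>i. c * a i)"
    by (rule p_scale_le[OF bounded_fun_scale[OF assms]])
  then have "\<bar>c\<bar> * p n a \<le> p n (\<lambda>i. c * a i)"
    using False by (simp add: field_simps)
  then show ?thesis using p_scale_le[OF assms, of n c] by simp
qed

section \<open>The interpolation space as a Banach space\<close>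

lemma carrier_V: "a \<in> carrier V \<longleftrightarrow> bounded_fun a \<and> (\<lambda>n. p n a) \<longlonglongrightarrow> 0"
  and zero_V: "\<zero>\<^bsub>V\<^esub> = (\<lambda>_. 0)" and add_V: "a \<oplus>\<^bsub>V\<^esub> b = (\<lambda>i. a i + b i)"
  and smult_V: "c \<odot>\<^bsub>V\<^esub> a = (\<lambda>i. c * a i)" and vnorm_V: "vnorm V a = (SUP n. p n a)"
  by (simp_all add: interpolation_space_def)

lemma V_bounded: "a \<in> carrier V \<Longrightarrow> bounded_fun a"
  by (simp add: carrier_V)

lemma plus_closed:
  assumes "a \<in> carrier V" "b \<in> carrier V" shows "(\<lambda>i. a i + b i) \<in> carrier V"
proof -
  have lim: "(\<lambda>n. p n a + p n b) \<longlonglongrightarrow> 0"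
    using assms tendsto_add[of "\<lambda>n. p n a" 0 sequentially "\<lambda>n. p n b" 0] by (simp add: carrier_V)
  have "(\<lambda>n. p n (\<lambda>i. a i + b i)) \<longlonglongrightarrow> 0"
    by (rule tendsto_sandwich[OF _ _ tendsto_const lim])
      (use assms in \<open>auto intro!: always_eventually p_nonneg p_triangle bounded_fun_plus simp: carrier_V\<close>)
  then show ?thesis using assms by (simp add: carrier_V bounded_fun_plus)
qed

lemma scale_closed:
  assumes "a \<in> carrier V" shows "(\<lambda>i. c * a i) \<in> carrier V"
  using assms tendsto_mult_right_zero[of "\<lambda>n. p n a" sequentially "\<bar>c\<bar>"]
  by (simp add: carrier_V bounded_fun_scale p_scale)

lemma p_le_vnorm:
  assumes "a \<in> carrier V" shows "p n a \<le> vnorm V a"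
proof -
  have "Bseq (\<lambda>n. p n a)" using assms by (intro convergent_imp_Bseq convergentI) (auto simp: carrier_V)
  then obtain K where "\<And>n. norm (p n a) \<le> K" by (auto simp: Bseq_def)
  then have "bdd_above (range (\<lambda>n. p n a))" by (intro bdd_aboveI[of _ K]) (auto simp: abs_le_iff)
  then show ?thesis unfolding vnorm_V by (rule cSUP_upper[OF UNIV_I])
qed

lemma vnorm_le: "(\<And>n. p n a \<le> C) \<Longrightarrow> vnorm V a \<le> C"
  unfolding vnorm_V by (rule cSUP_least) auto

lemma sup_le_vnorm:
  assumes "a \<in> carrier V" shows "\<bar>a i\<bar> \<le> (D + 1) * vnorm V a"
proof -
  have "\<bar>a i\<bar> \<le> (D + 1) * p 0 a" using sup_le_p[OF V_bounded[OF assms], of i 0] by simp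
  also have "\<dots> \<le> (D + 1) * vnorm V a"
    using p_le_vnorm[OF assms] D_nonneg by (intro mult_left_mono) auto
  finally show ?thesis .
qed

lemma generator_in_V:
  assumes "f \<in> F" shows "f \<in> carrier V"
proof -
  have bdd: "bounded_fun f" using bound[OF assms] by (auto simp: bounded_fun_def)
  have "(\<lambda>n. p n f) \<longlonglongrightarrow> 0"
  proof (rule tendsto_sandwich[OF _ _ tendsto_const])
    show "(\<lambda>n. (1 / 2 :: real) ^ n) \<longlonglongrightarrow> 0" by (rule LIMSEQ_power_zero) simp
  qed (use p_generator[OF assms] p_nonneg[OF bdd] in \<open>auto simp: power_one_over\<close>)
  then show ?thesis using bdd by (simp add: carrier_V)
qed

lemma real_normed_space_V: "real_normed_space V"
proof -
  interpret cring real_ring by (rule cring_real_ring)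
  have "abelian_group V"
  proof (rule abelian_groupI)
    show "\<zero>\<^bsub>V\<^esub> \<in> carrier V" by (simp add: zero_V carrier_V p_zero bounded_fun_def) (auto intro: exI[of _ 0])
    fix a assume "a \<in> carrier V"
    then show "\<exists>b\<in>carrier V. b \<oplus>\<^bsub>V\<^esub> a = \<zero>\<^bsub>V\<^esub>"
      by (intro bexI[of _ "\<lambda>i. (-1) * a i"] scale_closed) (auto simp: zero_V add_V)
  qed (auto simp: add_V zero_V plus_closed algebra_simps)
  then have "module real_ring V"
    by (intro module.intro cring_real_ring module_axioms.intro)
      (auto simp: real_ring_def add_V smult_V scale_closed algebra_simps)
  moreover have "real_normed_space_axioms V"
  proof
    fix a assume a: "a \<in> carrier V" "vnorm V a = 0"
    then show "a = \<zero>\<^bsub>V\<^esub>" using sup_le_vnorm[OF a(1)] by (auto simp: zero_V)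
  next
    fix a c assume a: "a \<in> carrier V"
    show "vnorm V (c \<odot>\<^bsub>V\<^esub> a) = \<bar>c\<bar> * vnorm V a"
    proof (rule antisym)
      have le: "vnorm V (c \<odot>\<^bsub>V\<^esub> a) \<le> \<bar>c\<bar> * vnorm V a" if a: "a \<in> carrier V" for c a
        using p_le_vnorm[OF a] by (intro vnorm_le) (simp add: smult_V p_scale[OF V_bounded[OF a]] mult_left_mono)
      then show "vnorm V (c \<odot>\<^bsub>V\<^esub> a) \<le> \<bar>c\<bar> * vnorm V a" using a by blast
      have zero: "0 \<le> vnorm V b" if "b \<in> carrier V" for b
        using p_le_vnorm[OF that, of 0] p_nonneg[OF V_bounded[OF that], of 0] by linarith
      show "\<bar>c\<bar> * vnorm V a \<le> vnorm V (c \<odot>\<^bsub>V\<^esub> a)"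
      proof (cases "c = 0")
        case True
        then show ?thesis using zero[OF scale_closed[OF a, of c]] by (simp add: smult_V)
      next
        case False
        have "vnorm V ((1 / c) \<odot>\<^bsub>V\<^esub> (c \<odot>\<^bsub>V\<^esub> a)) \<le> \<bar>1 / c\<bar> * vnorm V (c \<odot>\<^bsub>V\<^esub> a)"
          using le[where c = "1 / c", OF scale_closed[OF a, of c]] by (simp only: smult_V)
        moreover have "(1 / c) \<odot>\<^bsub>V\<^esub> (c \<odot>\<^bsub>V\<^esub> a) = a" using False by (simp add: smult_V)
        ultimately show ?thesis using False by (simp add: field_simps)
      qed
    qed
  next
    fix a b assume ab: "a \<in> carrier V" "b \<in> carrier V"
    show "vnorm V (a \<oplus>\<^bsub>V\<^esub> b) \<le> vnorm V a + vnorm V b"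
    proof (rule vnorm_le)
      fix n
      have "p n (a \<oplus>\<^bsub>V\<^esub> b) \<le> p n a + p n b" unfolding add_V using ab by (intro p_triangle V_bounded)
      then show "p n (a \<oplus>\<^bsub>V\<^esub> b) \<le> vnorm V a + vnorm V b"
        using p_le_vnorm[OF ab(1), of n] p_le_vnorm[OF ab(2), of n] by linarith
    qed
  qed
  ultimately show ?thesis by (rule real_normed_space.intro)
qed

sublocale V: real_normed_space V
  by (rule real_normed_space_V)

lemma minus_V: "a \<in> carrier V \<Longrightarrow> b \<in> carrier V \<Longrightarrow> a \<ominus>\<^bsub>V\<^esub> b = (\<lambda>i. a i - b i)"
  by (simp add: V.minus_eq add_V smult_V)

lemma bounded_fun_minus: "bounded_fun a \<Longrightarrow> bounded_fun b \<Longrightarrow> bounded_fun (\<lambda>i. a i - b i)" for a b :: "'i \<Rightarrow> real"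
  using bounded_fun_plus[of a "\<lambda>i. (-1) * b i"] bounded_fun_scale[of b "-1"] by simp

lemma p_minus_commute: "bounded_fun a \<Longrightarrow> bounded_fun b \<Longrightarrow> p n (\<lambda>i. a i - b i) = p n (\<lambda>i. b i - a i)"
  using p_scale[OF bounded_fun_minus, of a b n "-1"] by simp

text \<open>A Cauchy sequence converges uniformly, which controls every individual p k. The Cauchy
  condition in the norm makes the control uniform in k, and then the decay of p k passes to the
  limit.\<close>

lemma banach_space_V: "banach_space V"
  unfolding banach_space_def V.mcomplete_iff
proof (intro conjI allI impI)
  show "real_normed_space V" by (rule real_normed_space_V)
  fix \<sigma> :: "nat \<Rightarrow> 'i \<Rightarrow> real"
  assume "(\<forall>n. \<sigma> n \<in> carrier V) \<and> (\<forall>\<epsilon>>0. \<exists>N. \<forall>n\<ge>N. \<forall>n'\<ge>N. vnorm V (\<sigma> n \<ominus>\<^bsub>V\<^esub> \<sigma> n') < \<epsilon>)"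
  then have \<sigma>: "\<And>n. \<sigma> n \<in> carrier V"
    and Cauchy: "\<And>\<epsilon>. \<epsilon> > 0 \<Longrightarrow> \<exists>N. \<forall>n\<ge>N. \<forall>n'\<ge>N. vnorm V (\<sigma> n \<ominus>\<^bsub>V\<^esub> \<sigma> n') < \<epsilon>" by auto
  have diff: "\<bar>\<sigma> n i - \<sigma> n' i\<bar> \<le> (D + 1) * vnorm V (\<sigma> n \<ominus>\<^bsub>V\<^esub> \<sigma> n')" for n n' i
    using sup_le_vnorm[OF V.M.minus_closed[OF \<sigma>[of n] \<sigma>[of n']], of i] \<sigma> by (simp add: minus_V)
  have sup_Cauchy: "\<exists>N. \<forall>n\<ge>N. \<forall>n'\<ge>N. \<forall>i. \<bar>\<sigma> n i - \<sigma> n' i\<bar> < e" if "e > 0" for e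
  proof -
    have "e / (D + 1) > 0" using that D_nonneg by simp
    then obtain N where N: "\<forall>n\<ge>N. \<forall>n'\<ge>N. vnorm V (\<sigma> n \<ominus>\<^bsub>V\<^esub> \<sigma> n') < e / (D + 1)" using Cauchy by blast
    have "\<bar>\<sigma> n i - \<sigma> n' i\<bar> < e" if "n \<ge> N" "n' \<ge> N" for n n' i
    proof -
      have "(D + 1) * vnorm V (\<sigma> n \<ominus>\<^bsub>V\<^esub> \<sigma> n') < (D + 1) * (e / (D + 1))"
        using N that D_nonneg by (intro mult_strict_left_mono) auto
      then show ?thesis using diff[of n i n'] D_nonneg by simp
    qed
    then show ?thesis by blast
  qed
  have "convergent (\<lambda>n. \<sigma> n i)" for i
    unfolding Cauchy_convergent_iff[symmetric]
  proof (rule CauchyI)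
    fix e :: real assume "0 < e"
    then show "\<exists>M. \<forall>m\<ge>M. \<forall>n\<ge>M. norm (\<sigma> m i - \<sigma> n i) < e" using sup_Cauchy[of e] by force
  qed
  then have "\<exists>l. \<forall>i. (\<lambda>n. \<sigma> n i) \<longlonglongrightarrow> l i" unfolding convergent_def by (rule choice[OF allI])
  then obtain l where l: "\<And>i. (\<lambda>n. \<sigma> n i) \<longlonglongrightarrow> l i" by blast
  have unif: "\<exists>N. \<forall>n\<ge>N. \<forall>i. \<bar>\<sigma> n i - l i\<bar> \<le> e" if e: "e > 0" for e
  proof -
    obtain N where N: "\<forall>n\<ge>N. \<forall>n'\<ge>N. \<forall>i. \<bar>\<sigma> n i - \<sigma> n' i\<bar> < e" using sup_Cauchy[OF e] by blast
    have "\<bar>\<sigma> n i - l i\<bar> \<le> e" if "n \<ge> N" for n i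
    proof (rule tendsto_upperbound)
      show "(\<lambda>n'. \<bar>\<sigma> n i - \<sigma> n' i\<bar>) \<longlonglongrightarrow> \<bar>\<sigma> n i - l i\<bar>" by (intro tendsto_intros l)
      show "\<forall>\<^sub>F n' in sequentially. \<bar>\<sigma> n i - \<sigma> n' i\<bar> \<le> e"
        unfolding eventually_sequentially using N that less_imp_le by blast
    qed simp
    then show ?thesis by blast
  qed
  have bl: "bounded_fun l"
  proof -
    obtain N where N: "\<forall>n\<ge>N. \<forall>i. \<bar>\<sigma> n i - l i\<bar> \<le> 1" using unif[of 1] by auto
    obtain C where C: "\<And>i. \<bar>\<sigma> N i\<bar> \<le> C" using V_bounded[OF \<sigma>[of N]] by (auto simp: bounded_fun_def)
    have "\<bar>l i\<bar> \<le> C + 1" for i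
    proof -
      have "\<bar>\<sigma> N i - l i\<bar> \<le> 1" using N by simp
      then show ?thesis using C[of i] by linarith
    qed
    then show ?thesis unfolding bounded_fun_def by blast
  qed
  have b\<sigma>: "bounded_fun (\<sigma> n)" for n using V_bounded[OF \<sigma>] .
  have close: "\<exists>N. \<forall>n\<ge>N. \<forall>k. p k (\<lambda>i. \<sigma> n i - l i) \<le> e" if "e > 0" for e
  proof -
    have "e / 2 > 0" using that by simp
    then obtain N where N: "\<forall>n\<ge>N. \<forall>n'\<ge>N. vnorm V (\<sigma> n \<ominus>\<^bsub>V\<^esub> \<sigma> n') < e / 2" using Cauchy by blast
    have "p k (\<lambda>i. \<sigma> n i - l i) \<le> e" if n: "n \<ge> N" for n k
    proof -
      have "e / 2 / 2 ^ k > 0" using \<open>e > 0\<close> by simp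
      \<comment> \<open>The uniform approximation required for p k depends on k. The detour through
        a later term of the sequence keeps N itself independent of k.\<close>
      then obtain N' where N': "\<forall>m\<ge>N'. \<forall>i. \<bar>\<sigma> m i - l i\<bar> \<le> e / 2 / 2 ^ k" using unif by blast
      let ?m = "max N N'"
      have "p k (\<lambda>i. \<sigma> ?m i - l i) \<le> 2 ^ k * (e / 2 / 2 ^ k)" by (rule p_le_sup) (use N' in simp)
      moreover have "p k (\<lambda>i. \<sigma> n i - \<sigma> ?m i) \<le> e / 2"
      proof -
        have "vnorm V (\<sigma> n \<ominus>\<^bsub>V\<^esub> \<sigma> ?m) < e / 2" using N n by simp
        moreover have "p k (\<sigma> n \<ominus>\<^bsub>V\<^esub> \<sigma> ?m) \<le> vnorm V (\<sigma> n \<ominus>\<^bsub>V\<^esub> \<sigma> ?m)"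
          by (rule p_le_vnorm[OF V.M.minus_closed[OF \<sigma>[of n] \<sigma>[of ?m]]])
        ultimately show ?thesis unfolding minus_V[OF \<sigma> \<sigma>] by linarith
      qed
      moreover have "p k (\<lambda>i. (\<sigma> n i - \<sigma> ?m i) + (\<sigma> ?m i - l i)) \<le> p k (\<lambda>i. \<sigma> n i - \<sigma> ?m i) + p k (\<lambda>i. \<sigma> ?m i - l i)"
        by (intro p_triangle bounded_fun_minus b\<sigma> bl)
      ultimately show ?thesis by simp
    qed
    then show ?thesis by blast
  qed
  have "(\<lambda>k. p k l) \<longlonglongrightarrow> 0"
  proof (rule LIMSEQ_I)
    fix e :: real assume "0 < e"
    then obtain N where N: "\<forall>k. p k (\<lambda>i. \<sigma> N i - l i) \<le> e / 2" using close[of "e / 2"] by auto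
    obtain k0 where k0: "\<And>k. k \<ge> k0 \<Longrightarrow> p k (\<sigma> N) < e / 2"
    proof -
      obtain k0 where "\<forall>k\<ge>k0. norm (p k (\<sigma> N) - 0) < e / 2"
        using \<sigma>[of N] LIMSEQ_D[of "\<lambda>k. p k (\<sigma> N)" 0 "e / 2"] \<open>0 < e\<close> by (auto simp: carrier_V)
      then show ?thesis by (intro that[of k0]) auto
    qed
    have "norm (p k l - 0) < e" if "k \<ge> k0" for k
    proof -
      have "p k (\<lambda>i. \<sigma> N i + (l i - \<sigma> N i)) \<le> p k (\<sigma> N) + p k (\<lambda>i. l i - \<sigma> N i)"
        by (intro p_triangle bounded_fun_minus b\<sigma> bl)
      then have "p k l \<le> p k (\<sigma> N) + p k (\<lambda>i. \<sigma> N i - l i)"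
        using p_minus_commute[OF b\<sigma> bl, of k N] by simp
      then have "p k l < e" using N[rule_format, of k] k0[OF that] by linarith
      then show ?thesis using p_nonneg[OF bl, of k] by simp
    qed
    then show "\<exists>k0. \<forall>k\<ge>k0. norm (p k l - 0) < e" by blast
  qed
  then have lV: "l \<in> carrier V" using bl by (simp add: carrier_V)
  moreover have "\<exists>N. \<forall>n\<ge>N. vnorm V (\<sigma> n \<ominus>\<^bsub>V\<^esub> l) < \<epsilon>" if \<epsilon>: "\<epsilon> > 0" for \<epsilon>
  proof -
    obtain N where N: "\<forall>n\<ge>N. \<forall>k. p k (\<lambda>i. \<sigma> n i - l i) \<le> \<epsilon> / 2" using close[of "\<epsilon> / 2"] \<epsilon> by auto
    have "vnorm V (\<sigma> n \<ominus>\<^bsub>V\<^esub> l) \<le> \<epsilon> / 2" if "n \<ge> N" for n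
      unfolding minus_V[OF \<sigma> lV] by (rule vnorm_le) (use N that in blast)
    moreover have "\<epsilon> / 2 < \<epsilon>" using \<epsilon> by simp
    ultimately show ?thesis by (meson order.strict_trans1)
  qed
  ultimately show "\<exists>v\<in>carrier V. \<forall>\<epsilon>>0. \<exists>N. \<forall>n\<ge>N. vnorm V (\<sigma> n \<ominus>\<^bsub>V\<^esub> v) < \<epsilon>" by blast
qed

section \<open>Copies of l1 in the interpolation space\<close>

lemma sum_closed:
  assumes "\<And>k. v k \<in> carrier V" "finite I"
  shows "(\<lambda>i. \<Sum>k\<in>I. c k * v k i) \<in> carrier V"
  using assms(2)
proof induction
  case empty
  then show ?case using V.M.zero_closed by (simp add: zero_V)
next
  case (insert k I)
  then show ?case using plus_closed[OF scale_closed[OF assms(1)] insert.IH] by simp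
qed

lemma vnorm_sum_le:
  assumes "\<And>k. v k \<in> carrier V" "\<And>k. vnorm V (v k) \<le> M" "finite I"
  shows "vnorm V (\<lambda>i. \<Sum>k\<in>I. c k * v k i) \<le> M * (\<Sum>k\<in>I. \<bar>c k\<bar>)"
  using assms(3)
proof induction
  case empty
  then show ?case using V.vnorm_zero by (simp add: zero_V)
next
  case (insert k I)
  have "vnorm V (\<lambda>i. \<Sum>k\<in>insert k I. c k * v k i)
      \<le> vnorm V (\<lambda>i. c k * v k i) + vnorm V (\<lambda>i. \<Sum>k\<in>I. c k * v k i)"
    using V.vnorm_triangle[OF scale_closed[OF assms(1)] sum_closed[OF assms(1) insert.hyps(1)]] insert.hyps
    by (simp add: add_V)
  also have "vnorm V (\<lambda>i. c k * v k i) = \<bar>c k\<bar> * vnorm V (v k)"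
    using V.vnorm_smult[OF assms(1)] by (simp add: smult_V)
  also have "\<dots> \<le> \<bar>c k\<bar> * M" using assms(2) by (intro mult_left_mono) auto
  finally show ?case using insert by (simp add: algebra_simps)
qed

text \<open>
  Gliding hump.  A vector whose supremum norm is small has small interpolation norms up to a
  prescribed index, and every vector has small ones from some index on; so vectors that are small in
  the supremum norm can be added without increasing the norm much.
\<close>

lemma ell1_sequence_sup_lower:
  assumes v: "\<And>k::nat. v k \<in> carrier V" and M: "\<And>k. vnorm V (v k) \<le> M" and "\<rho> > 0"
    and low: "\<And>I c. finite I \<Longrightarrow> \<rho> * (\<Sum>k\<in>I. \<bar>c k\<bar>) \<le> vnorm V (\<lambda>i. \<Sum>k\<in>I. c k * v k i)"
  shows "\<exists>m. \<exists>\<eta>>0. sup_ell1_lower UNIV (\<lambda>k. v (m + k)) \<eta>"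
proof (rule ccontr)
  assume neg: "\<not> ?thesis"
  \<comment> \<open>Wherever the lower estimate in the supremum norm fails, normalising the
    coefficients gives a block beyond m with coefficient mass 1 and arbitrarily small supremum
    norm.\<close>
  have small: "\<exists>I c. finite I \<and> (\<forall>k\<in>I. m \<le> k) \<and> (\<Sum>k\<in>I. \<bar>c k\<bar>) = 1 \<and> (\<forall>i. \<bar>\<Sum>k\<in>I. c k * v k i\<bar> \<le> \<eta>)"
    if "\<eta> > 0" for m \<eta>
  proof -
    have "\<not> sup_ell1_lower UNIV (\<lambda>k. v (m + k)) \<eta>" using neg that by blast
    then obtain I c s where I: "finite I" "\<And>i. \<bar>\<Sum>k\<in>I. c k * v (m + k) i\<bar> \<le> s" "s < \<eta> * (\<Sum>k\<in>I. \<bar>c k\<bar>)"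
      unfolding sup_ell1_lower_def by (force simp: not_le)
    define t where "t = (\<Sum>k\<in>I. \<bar>c k\<bar>)"
    have "0 \<le> s" using I(2) abs_ge_zero order_trans by blast
    then have "0 < \<eta> * t" using I(3) by (simp add: t_def)
    then have t: "t > 0" using that by (simp add: zero_less_mult_iff)
    have inj: "inj_on ((+) m) I" by simp
    show ?thesis
    proof (intro exI[of _ "(+) m ` I"] exI[of _ "\<lambda>k. c (k - m) / t"] conjI)
      show "(\<Sum>k\<in>(+) m ` I. \<bar>c (k - m) / t\<bar>) = 1"
        using t unfolding sum.reindex[OF inj] by (simp add: o_def t_def flip: sum_divide_distrib)
      show "\<forall>i. \<bar>\<Sum>k\<in>(+) m ` I. c (k - m) / t * v k i\<bar> \<le> \<eta>"
      proof
        fix i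
        have "(\<Sum>k\<in>(+) m ` I. c (k - m) / t * v k i) = (\<Sum>k\<in>I. c k * v (m + k) i) / t"
          unfolding sum.reindex[OF inj] by (simp add: o_def sum_divide_distrib)
        moreover have "\<bar>(\<Sum>k\<in>I. c k * v (m + k) i) / t\<bar> \<le> \<eta>"
        proof -
          have "\<bar>\<Sum>k\<in>I. c k * v (m + k) i\<bar> \<le> \<eta> * t" using I(2)[of i] I(3) unfolding t_def by linarith
          then show ?thesis using t by (simp add: pos_divide_le_eq)
        qed
        ultimately show "\<bar>\<Sum>k\<in>(+) m ` I. c (k - m) / t * v k i\<bar> \<le> \<eta>" by simp
      qed
    qed (use I(1) in auto)
  qed
  \<comment> \<open>Sums of j blocks have coefficient mass j but norm at most M + j \<rho> / 2,
    which falls below the required j \<rho> once j exceeds 2 M / \<rho>.\<close>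
  define \<eta> where "\<eta> = \<rho> / 2"
  have "\<eta> > 0" using \<open>\<rho> > 0\<close> by (simp add: \<eta>_def)
  have "0 \<le> M" using M[of 0] V.vnorm_nonneg[OF v[of 0]] by linarith
  have ex: "\<exists>A C. finite A \<and> (\<Sum>k\<in>A. \<bar>C k\<bar>) = real j \<and> (\<forall>n. p n (\<lambda>i. \<Sum>k\<in>A. C k * v k i) \<le> M + j * \<eta>)" for j :: nat
  proof (induction j)
    case 0
    show ?case using \<open>0 \<le> M\<close> by (intro exI[of _ "{}"]) (simp add: p_zero)
  next
    case (Suc j)
    then obtain A C where A: "finite A" "(\<Sum>k\<in>A. \<bar>C k\<bar>) = real j"
      "\<And>n. p n (\<lambda>i. \<Sum>k\<in>A. C k * v k i) \<le> M + j * \<eta>" by blast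
    define U where "U i = (\<Sum>k\<in>A. C k * v k i)" for i
    have U: "U \<in> carrier V" unfolding U_def[abs_def] by (rule sum_closed[OF v A(1)])
    obtain n0 where n0: "\<And>n. n \<ge> n0 \<Longrightarrow> p n U < \<eta>"
    proof -
      obtain n0 where "\<forall>n\<ge>n0. norm (p n U - 0) < \<eta>"
        using U LIMSEQ_D[of "\<lambda>k. p k U" 0 \<eta>] \<open>\<eta> > 0\<close> by (auto simp: carrier_V)
      then show ?thesis by (intro that[of n0]) auto
    qed
    obtain m where m: "\<And>k. k \<in> A \<Longrightarrow> k < m" using finite_nat_set_iff_bounded[of A] A(1) by auto
    \<comment> \<open>The new block starts beyond all indices used so far. Its supremum norm makes p
      n of it at most \<eta> for n < n0; for n from n0 on it may cost M, but there the old sum costs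
      less than \<eta>.\<close>
    obtain I c where I: "finite I" "\<And>k. k \<in> I \<Longrightarrow> m \<le> k" "(\<Sum>k\<in>I. \<bar>c k\<bar>) = 1"
      "\<And>i. \<bar>\<Sum>k\<in>I. c k * v k i\<bar> \<le> \<eta> / 2 ^ n0"
      using small[of "\<eta> / 2 ^ n0" m] \<open>\<eta> > 0\<close> by auto
    define u where "u i = (\<Sum>k\<in>I. c k * v k i)" for i
    have u: "u \<in> carrier V" unfolding u_def[abs_def] by (rule sum_closed[OF v I(1)])
    have disj: "A \<inter> I = {}" using m I(2) by force
    define C' where "C' k = (if k \<in> I then c k else C k)" for k
    have split: "(\<Sum>k\<in>A \<union> I. g (C' k) k) = (\<Sum>k\<in>A. g (C k) k) + (\<Sum>k\<in>I. g (c k) k)" for g :: "real \<Rightarrow> nat \<Rightarrow> real"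
    proof -
      have "(\<Sum>k\<in>A. g (C' k) k) = (\<Sum>k\<in>A. g (C k) k)"
        by (rule sum.cong) (use disj in \<open>auto simp: C'_def\<close>)
      moreover have "(\<Sum>k\<in>I. g (C' k) k) = (\<Sum>k\<in>I. g (c k) k)" by (rule sum.cong) (auto simp: C'_def)
      ultimately show ?thesis using sum.union_disjoint[OF A(1) I(1) disj, of "\<lambda>k. g (C' k) k"] by simp
    qed
    have "p n (\<lambda>i. U i + u i) \<le> M + Suc j * \<eta>" for n
    proof -
      have tri: "p n (\<lambda>i. U i + u i) \<le> p n U + p n u" by (intro p_triangle V_bounded U u)
      show ?thesis
      proof (cases "n \<ge> n0")
        case True
        have "p n u \<le> M * 1"
          using p_le_vnorm[OF u, of n] vnorm_sum_le[where v = v and M = M and I = I and c = c, OF v M I(1)] I(3)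
          by (simp add: u_def[abs_def])
        moreover have "0 \<le> j * \<eta>" using \<open>\<eta> > 0\<close> by simp
        ultimately show ?thesis using tri n0[OF True] by (simp add: distrib_right) 
      next
        case False
        have "p n u \<le> 2 ^ n * (\<eta> / 2 ^ n0)" by (rule p_le_sup) (use I(4) in \<open>simp add: u_def\<close>)
        also have "\<dots> \<le> 2 ^ n0 * (\<eta> / 2 ^ n0)"
          using False \<open>\<eta> > 0\<close> by (intro mult_right_mono power_increasing) auto
        finally have "p n u \<le> \<eta>" by simp
        then show ?thesis using tri A(3)[of n] by (simp add: distrib_right U_def[abs_def])
      qed
    qed
    moreover have "(\<lambda>i. \<Sum>k\<in>A \<union> I. C' k * v k i) = (\<lambda>i. U i + u i)"
      using split[of "\<lambda>t k. t * v k i" for i] by (simp add: U_def u_def fun_eq_iff)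
    moreover have "(\<Sum>k\<in>A \<union> I. \<bar>C' k\<bar>) = real (Suc j)"
      using split[of "\<lambda>t k. \<bar>t\<bar>"] A(2) I(3) by simp
    moreover have "finite (A \<union> I)" using A(1) I(1) by simp
    ultimately show ?case by (intro exI[of _ "A \<union> I"] exI[of _ C'] conjI) simp_all
  qed
  obtain j :: nat where j: "2 * M / \<rho> < j" using reals_Archimedean2 by blast
  obtain A C where A: "finite A" "(\<Sum>k\<in>A. \<bar>C k\<bar>) = real j"
    "\<And>n. p n (\<lambda>i. \<Sum>k\<in>A. C k * v k i) \<le> M + j * \<eta>" using ex[of j] by blast
  have "\<rho> * j \<le> M + j * \<eta>"
    using low[OF A(1), of C] vnorm_le[OF A(3)] A(2) by (metis order_trans)
  then have "\<rho> * j \<le> 2 * M" by (simp add: \<eta>_def algebra_simps)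
  then show False using j \<open>\<rho> > 0\<close> by (simp add: field_simps)
qed

text \<open>The images of the unit vectors satisfy two-sided l1-estimates, so a tail of them has a
  lower estimate \<eta> in the supremum norm. One p n with n large approximates them within \<eta> /
  2 by combinations of bounded weight; the perturbation leaves half of the estimate, and scaling
  brings the weights down to 1.\<close>

lemma contains_ell1_imp_combinations:
  assumes "contains_isomorphic_copy V l1_space"
  shows "\<exists>w. \<exists>\<delta>>0. (\<forall>k::nat. \<exists>r\<le>1. abs_combination F (w k) r) \<and> sup_ell1_lower UNIV w \<delta>"
proof -
  obtain S where S: "linear_operator l1_space V S"
    and emb: "embedding_map (norm_topology l1_space) (norm_topology V) S"
    using assms unfolding contains_isomorphic_copy_def by blast
  interpret S: linear_map_of_normed_spaces l1_space V S
    by (intro linear_map_of_normed_spaces.intro real_normed_space_l1_space real_normed_space_V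
        linear_map_of_normed_spaces_axioms.intro S)
  obtain \<rho> where \<rho>: "\<rho> > 0" "\<And>a. a \<in> carrier l1_space \<Longrightarrow> \<rho> * vnorm l1_space a \<le> vnorm V (S a)"
    using S.bounded_below_of_embedding[OF emb] by blast
  have "continuous_map (norm_topology l1_space) (norm_topology V) S"
    using emb unfolding embedding_map_def
    by (meson continuous_map_in_subtopology homeomorphic_imp_continuous_map)
  then obtain M where M: "M > 0" "\<And>a. a \<in> carrier l1_space \<Longrightarrow> vnorm V (S a) \<le> M * vnorm l1_space a"
    using S.bounded_of_continuous by blast
  define e :: "nat \<Rightarrow> nat \<Rightarrow> real" where "e k = (\<lambda>n. if n = k then 1 else 0)" for k
  define fs where "fs I c = (\<lambda>n. if n \<in> I then c n else 0)" for I and c :: "nat \<Rightarrow> real"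
  have fs: "fs I c \<in> carrier l1_space" "vnorm l1_space (fs I c) = (\<Sum>k\<in>I. \<bar>c k\<bar>)" if "finite I" for I c
  proof -
    have "(\<lambda>n. \<bar>fs I c n\<bar>) sums (\<Sum>n\<in>I. \<bar>fs I c n\<bar>)"
      by (rule sums_finite[OF that]) (simp add: fs_def)
    moreover have "(\<Sum>n\<in>I. \<bar>fs I c n\<bar>) = (\<Sum>k\<in>I. \<bar>c k\<bar>)" by (rule sum.cong) (auto simp: fs_def)
    ultimately show "fs I c \<in> carrier l1_space" "vnorm l1_space (fs I c) = (\<Sum>k\<in>I. \<bar>c k\<bar>)"
      by (auto simp: l1_space_def sums_iff)
  qed
  have e_fs: "e k = fs {k} (\<lambda>_. 1)" for k by (auto simp: e_def fs_def)
  have e: "e k \<in> carrier l1_space" "vnorm l1_space (e k) = 1" for k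
    using fs[of "{k}" "\<lambda>_. 1"] by (auto simp: e_fs)
  define v where "v k = S (e k)" for k
  have v: "v k \<in> carrier V" "vnorm V (v k) \<le> M" for k
    using S.closed e M(2)[OF e(1), of k] by (auto simp: v_def)
  have S_fs: "S (fs I c) = (\<lambda>i. \<Sum>k\<in>I. c k * v k i)" if "finite I" for I c
    using that
  proof induction
    case empty
    have "fs {} c = \<zero>\<^bsub>l1_space\<^esub>" by (simp add: fs_def l1_space_def)
    then show ?case by (simp add: S.zero zero_V)
  next
    case (insert k I)
    have "fs (insert k I) c = c k \<odot>\<^bsub>l1_space\<^esub> e k \<oplus>\<^bsub>l1_space\<^esub> fs I c"
      using insert.hyps by (auto simp: fs_def e_def l1_space_def)
    then have "S (fs (insert k I) c) = c k \<odot>\<^bsub>V\<^esub> v k \<oplus>\<^bsub>V\<^esub> S (fs I c)"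
      using e(1)[of k] fs(1)[OF insert.hyps(1), of c]
      by (simp add: S.add S.smult S.W.real_smult_closed v_def)
    then show ?case using insert by (simp add: add_V smult_V)
  qed
  obtain m \<eta> where \<eta>: "\<eta> > 0" "sup_ell1_lower UNIV (\<lambda>k. v (m + k)) \<eta>"
  proof -
    have "\<rho> * (\<Sum>k\<in>I. \<bar>c k\<bar>) \<le> vnorm V (\<lambda>i. \<Sum>k\<in>I. c k * v k i)" if "finite I" for I c
      using \<rho>(2)[OF fs(1)[OF that, of c]] fs(2)[OF that, of c] S_fs[OF that, of c] by simp
    from ell1_sequence_sup_lower[of v, OF v \<rho>(1) this] show ?thesis using that by blast
  qed
  \<comment> \<open>This n makes \<open>2 ^ n * s \<le> M + 1\<close> force s to be at most \<eta> /
    2. The weights are then bounded by K, since r is at most \<open>2 ^ n * (M + 1)\<close>.\<close>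
  obtain n where n: "2 * (M + 1) / \<eta> < 2 ^ n" using real_arch_pow[of 2] by auto
  define K where "K = 2 ^ n * (M + 1)"
  have "K > 0" using M(1) by (simp add: K_def)
  have "\<exists>w r. abs_combination F w r \<and> r \<le> K \<and> (\<forall>i. \<bar>v (m + k) i - w i\<bar> \<le> \<eta> / 2)" for k
  proof -
    have "p n (v (m + k)) < M + 1" using p_le_vnorm[OF v(1), of n "m + k"] v(2)[of "m + k"] by linarith
    then obtain w r s where w: "abs_combination F w r" "\<And>i. \<bar>v (m + k) i - w i\<bar> \<le> s" "r / 2 ^ n + 2 ^ n * s < M + 1"
      using p_less[OF V_bounded[OF v(1)]] by blast
    have "0 \<le> s" using w(2) abs_ge_zero order_trans by blast
    have "0 \<le> r" using w(1) by (rule abs_combination_nonneg)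
    have "0 \<le> 2 ^ n * s" using \<open>0 \<le> s\<close> by simp
    then have "r / 2 ^ n \<le> M + 1" using w(3) by linarith
    then have "r \<le> K" by (simp add: K_def field_simps)
    have "0 \<le> r / 2 ^ n" using \<open>0 \<le> r\<close> by simp
    then have "2 ^ n * s \<le> M + 1" using w(3) by linarith
    also have "M + 1 \<le> 2 ^ n * (\<eta> / 2)" using n \<eta>(1) by (simp add: field_simps)
    finally have "s \<le> \<eta> / 2" by simp
    then have "\<forall>i. \<bar>v (m + k) i - w i\<bar> \<le> \<eta> / 2" using w(2) order_trans by blast
    then show ?thesis using w(1) \<open>r \<le> K\<close> by blast
  qed
  then obtain w r where w: "\<And>k. abs_combination F (w k) (r k)" "\<And>k. r k \<le> K"
    "\<And>k i. \<bar>v (m + k) i - w k i\<bar> \<le> \<eta> / 2" by metis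
  define w' where "w' k i = 1 / K * w k i" for k i
  have "\<exists>t\<le>1. abs_combination F (w' k) t" for k
    using abs_combination_scale[OF w(1), of "1 / K" k] w(2)[of k] \<open>K > 0\<close>
    by (intro exI[of _ "\<bar>1 / K\<bar> * r k"]) (simp add: w'_def[abs_def])
  moreover have "sup_ell1_lower UNIV w' (\<eta> / 2 / K)"
    unfolding sup_ell1_lower_def
  proof (intro allI impI)
    fix I c s assume I: "finite I" and s: "\<forall>i\<in>UNIV. \<bar>\<Sum>k\<in>I. c k * w' k i\<bar> \<le> s"
    have "\<bar>\<Sum>k\<in>I. c k * v (m + k) i\<bar> \<le> K * s + \<eta> / 2 * (\<Sum>k\<in>I. \<bar>c k\<bar>)" for i
    proof -
      have "\<bar>(\<Sum>k\<in>I. c k * v (m + k) i) - (\<Sum>k\<in>I. c k * w k i)\<bar> = \<bar>\<Sum>k\<in>I. c k * (v (m + k) i - w k i)\<bar>"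
        by (simp add: right_diff_distrib sum_subtractf)
      also have "\<dots> \<le> (\<Sum>k\<in>I. \<bar>c k * (v (m + k) i - w k i)\<bar>)" by (rule sum_abs)
      also have "\<dots> \<le> (\<Sum>k\<in>I. \<bar>c k\<bar> * (\<eta> / 2))"
        unfolding abs_mult by (intro sum_mono mult_left_mono w(3)) simp
      also have "\<dots> = \<eta> / 2 * (\<Sum>k\<in>I. \<bar>c k\<bar>)" by (simp add: sum_distrib_left mult.commute)
      finally have 1: "\<bar>(\<Sum>k\<in>I. c k * v (m + k) i) - (\<Sum>k\<in>I. c k * w k i)\<bar> \<le> \<eta> / 2 * (\<Sum>k\<in>I. \<bar>c k\<bar>)" .
      have "(\<Sum>k\<in>I. c k * w' k i) = (\<Sum>k\<in>I. c k * w k i) / K"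
        by (simp add: w'_def sum_divide_distrib)
      then have "\<bar>\<Sum>k\<in>I. c k * w k i\<bar> \<le> K * s"
        using s[rule_format, of i] \<open>K > 0\<close> by (simp add: pos_divide_le_eq mult.commute)
      then show ?thesis using 1 by linarith
    qed
    then have "\<eta> * (\<Sum>k\<in>I. \<bar>c k\<bar>) \<le> K * s + \<eta> / 2 * (\<Sum>k\<in>I. \<bar>c k\<bar>)"
      using \<eta>(2)[unfolded sup_ell1_lower_def] I by blast
    then show "\<eta> / 2 / K * (\<Sum>k\<in>I. \<bar>c k\<bar>) \<le> s"
      using \<open>K > 0\<close> by (simp add: field_simps)
  qed
  moreover have "\<eta> / 2 / K > 0" using \<eta>(1) \<open>K > 0\<close> by simp
  ultimately show ?thesis by blast
qed

end


section \<open>Continuous functions along a dense sequence\<close>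

text \<open>One vector is kept for each code that occurs at each precision. Thus a countable dense
  set is obtained inside the space without exhibiting its elements.\<close>

lemma (in real_normed_space) separable_of_codes:
  assumes code: "\<And>\<epsilon>::real. \<epsilon> > 0 \<Longrightarrow> \<exists>code :: 'v \<Rightarrow> 'c::countable.
    \<forall>v\<in>carrier V. \<forall>w\<in>carrier V. code v = code w \<longrightarrow> vnorm V (v \<ominus> w) < \<epsilon>"
  shows "separable_space (norm_topology V)"
proof -
  have "\<forall>n::nat. \<exists>code :: 'v \<Rightarrow> 'c. \<forall>v\<in>carrier V. \<forall>w\<in>carrier V. code v = code w \<longrightarrow> vnorm V (v \<ominus> w) < 1 / Suc n"
    by (intro allI code) simp
  from choice[OF this] obtain code :: "nat \<Rightarrow> 'v \<Rightarrow> 'c"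
    where c: "\<And>n v w. v \<in> carrier V \<Longrightarrow> w \<in> carrier V \<Longrightarrow> code n v = code n w \<Longrightarrow> vnorm V (v \<ominus> w) < 1 / Suc n"
    by blast
  define rep where "rep = (\<lambda>(n, c). SOME v. v \<in> carrier V \<and> code n v = c)"
  have rep: "rep (n, code n v) \<in> carrier V \<and> code n (rep (n, code n v)) = code n v" if "v \<in> carrier V" for n v
    unfolding rep_def prod.case by (rule someI[of _ v]) (use that in simp)
  define C where "C = (\<Union>n. (\<lambda>v. rep (n, code n v)) ` carrier V)"
  have "C \<subseteq> range rep" by (auto simp: C_def)
  then have "countable C" by (rule countable_subset) simp
  moreover have sub: "C \<subseteq> carrier V" using rep by (auto simp: C_def)
  moreover have "norm_topology V closure_of C = carrier V"
  proof
    show "norm_topology V closure_of C \<subseteq> carrier V"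
      using closure_of_subset_topspace[of "norm_topology V" C] by (simp add: topspace_norm_topology)
    show "carrier V \<subseteq> norm_topology V closure_of C"
    proof
      fix v assume v: "v \<in> carrier V"
      show "v \<in> norm_topology V closure_of C"
        unfolding in_closure_of
      proof (intro conjI allI impI)
        show "v \<in> topspace (norm_topology V)" using v by (simp add: topspace_norm_topology)
        fix U assume "v \<in> U \<and> openin (norm_topology V) U"
        then obtain r where r: "r > 0" "\<And>w. w \<in> carrier V \<Longrightarrow> vnorm V (v \<ominus> w) < r \<Longrightarrow> w \<in> U"
          unfolding openin_norm_topology by blast
        obtain n where n: "1 / Suc n < r" using r(1) by (metis nat_approx_posE)
        let ?w = "rep (n, code n v)"
        have "vnorm V (v \<ominus> ?w) < r" using c[OF v, of ?w n] rep[OF v, of n] n by simp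
        then have "?w \<in> U" using r(2) rep[OF v, of n] by blast
        moreover have "?w \<in> C" using v by (auto simp: C_def)
        ultimately show "\<exists>w. w \<in> C \<and> w \<in> U" by blast
      qed
    qed
  qed
  ultimately show ?thesis unfolding separable_space_def by (auto simp: topspace_norm_topology)
qed

lemma compact_dense_sequence:
  fixes X :: "'x::metric_space set"
  assumes X: "compact X" "X \<noteq> {}"
  shows "\<exists>d :: nat \<Rightarrow> 'x. range d \<subseteq> X \<and> X \<subseteq> closure (range d)"
proof -
  have "\<forall>n::nat. \<exists>k. k \<subseteq> X \<and> finite k \<and> X \<subseteq> (\<Union>x\<in>k. ball x (1 / Suc n))"
  proof
    fix n :: nat
    show "\<exists>k. k \<subseteq> X \<and> finite k \<and> X \<subseteq> (\<Union>x\<in>k. ball x (1 / Suc n))"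
      using X(1) by (rule compactE_image[of X X "\<lambda>x. ball x (1 / Suc n)"]) auto
  qed
  from choice[OF this] obtain k where k: "\<And>n. k n \<subseteq> X" "\<And>n. finite (k n)"
    "\<And>n::nat. X \<subseteq> (\<Union>x\<in>k n. ball x (1 / Suc n))" by blast
  define D where "D = (\<Union>n. k n)"
  have "D \<noteq> {}" using X(2) k(3)[of 0] by (fastforce simp: D_def)
  moreover have "countable D" using k(2) by (auto simp: D_def countable_finite)
  ultimately have "range (from_nat_into D) = D" by (simp add: range_from_nat_into)
  moreover have "D \<subseteq> X" using k(1) by (auto simp: D_def)
  moreover have "X \<subseteq> closure D"
  proof
    fix x assume x: "x \<in> X"
    show "x \<in> closure D"
      unfolding closure_approachable
    proof (intro allI impI)
      fix e :: real assume "e > 0"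
      then obtain n where n: "1 / Suc n < e" by (metis nat_approx_posE)
      obtain y where "y \<in> k n" "dist y x < 1 / Suc n" using k(3)[of n] x by auto
      then show "\<exists>y\<in>D. dist y x < e" using n by (intro bexI[of _ y]) (auto simp: D_def)
    qed
  qed
  ultimately show ?thesis by (intro exI[of _ "from_nat_into D"]) simp
qed

lemma abs_diff_less_of_floor_eq:
  fixes x y e :: real
  assumes "e > 0" "\<lfloor>x / e\<rfloor> = \<lfloor>y / e\<rfloor>" shows "\<bar>x - y\<bar> < e"
proof -
  have "\<bar>x / e - y / e\<bar> < 1" using assms(2) by linarith
  then show ?thesis using assms(1) by (simp add: pos_divide_less_eq flip: diff_divide_distrib)
qed

text \<open>
  Continuous functions on \<open>X\<close> are encoded by their values along a dense sequence \<open>d\<close>.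
\<close>

locale dense_sequence =
  fixes X :: "'x::metric_space set" and d :: "nat \<Rightarrow> 'x"
  assumes compact: "compact X" and d_in: "d i \<in> X" and dense: "X \<subseteq> closure (range d)"
begin

lemma all_in_closed:
  assumes v: "continuous_on X v" and S: "closed S" "\<And>i. v (d i) \<in> S" and x: "x \<in> X"
  shows "v x \<in> S"
proof -
  obtain t where t: "\<And>n. t n \<in> range d" "t \<longlonglongrightarrow> x" using dense x closure_sequential[of x "range d"] by auto
  have "t n \<in> X" for n using t(1)[of n] d_in by auto
  then have "(\<lambda>n. v (t n)) \<longlonglongrightarrow> v x"
    by (intro continuous_on_tendsto_compose[OF v t(2) x] always_eventually) simp
  moreover have "v (t n) \<in> S" for n using t(1)[of n] S(2) by auto
  ultimately show ?thesis using closed_sequentially[OF S(1), of "\<lambda>n. v (t n)" "v x"] by blast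
qed

lemma sup_bound:
  assumes "continuous_on X v" "\<And>i. \<bar>v (d i)\<bar> \<le> C" "x \<in> X"
  shows "\<bar>v x\<bar> \<le> (C::real)"
proof -
  have "v (d i) \<in> {-C..C}" for i using assms(2)[of i] by auto
  then have "v x \<in> {-C..C}" by (intro all_in_closed[OF assms(1) _ _ assms(3)]) simp_all
  then show ?thesis by auto
qed

definition cts :: "(nat \<Rightarrow> real) set"
  where "cts = {a. \<exists>v. continuous_on X v \<and> a = (\<lambda>i. v (d i))}"

text \<open>Determined on X by density (\<open>ext_unique\<close>), arbitrary outside.\<close>

definition ext :: "(nat \<Rightarrow> real) \<Rightarrow> 'x \<Rightarrow> real"
  where "ext a = (SOME v. continuous_on X v \<and> a = (\<lambda>i. v (d i)))"

lemma ctsI: "continuous_on X v \<Longrightarrow> (\<lambda>i. v (d i)) \<in> cts"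
  by (auto simp: cts_def)

lemma ext: assumes "a \<in> cts" shows "continuous_on X (ext a)" "ext a (d i) = a i"
proof -
  have "continuous_on X (ext a) \<and> a = (\<lambda>i. ext a (d i))"
    unfolding ext_def using assms someI_ex[of "\<lambda>v. continuous_on X v \<and> a = (\<lambda>i. v (d i))"]
    by (simp only: cts_def mem_Collect_eq)
  then show "continuous_on X (ext a)" "ext a (d i) = a i" by (blast, metis)
qed

lemma ext_unique:
  assumes "continuous_on X v" "\<And>i. a i = v (d i)" "x \<in> X" shows "ext a x = v x"
proof -
  have a: "a \<in> cts" using ctsI[OF assms(1)] assms(2) by presburger
  have "\<bar>ext a x - v x\<bar> \<le> 0"
    using sup_bound[of "\<lambda>x. ext a x - v x" 0 x] ext[OF a] assms by (simp add: continuous_on_diff)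
  then show ?thesis by simp
qed

lemma cts_plus: "a \<in> cts \<Longrightarrow> b \<in> cts \<Longrightarrow> (\<lambda>i. a i + b i) \<in> cts"
  using ctsI[OF continuous_on_add[OF ext(1) ext(1)], of a b] by (simp add: ext(2))

lemma cts_scale: "a \<in> cts \<Longrightarrow> (\<lambda>i. c * a i) \<in> cts"
  using ctsI[OF continuous_on_mult_left[OF ext(1)], of a c] by (simp add: ext(2))

lemma ext_plus: "a \<in> cts \<Longrightarrow> b \<in> cts \<Longrightarrow> x \<in> X \<Longrightarrow> ext (\<lambda>i. a i + b i) x = ext a x + ext b x"
  by (rule ext_unique[OF continuous_on_add[OF ext(1) ext(1)]]) (simp_all add: ext(2))

lemma ext_scale: "a \<in> cts \<Longrightarrow> x \<in> X \<Longrightarrow> ext (\<lambda>i. c * a i) x = c * ext a x"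
  by (rule ext_unique[OF continuous_on_mult_left[OF ext(1)]]) (simp_all add: ext(2))

lemma ext_diff_bound:
  assumes "a \<in> cts" "b \<in> cts" "\<And>i. \<bar>a i - b i\<bar> \<le> C" "x \<in> X"
  shows "\<bar>ext a x - ext b x\<bar> \<le> C"
  using sup_bound[of "\<lambda>x. ext a x - ext b x" C x] assms by (simp add: ext continuous_on_diff)

lemma cts_bounded:
  assumes "a \<in> cts" shows "bounded_fun a"
proof -
  have "compact (ext a ` X)" using compact ext(1)[OF assms] by (simp add: compact_continuous_image)
  then obtain C where "\<forall>y\<in>ext a ` X. norm y \<le> C" using compact_imp_bounded bounded_iff by blast
  then have "\<bar>a i\<bar> \<le> C" for i using d_in[of i] ext(2)[OF assms, of i] by force
  then show ?thesis by (auto simp: bounded_fun_def)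
qed

text \<open>A bound along \<open>d\<close> is a bound on X for continuous functions, so the
  extensions converge uniformly on X and their limit is continuous.\<close>

lemma cts_uniform_limit:
  assumes "\<And>e. e > 0 \<Longrightarrow> \<exists>w\<in>cts. \<forall>i. \<bar>a i - w i\<bar> \<le> e"
  shows "a \<in> cts"
proof -
  have "\<forall>n::nat. \<exists>w. w \<in> cts \<and> (\<forall>i. \<bar>a i - w i\<bar> \<le> (1/2) ^ n)"
    using assms by (metis zero_less_power half_gt_zero zero_less_one)
  from choice[OF this] obtain w where w: "\<And>n. w n \<in> cts" "\<And>n i. \<bar>a i - w n i\<bar> \<le> (1/2) ^ n" by blast
  have half: "(\<lambda>n. (1/2::real) ^ n) \<longlonglongrightarrow> 0" by (rule LIMSEQ_power_zero) simp
  have wdiff: "\<bar>ext (w n) x - ext (w m) x\<bar> \<le> (1/2) ^ n + (1/2) ^ m" if "x \<in> X" for n m x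
  proof (rule ext_diff_bound[OF w(1) w(1) _ that])
    fix i
    show "\<bar>w n i - w m i\<bar> \<le> (1/2) ^ n + (1/2) ^ m" using w(2)[of i n] w(2)[of i m] by linarith
  qed
  have "Cauchy (\<lambda>n. ext (w n) x)" if x: "x \<in> X" for x
  proof (rule CauchyI)
    fix e :: real assume "0 < e"
    then obtain N where N: "\<forall>n\<ge>N. norm ((1/2::real) ^ n - 0) < e / 2" using LIMSEQ_D[OF half, of "e / 2"] by auto
    have "norm (ext (w m) x - ext (w n) x) < e" if "m \<ge> N" "n \<ge> N" for m n
    proof -
      have "(1/2::real) ^ m < e / 2" "(1/2::real) ^ n < e / 2" using N that by auto
      then show ?thesis using wdiff[OF x, of m n] by simp
    qed
    then show "\<exists>M. \<forall>m\<ge>M. \<forall>n\<ge>M. norm (ext (w m) x - ext (w n) x) < e" by blast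
  qed
  then have conv: "convergent (\<lambda>n. ext (w n) x)" if "x \<in> X" for x using that Cauchy_convergent_iff by blast
  define v where "v x = lim (\<lambda>n. ext (w n) x)" for x
  have v: "(\<lambda>n. ext (w n) x) \<longlonglongrightarrow> v x" if "x \<in> X" for x
    using conv[OF that] by (simp add: v_def convergent_LIMSEQ_iff)
  have close: "\<bar>ext (w n) x - v x\<bar> \<le> (1/2) ^ n" if x: "x \<in> X" for n x
  proof (rule LIMSEQ_le)
    show "(\<lambda>m. \<bar>ext (w n) x - ext (w m) x\<bar>) \<longlonglongrightarrow> \<bar>ext (w n) x - v x\<bar>" by (intro tendsto_intros v x)
    show "(\<lambda>m. (1/2) ^ n + (1/2) ^ m) \<longlonglongrightarrow> (1/2::real) ^ n"
      using tendsto_add[OF tendsto_const half, of "(1/2) ^ n"] by simp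
    show "\<exists>N. \<forall>m\<ge>N. \<bar>ext (w n) x - ext (w m) x\<bar> \<le> (1/2) ^ n + (1/2) ^ m" using wdiff[OF x] by blast
  qed
  have "continuous_on X v"
  proof (rule uniform_limit_theorem[of _ "\<lambda>n. ext (w n)" sequentially])
    show "uniform_limit X (\<lambda>n. ext (w n)) v sequentially"
    proof (rule uniform_limitI)
      fix e :: real assume "0 < e"
      then obtain N where N: "\<forall>n\<ge>N. norm ((1/2::real) ^ n - 0) < e" using LIMSEQ_D[OF half, of e] by auto
      have "dist (ext (w n) x) (v x) < e" if "n \<ge> N" "x \<in> X" for n x
      proof -
        have "(1/2::real) ^ n < e" using N that(1) by auto
        then show ?thesis using close[OF that(2), of n] by (simp add: dist_real_def)
      qed
      then show "\<forall>\<^sub>F n in sequentially. \<forall>x\<in>X. dist (ext (w n) x) (v x) < e"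
        unfolding eventually_sequentially by blast
    qed
  qed (simp_all add: ext(1)[OF w(1)])
  moreover have "a i = v (d i)" for i
  proof (rule LIMSEQ_unique)
    show "(\<lambda>n. ext (w n) (d i)) \<longlonglongrightarrow> v (d i)" by (rule v[OF d_in])
    have "(\<lambda>n. w n i - a i) \<longlonglongrightarrow> 0"
      by (rule tendsto_0_le[OF half, of _ 1]) (use w(2) in \<open>auto intro!: always_eventually simp: abs_minus_commute\<close>)
    then have "(\<lambda>n. w n i) \<longlonglongrightarrow> a i" by (rule LIM_zero_cancel)
    then show "(\<lambda>n. ext (w n) (d i)) \<longlonglongrightarrow> a i" by (simp add: ext(2)[OF w(1)])
  qed
  ultimately show ?thesis using ctsI[of v] by presburger
qed

lemma finite_subcover_dense:
  assumes "e > 0" shows "\<exists>m. X \<subseteq> (\<Union>i<m::nat. ball (d i) e)"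
proof -
  have "X \<subseteq> (\<Union>i. ball (d i) e)"
  proof
    fix x assume "x \<in> X"
    then have "x \<in> closure (range d)" using dense by blast
    then obtain y where "y \<in> range d" "dist y x < e" using assms unfolding closure_approachable by blast
    then show "x \<in> (\<Union>i. ball (d i) e)" by auto
  qed
  then obtain I where I: "I \<subseteq> UNIV" "finite I" "X \<subseteq> (\<Union>i\<in>I. ball (d i) e)"
    using compact by (rule_tac compactE_image[of X UNIV "\<lambda>i. ball (d i) e"]) auto
  obtain m where "I \<subseteq> {..<m}" using I(2) by (meson finite_nat_iff_bounded)
  then have "(\<Union>i\<in>I. ball (d i) e) \<subseteq> (\<Union>i<m. ball (d i) e)" by (intro UN_mono subset_refl)
  then show ?thesis using I(3) by (intro exI[of _ m]) (rule order_trans)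
qed

text \<open>The code records a modulus of continuity for \<eta> / 3 and the values on a matching
  finite net, rounded to multiples of \<eta> / 3. Equal codes give a common net point near any given
  point, and three errors of \<eta> / 3 add up.\<close>

lemma sup_codes:
  assumes "\<eta> > 0"
  shows "\<exists>code :: (nat \<Rightarrow> real) \<Rightarrow> nat \<times> int list.
    \<forall>a\<in>cts. \<forall>b\<in>cts. code a = code b \<longrightarrow> (\<forall>i. \<bar>a i - b i\<bar> \<le> \<eta>)"
proof -
  define q where "q a k \<longleftrightarrow> (\<forall>x\<in>X. \<forall>y\<in>X. dist x y < 1 / Suc k \<longrightarrow> \<bar>ext a x - ext a y\<bar> < \<eta> / 3)" for a and k :: nat
  have ex: "\<exists>k. q a k" if a: "a \<in> cts" for a
  proof -
    have "uniformly_continuous_on X (ext a)" using ext(1)[OF a] compact by (rule compact_uniformly_continuous)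
    then obtain e where e: "e > 0" "\<And>x y. x \<in> X \<Longrightarrow> y \<in> X \<Longrightarrow> dist y x < e \<Longrightarrow> dist (ext a y) (ext a x) < \<eta> / 3"
      using assms unfolding uniformly_continuous_on_def by (metis divide_pos_pos zero_less_numeral)
    obtain k where "1 / Suc k < e" using e(1) by (metis nat_approx_posE)
    then have "q a k" unfolding q_def using e(2) by (auto simp: dist_real_def)
    then show ?thesis ..
  qed
  have "\<forall>k::nat. \<exists>m. X \<subseteq> (\<Union>i<m::nat. ball (d i) (1 / Suc k))"
    by (intro allI finite_subcover_dense) simp
  from choice[OF this] obtain m where m: "\<And>k. X \<subseteq> (\<Union>i<m k. ball (d i) (1 / Suc k))" by blast
  define K where "K a = (SOME k. q a k)" for a
  have K: "q a (K a)" if "a \<in> cts" for a unfolding K_def using ex[OF that] by (rule someI_ex)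
  define code where "code a = (K a, map (\<lambda>i. \<lfloor>a i / (\<eta> / 3)\<rfloor>) [0..<m (K a)])" for a
  have "\<bar>a j - b j\<bar> \<le> \<eta>" if ab: "a \<in> cts" "b \<in> cts" "code a = code b" for a b j
  proof -
    have Kab: "K b = K a" using ab(3) by (simp add: code_def)
    obtain i where i: "i < m (K a)" "dist (d i) (d j) < 1 / Suc (K a)" using m[of "K a"] d_in[of j] by auto
    have 1: "\<bar>a i - a j\<bar> < \<eta> / 3"
      using K[OF ab(1)] i(2) d_in ext(2)[OF ab(1)] unfolding q_def by metis
    have 2: "\<bar>b i - b j\<bar> < \<eta> / 3"
      using K[OF ab(2)] i(2) d_in ext(2)[OF ab(2)] unfolding q_def Kab by metis
    have "snd (code a) ! i = snd (code b) ! i" using ab(3) by simp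
    then have "\<lfloor>a i / (\<eta> / 3)\<rfloor> = \<lfloor>b i / (\<eta> / 3)\<rfloor>" using i(1) Kab by (simp add: code_def)
    then have "\<bar>a i - b i\<bar> < \<eta> / 3" using assms by (intro abs_diff_less_of_floor_eq) simp_all
    then show ?thesis using 1 2 by linarith
  qed
  then show ?thesis by blast
qed

end


section \<open>The representation of a tame system\<close>

locale metric_G_space = dense_sequence X d
  for X :: "'x::metric_space set" and d :: "nat \<Rightarrow> 'x" +
  fixes G :: "('g, 'm) monoid_scheme" and T :: "'g topology" and \<phi> :: "'g \<Rightarrow> 'x \<Rightarrow> 'x"
  assumes group: "topological_group G T" and G_space: "G_space G T X \<phi>"
begin

sublocale group: topological_group G T by (rule group)

sublocale action: group_action G X \<phi>
  using G_space by (simp add: G_space_def)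

lemma joint: "continuous_map (prod_topology T (top_of_set X)) (top_of_set X) (\<lambda>(g, x). \<phi> g x)"
  using G_space by (simp add: G_space_def)

lemma act_in: "g \<in> carrier G \<Longrightarrow> x \<in> X \<Longrightarrow> \<phi> g x \<in> X"
  using action.action_maps_to by blast

lemma act_mult: "g \<in> carrier G \<Longrightarrow> h \<in> carrier G \<Longrightarrow> x \<in> X \<Longrightarrow> \<phi> (g \<otimes>\<^bsub>G\<^esub> h) x = \<phi> g (\<phi> h x)"
  using action.composition_rule by blast

lemma act_one: "x \<in> X \<Longrightarrow> \<phi> \<one>\<^bsub>G\<^esub> x = x"
  using action.id_eq_one by (metis restrict_apply')

lemma act_cont:
  assumes g: "g \<in> carrier G" shows "continuous_on X (\<phi> g)"
proof -
  have "continuous_map (top_of_set X) (prod_topology T (top_of_set X)) (\<lambda>x. (g, x))"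
    using g by (simp add: continuous_map_pairwise o_def group.topspace_eq)
  from continuous_map_compose[OF this joint] show ?thesis by (simp add: o_def)
qed

definition gen :: "'g \<Rightarrow> 'x \<Rightarrow> nat \<Rightarrow> real"
  where "gen g y = (\<lambda>i. dist (\<phi> g (d i)) y)"

definition orbit_family :: "(nat \<Rightarrow> real) set"
  where "orbit_family = {gen g y | g y. g \<in> carrier G \<and> y \<in> X}"

sublocale bounded_family orbit_family "diameter X"
proof
  show "0 \<le> diameter X" using compact compact_imp_bounded by (intro diameter_ge_0)
  fix f i assume "f \<in> orbit_family"
  then show "\<bar>f i\<bar> \<le> diameter X"
    using diameter_bounded_bound[OF compact_imp_bounded[OF compact]] act_in d_in
    by (auto simp: orbit_family_def gen_def)
qed

lemma gen_cont: "g \<in> carrier G \<Longrightarrow> continuous_on X (\<lambda>x. dist (\<phi> g x) y)"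
  using act_cont by (intro continuous_intros)

lemma gen_cts: "g \<in> carrier G \<Longrightarrow> gen g y \<in> cts"
  unfolding gen_def by (rule ctsI[OF gen_cont])

lemma ext_gen: "g \<in> carrier G \<Longrightarrow> x \<in> X \<Longrightarrow> ext (gen g y) x = dist (\<phi> g x) y"
  by (rule ext_unique[OF gen_cont]) (simp_all add: gen_def)

lemma cts_zero: "(\<lambda>_. 0) \<in> cts"
  using ctsI[of "\<lambda>_. 0"] by simp

lemma ext_zero: "x \<in> X \<Longrightarrow> ext (\<lambda>_. 0) x = 0"
  by (rule ext_unique[of "\<lambda>_. 0"]) simp_all

lemma combination_cts:
  assumes "abs_combination orbit_family w r" shows "w \<in> cts"
  using assms
proof induction
  case zero
  show ?case by (rule cts_zero)
next
  case (add w r f c)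
  have "f \<in> cts" using add.hyps(2) gen_cts by (auto simp: orbit_family_def)
  then show ?case by (intro cts_plus cts_scale add.IH)
qed

text \<open>A small p n gives a combination of generators close in the supremum norm, so decay of p
  n makes every element a uniform limit of continuous functions.\<close>

lemma V_cts:
  assumes a: "a \<in> carrier V" shows "a \<in> cts"
proof (rule cts_uniform_limit)
  fix e :: real assume "e > 0"
  have "(\<lambda>n. p n a) \<longlonglongrightarrow> 0" and bdd: "bounded_fun a" using a by (simp_all add: carrier_V)
  then have "\<forall>\<^sub>F n in sequentially. p n a < e" using \<open>e > 0\<close> by (intro order_tendstoD)
  then obtain n where "p n a < e" unfolding eventually_sequentially by blast
  then obtain w r s where w: "abs_combination orbit_family w r" "\<And>i. \<bar>a i - w i\<bar> \<le> s" "r / 2 ^ n + 2 ^ n * s < e"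
    using p_less[OF bdd] by blast
  have "0 \<le> r" using w(1) by (rule abs_combination_nonneg)
  then have "0 \<le> r / 2 ^ n" by simp
  moreover have "0 \<le> s" using w(2)[of 0] by linarith
  then have "1 * s \<le> 2 ^ n * s" by (intro mult_right_mono) auto
  ultimately have "s \<le> e" using w(3) by linarith
  then have "\<forall>i. \<bar>a i - w i\<bar> \<le> e" using w(2) order_trans by blast
  then show "\<exists>w\<in>cts. \<forall>i. \<bar>a i - w i\<bar> \<le> e" using combination_cts[OF w(1)] by blast
qed

section \<open>The action on the interpolation space by composition with translations\<close>

definition R :: "'g \<Rightarrow> (nat \<Rightarrow> real) \<Rightarrow> nat \<Rightarrow> real"
  where "R g a = (\<lambda>i. ext a (\<phi> g (d i)))"

lemma R_cont:
  assumes "g \<in> carrier G" "a \<in> cts" shows "continuous_on X (\<lambda>x. ext a (\<phi> g x))"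
  by (rule continuous_on_compose2[OF ext(1)[OF assms(2)] act_cont[OF assms(1)]]) (use act_in[OF assms(1)] in auto)

lemma R_cts: "g \<in> carrier G \<Longrightarrow> a \<in> cts \<Longrightarrow> R g a \<in> cts"
  unfolding R_def by (rule ctsI[OF R_cont])

lemma ext_R: "g \<in> carrier G \<Longrightarrow> a \<in> cts \<Longrightarrow> x \<in> X \<Longrightarrow> ext (R g a) x = ext a (\<phi> g x)"
  by (rule ext_unique[OF R_cont]) (simp_all add: R_def)

lemma R_plus: "g \<in> carrier G \<Longrightarrow> a \<in> cts \<Longrightarrow> b \<in> cts \<Longrightarrow> R g (\<lambda>i. a i + b i) = (\<lambda>i. R g a i + R g b i)"
  by (simp add: R_def fun_eq_iff ext_plus act_in d_in)

lemma R_scale: "g \<in> carrier G \<Longrightarrow> a \<in> cts \<Longrightarrow> R g (\<lambda>i. c * a i) = (\<lambda>i. c * R g a i)"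
  by (simp add: R_def fun_eq_iff ext_scale act_in d_in)

lemma R_gen: "g \<in> carrier G \<Longrightarrow> h \<in> carrier G \<Longrightarrow> R g (gen h y) = gen (h \<otimes>\<^bsub>G\<^esub> g) y"
  by (simp add: R_def fun_eq_iff ext_gen act_in d_in) (simp add: gen_def act_mult d_in)

text \<open>Composition reverses the order of the group elements, as a co-homomorphism
  requires.\<close>

lemma R_R:
  "g \<in> carrier G \<Longrightarrow> h \<in> carrier G \<Longrightarrow> a \<in> cts \<Longrightarrow> R h (R g a) = R (g \<otimes>\<^bsub>G\<^esub> h) a"
  unfolding R_def[of h "R g a"] R_def[of "g \<otimes>\<^bsub>G\<^esub> h"]
  by (simp add: fun_eq_iff ext_R act_in d_in act_mult)

lemma R_one: "a \<in> cts \<Longrightarrow> R \<one>\<^bsub>G\<^esub> a = a"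
  by (simp add: R_def fun_eq_iff act_one d_in ext(2))

lemma R_combination:
  assumes "abs_combination orbit_family w r" "g \<in> carrier G"
  shows "abs_combination orbit_family (R g w) r"
  using assms(1)
proof induction
  case zero
  have "R g (\<lambda>_. 0) = (\<lambda>_. 0)" using assms(2) by (simp add: R_def fun_eq_iff ext_zero act_in d_in)
  then show ?case using abs_combination.zero by metis
next
  case (add w r f c)
  obtain h y where f: "f = gen h y" "h \<in> carrier G" "y \<in> X" using add.hyps(2) by (auto simp: orbit_family_def)
  have "R g f = gen (h \<otimes>\<^bsub>G\<^esub> g) y" using f assms(2) by (simp add: R_gen)
  then have "R g f \<in> orbit_family" using f assms(2) by (auto simp: orbit_family_def)
  moreover have "R g (\<lambda>i. w i + c * f i) = (\<lambda>i. R g w i + c * R g f i)"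
    using R_plus[OF assms(2) combination_cts[OF add.hyps(1)] cts_scale[OF gen_cts[OF f(2), of y], of c]]
      R_scale[OF assms(2) gen_cts[OF f(2), of y], of c] f(1) by simp
  ultimately show ?case using abs_combination.add[OF add.IH, of "R g f" c] by simp
qed

text \<open>Composition with a translation permutes the generators, so it preserves the weight of a
  combination, and it does not increase supremum distances. Equality then comes from the inverse
  group element.\<close>

lemma p_R_le:
  assumes g: "g \<in> carrier G" and a: "a \<in> cts" shows "p n (R g a) \<le> p n a"
proof (rule dense_ge)
  fix t assume "p n a < t"
  then obtain w r s where w: "abs_combination orbit_family w r" "\<And>i. \<bar>a i - w i\<bar> \<le> s" "r / 2 ^ n + 2 ^ n * s < t"
    using p_less[OF cts_bounded[OF a]] by blast
  have "p n (R g a) \<le> r / 2 ^ n + 2 ^ n * s"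
  proof (rule p_le[OF R_combination[OF w(1) g]])
    show "\<bar>R g a i - R g w i\<bar> \<le> s" for i
      unfolding R_def by (rule ext_diff_bound[OF a combination_cts[OF w(1)] w(2) act_in[OF g d_in]])
  qed
  then show "p n (R g a) \<le> t" using w(3) by linarith
qed

lemma p_R:
  assumes g: "g \<in> carrier G" and a: "a \<in> cts" shows "p n (R g a) = p n a"
proof (rule antisym)
  have "p n (R (inv\<^bsub>G\<^esub> g) (R g a)) \<le> p n (R g a)" using g a by (intro p_R_le R_cts) auto
  moreover have "R (inv\<^bsub>G\<^esub> g) (R g a) = a" using g a by (simp add: R_R R_one)
  ultimately show "p n a \<le> p n (R g a)" by simp
qed (rule p_R_le[OF assms])

lemma R_V: "g \<in> carrier G \<Longrightarrow> a \<in> carrier V \<Longrightarrow> R g a \<in> carrier V"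
  using V_cts[of a] by (simp add: carrier_V p_R cts_bounded R_cts)

lemma vnorm_R: "g \<in> carrier G \<Longrightarrow> a \<in> carrier V \<Longrightarrow> vnorm V (R g a) = vnorm V a"
  using V_cts[of a] by (simp add: vnorm_V p_R)

definition isom :: "'g \<Rightarrow> (nat \<Rightarrow> real) \<Rightarrow> (nat \<Rightarrow> real)"
  where "isom g = restrict (R g) (carrier V)"

definition evaluation :: "'x \<Rightarrow> (nat \<Rightarrow> real) \<Rightarrow> real"
  where "evaluation x = restrict (\<lambda>a. ext a x) (carrier V)"

lemma isom_linear_isometry:
  assumes g: "g \<in> carrier G" shows "isom g \<in> linear_isometries V"
proof -
  have lin: "linear_operator V V (isom g)"
    unfolding linear_operator_def isom_def
    using g R_V V_cts plus_closed scale_closed by (auto simp: add_V smult_V R_plus R_scale)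
  have "a \<in> isom g ` carrier V" if a: "a \<in> carrier V" for a
  proof (rule image_eqI)
    show "R (inv\<^bsub>G\<^esub> g) a \<in> carrier V" using g a by (simp add: R_V)
    then show "a = isom g (R (inv\<^bsub>G\<^esub> g) a)" using g V_cts[OF a] by (simp add: isom_def R_R R_one)
  qed
  moreover have "isom g ` carrier V \<subseteq> carrier V" using g by (auto simp: isom_def R_V)
  ultimately show ?thesis
    unfolding linear_isometries_def using lin g by (auto simp: isom_def vnorm_R)
qed

lemma isom_comult:
  assumes "g \<in> carrier G" "h \<in> carrier G"
  shows "isom (g \<otimes>\<^bsub>G\<^esub> h) = compose (carrier V) (isom h) (isom g)"
  using assms by (auto simp: isom_def compose_def fun_eq_iff R_V R_R V_cts)

text \<open>For n from N on, invariance of p n makes both translates of a small, whatever the group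
  element. For n < N closeness in the supremum norm suffices, and the tube lemma provides it near g0
  because X is compact. The constant \<eta> satisfies
  \<open>2 ^ N * \<eta> = \<epsilon> / 2\<close>.\<close>

lemma isom_orbit_continuous:
  assumes a: "a \<in> carrier V" shows "continuous_map T (norm_topology V) (\<lambda>g. R g a)"
  unfolding V.continuous_map_to_norm_topology
proof (intro conjI ballI allI impI)
  show "(\<lambda>g. R g a) \<in> topspace T \<rightarrow> carrier V" using a by (auto simp: group.topspace_eq R_V)
  fix g0 and \<epsilon> :: real assume "g0 \<in> topspace T" and "\<epsilon> > 0"
  then have g0: "g0 \<in> carrier G" by (simp add: group.topspace_eq)
  have ac: "a \<in> cts" by (rule V_cts[OF a])
  have "(\<lambda>n. p n a) \<longlonglongrightarrow> 0" using a by (simp add: carrier_V)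
  then have "\<forall>\<^sub>F n in sequentially. p n a < \<epsilon> / 4" using \<open>\<epsilon> > 0\<close> by (intro order_tendstoD) auto
  then obtain N where N: "\<And>n. n \<ge> N \<Longrightarrow> p n a < \<epsilon> / 4" unfolding eventually_sequentially by blast
  define \<eta> where "\<eta> = \<epsilon> / (2 * 2 ^ N)"
  have "\<eta> > 0" using \<open>\<epsilon> > 0\<close> by (simp add: \<eta>_def)
  let ?P = "prod_topology T (top_of_set X)"
  define W where "W = {z \<in> topspace ?P. ext a (\<phi> (fst z) (snd z)) - ext a (\<phi> g0 (snd z)) \<in> {-\<eta><..<\<eta>}}"
  have ea: "continuous_map (top_of_set X) euclideanreal (ext a)" using ext(1)[OF ac] by simp
  have "continuous_map ?P euclideanreal (\<lambda>z. ext a (\<phi> (fst z) (snd z)))"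
    using continuous_map_compose[OF joint ea] by (simp add: o_def case_prod_beta)
  moreover have "continuous_map ?P euclideanreal (\<lambda>z. ext a (\<phi> g0 (snd z)))"
  proof -
    have "continuous_map (top_of_set X) euclideanreal (\<lambda>x. ext a (\<phi> g0 x))" using R_cont[OF g0 ac] by simp
    from continuous_map_compose[OF continuous_map_snd this, of T] show ?thesis by (simp add: o_def)
  qed
  ultimately have "continuous_map ?P euclideanreal (\<lambda>z. ext a (\<phi> (fst z) (snd z)) - ext a (\<phi> g0 (snd z)))"
    by (rule continuous_map_diff)
  then have "openin ?P W"
    unfolding W_def by (rule openin_continuous_map_preimage) simp
  moreover have "compactin (top_of_set X) X" using compact by (simp add: compactin_subtopology)
  moreover have "{g0} \<times> X \<subseteq> W" using g0 \<open>\<eta> > 0\<close> by (auto simp: W_def group.topspace_eq)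
  ultimately obtain U Y where U: "openin T U" "g0 \<in> U" "X \<subseteq> Y" "U \<times> Y \<subseteq> W"
    using tube_lemma_right[of T "top_of_set X" W X g0] g0 by (auto simp: group.topspace_eq)
  have "vnorm V (R g0 a \<ominus>\<^bsub>V\<^esub> R g a) < \<epsilon>" if g: "g \<in> U" for g
  proof -
    have gG: "g \<in> carrier G" using g openin_subset[OF U(1)] by (auto simp: group.topspace_eq)
    have "p n (\<lambda>i. R g0 a i - R g a i) \<le> \<epsilon> / 2" for n
    proof (cases "n \<ge> N")
      case True
      have "p n (\<lambda>i. R g0 a i + (-1) * R g a i) \<le> p n (R g0 a) + p n (\<lambda>i. (-1) * R g a i)"
        using g0 gG ac by (intro p_triangle bounded_fun_scale cts_bounded R_cts)
      also have "\<dots> = p n a + p n a"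
        using p_R[OF g0 ac] p_R[OF gG ac] p_scale[OF cts_bounded[OF R_cts[OF gG ac]], of n "-1"] by simp
      finally show ?thesis using N[OF True] by simp
    next
      case False
      have "p n (\<lambda>i. R g0 a i - R g a i) \<le> 2 ^ n * \<eta>"
      proof (rule p_le_sup)
        fix i
        have "(g, d i) \<in> W" using U(3,4) g d_in[of i] by blast
        then show "\<bar>R g0 a i - R g a i\<bar> \<le> \<eta>" by (auto simp: W_def R_def abs_le_iff)
      qed
      also have "\<dots> \<le> 2 ^ N * \<eta>" using False \<open>\<eta> > 0\<close> by (intro mult_right_mono power_increasing) auto
      also have "\<dots> = \<epsilon> / 2" by (simp add: \<eta>_def)
      finally show ?thesis .
    qed
    then have "vnorm V (R g0 a \<ominus>\<^bsub>V\<^esub> R g a) \<le> \<epsilon> / 2"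
      unfolding minus_V[OF R_V[OF g0 a] R_V[OF gG a]] by (rule vnorm_le)
    then show ?thesis using \<open>\<epsilon> > 0\<close> by simp
  qed
  then show "\<exists>U. openin T U \<and> g0 \<in> U \<and> (\<forall>g\<in>U. vnorm V (R g0 a \<ominus>\<^bsub>V\<^esub> R g a) < \<epsilon>)" using U(1,2) by blast
qed

lemma isom_continuous: "continuous_map T (isometry_topology V) isom"
  unfolding isometry_topology_def continuous_map_in_subtopology
proof
  show "isom \<in> topspace T \<rightarrow> linear_isometries V"
    using isom_linear_isometry by (simp add: group.topspace_eq)
  show "continuous_map T (product_topology (\<lambda>_. norm_topology V) (carrier V)) isom"
    unfolding continuous_map_componentwise
  proof (intro conjI ballI)
    show "isom ` topspace T \<subseteq> extensional (carrier V)" by (auto simp: isom_def)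
    fix a assume a: "a \<in> carrier V"
    show "continuous_map T (norm_topology V) (\<lambda>g. isom g a)"
      using isom_orbit_continuous[OF a] a by (simp add: isom_def)
  qed
qed

section \<open>Point evaluations as functionals\<close>

lemma evaluation_dual:
  assumes x: "x \<in> X" shows "evaluation x \<in> dual_space V"
  unfolding dual_space_def
proof (intro CollectI conjI ballI allI)
  show "evaluation x \<in> extensional (carrier V)" by (simp add: evaluation_def)
  have minus: "ext (\<lambda>i. a i - b i) x = ext a x - ext b x" if "a \<in> cts" "b \<in> cts" for a b
    using ext_plus[OF that(1) cts_scale[OF that(2), of "-1"] x] ext_scale[OF that(2) x, of "-1"] by simp
  show "continuous_map (norm_topology V) euclideanreal (evaluation x)"
  proof -
    have bound: "\<bar>ext a x\<bar> \<le> (diameter X + 1) * vnorm V a" if "a \<in> carrier V" for a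
      by (rule sup_bound[OF ext(1)[OF V_cts[OF that]] _ x]) (simp add: ext(2)[OF V_cts[OF that]] sup_le_vnorm[OF that])
    have pos: "diameter X + 1 > 0" using D_nonneg by simp
    have "\<exists>U. openin (norm_topology V) U \<and> a \<in> U \<and> (\<forall>b\<in>U. dist (evaluation x a) (evaluation x b) < \<epsilon>)"
      if a: "a \<in> carrier V" and "\<epsilon> > 0" for a \<epsilon>
    proof -
      let ?U = "{b \<in> carrier V. vnorm V (a \<ominus>\<^bsub>V\<^esub> b) < \<epsilon> / (diameter X + 1)}"
      have "dist (evaluation x a) (evaluation x b) < \<epsilon>" if b: "b \<in> ?U" for b
      proof -
        have bV: "b \<in> carrier V" using b by simp
        have "\<bar>ext a x - ext b x\<bar> \<le> (diameter X + 1) * vnorm V (a \<ominus>\<^bsub>V\<^esub> b)"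
          using bound[OF V.M.minus_closed[OF a bV]] minus[OF V_cts[OF a] V_cts[OF bV]] by (simp add: minus_V[OF a bV])
        also have "\<dots> < (diameter X + 1) * (\<epsilon> / (diameter X + 1))" using b pos by (intro mult_strict_left_mono) auto
        finally show ?thesis using pos a bV by (simp add: evaluation_def dist_real_def)
      qed
      moreover have "a \<in> ?U" using a pos \<open>\<epsilon> > 0\<close> by (simp add: V.minus_self V.vnorm_zero)
      ultimately show ?thesis using V.openin_norm_ball[OF a] by blast
    qed
    then have "continuous_map (norm_topology V) Met_TC.mtopology (evaluation x)"
      unfolding Met_TC.continuous_map_to_metric by (simp add: V.topspace_norm_topology)
    then show ?thesis by simp
  qed
qed (use x in \<open>auto simp: evaluation_def V.M.a_closed[unfolded add_V] plus_closed scale_closed add_V smult_V ext_plus ext_scale V_cts\<close>)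

lemma evaluation_continuous: "continuous_map (top_of_set X) (weak_star_topology V) evaluation"
  unfolding weak_star_topology_def continuous_map_in_subtopology
proof
  show "evaluation \<in> topspace (top_of_set X) \<rightarrow> dual_space V" using evaluation_dual by simp
  show "continuous_map (top_of_set X) (product_topology (\<lambda>_. euclideanreal) (carrier V)) evaluation"
    unfolding continuous_map_componentwise
  proof (intro conjI ballI)
    show "evaluation ` topspace (top_of_set X) \<subseteq> extensional (carrier V)" by (auto simp: evaluation_def)
    fix a assume a: "a \<in> carrier V"
    have "continuous_on X (ext a)" by (rule ext(1)[OF V_cts[OF a]])
    then show "continuous_map (top_of_set X) euclideanreal (\<lambda>x. evaluation x a)" using a by (simp add: evaluation_def)
  qed
qed

text \<open>A continuous injection of a compact space into a Hausdorff space is an embedding. Points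
  are separated by the generator measuring the distance to y, which vanishes at y only.\<close>

lemma evaluation_embedding: "embedding_map (top_of_set X) (weak_star_topology V) evaluation"
proof (rule continuous_imp_embedding_map[OF evaluation_continuous])
  show "compact_space (top_of_set X)" using compact by (simp add: compact_space_subtopology)
  show "Hausdorff_space (weak_star_topology V)"
    unfolding weak_star_topology_def by (intro Hausdorff_space_subtopology) (simp add: Hausdorff_space_product_topology)
  show "inj_on evaluation (topspace (top_of_set X))"
  proof (rule inj_onI)
    fix x y assume xy: "x \<in> topspace (top_of_set X)" "y \<in> topspace (top_of_set X)" "evaluation x = evaluation y"
    then have x: "x \<in> X" and y: "y \<in> X" by simp_all
    let ?f = "gen \<one>\<^bsub>G\<^esub> y"
    have "?f \<in> carrier V" using y by (intro generator_in_V) (auto simp: orbit_family_def)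
    then have "ext ?f x = ext ?f y" using fun_cong[OF xy(3), of ?f] by (simp add: evaluation_def)
    then show "x = y" using x y by (simp add: ext_gen act_one)
  qed
qed

lemma evaluation_bounded: "norm_bounded_functionals V (evaluation ` X)"
  unfolding norm_bounded_functionals_def
proof (intro exI[of _ "diameter X + 1"] ballI)
  fix f a assume "f \<in> evaluation ` X" and a: "a \<in> carrier V"
  then obtain x where x: "x \<in> X" "f = evaluation x" by blast
  show "\<bar>f a\<bar> \<le> (diameter X + 1) * vnorm V a"
    using sup_bound[OF ext(1)[OF V_cts[OF a]] _ x(1)] sup_le_vnorm[OF a] a
    by (simp add: x(2) evaluation_def ext(2)[OF V_cts[OF a]])
qed

lemma representable: "faithfully_representable_on G T X \<phi> V"
  unfolding faithfully_representable_on_def continuous_representation_def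
proof (intro exI[of _ isom] exI[of _ evaluation] conjI ballI)
  show "evaluation (\<phi> g x) a = evaluation x (isom g a)" if "g \<in> carrier G" "x \<in> X" "a \<in> carrier V" for g x a
    using that by (simp add: evaluation_def isom_def R_V ext_R V_cts)
qed (use isom_continuous isom_comult evaluation_continuous evaluation_bounded evaluation_embedding in auto)

text \<open>The code of a consists of an index from which p n a is small and a code for the supremum
  norm whose precision is adapted to that index. Equal codes share the index, so both ranges of n
  are controlled.\<close>

lemma separable_V: "separable_space (norm_topology V)"
proof (rule V.separable_of_codes)
  fix \<epsilon> :: real assume "\<epsilon> > 0"
  define tail where "tail a N \<longleftrightarrow> (\<forall>n\<ge>N. p n a < \<epsilon> / 4)" for a N
  have ex: "\<exists>N. tail a N" if a: "a \<in> carrier V" for a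
  proof -
    have "(\<lambda>n. p n a) \<longlonglongrightarrow> 0" using a by (simp add: carrier_V)
    then have "\<forall>\<^sub>F n in sequentially. p n a < \<epsilon> / 4" using \<open>\<epsilon> > 0\<close> by (intro order_tendstoD) auto
    then show ?thesis by (simp add: eventually_sequentially tail_def)
  qed
  have N: "tail a (SOME N. tail a N)" if "a \<in> carrier V" for a
    using ex[OF that] by (rule someI_ex[of "tail a"])
  define \<eta> where "\<eta> N = \<epsilon> / (2 * 2 ^ N)" for N :: nat
  have "\<eta> N > 0" for N using \<open>\<epsilon> > 0\<close> by (simp add: \<eta>_def)
  then have "\<forall>N. \<exists>code :: (nat \<Rightarrow> real) \<Rightarrow> nat \<times> int list.
      \<forall>a\<in>cts. \<forall>b\<in>cts. code a = code b \<longrightarrow> (\<forall>i. \<bar>a i - b i\<bar> \<le> \<eta> N)"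
    using sup_codes by blast
  from choice[OF this] obtain code :: "nat \<Rightarrow> (nat \<Rightarrow> real) \<Rightarrow> nat \<times> int list"
    where code: "\<And>N a b i. a \<in> cts \<Longrightarrow> b \<in> cts \<Longrightarrow> code N a = code N b \<Longrightarrow> \<bar>a i - b i\<bar> \<le> \<eta> N" by blast
  define full where "full a = ((SOME N. tail a N), code (SOME N. tail a N) a)" for a
  have "vnorm V (a \<ominus>\<^bsub>V\<^esub> b) < \<epsilon>" if a: "a \<in> carrier V" and b: "b \<in> carrier V" and eq: "full a = full b" for a b
  proof -
    define M where "M = (SOME N. tail a N)"
    have tails: "tail a M" "tail b M" using N[OF a] N[OF b] eq by (simp_all add: full_def M_def)
    have "(SOME N. tail b N) = M" using eq by (simp add: full_def M_def)
    then have codes: "code M a = code M b" using eq by (simp add: full_def flip: M_def)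
    have "p n (\<lambda>i. a i - b i) \<le> \<epsilon> / 2" for n
    proof (cases "n \<ge> M")
      case True
      have "p n (\<lambda>i. a i + (-1) * b i) \<le> p n a + p n (\<lambda>i. (-1) * b i)"
        by (intro p_triangle bounded_fun_scale V_bounded a b)
      also have "\<dots> = p n a + p n b" using p_scale[OF V_bounded[OF b], of n "-1"] by simp
      finally show ?thesis using tails[unfolded tail_def, rule_format, OF True] by simp
    next
      case False
      have "p n (\<lambda>i. a i - b i) \<le> 2 ^ n * \<eta> M"
        by (rule p_le_sup) (rule code[OF V_cts[OF a] V_cts[OF b] codes])
      also have "\<dots> \<le> 2 ^ M * \<eta> M"
        using False \<open>\<epsilon> > 0\<close> by (intro mult_right_mono power_increasing) (auto simp: \<eta>_def)
      also have "\<dots> = \<epsilon> / 2" by (simp add: \<eta>_def)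
      finally show ?thesis .
    qed
    then have "vnorm V (a \<ominus>\<^bsub>V\<^esub> b) \<le> \<epsilon> / 2" unfolding minus_V[OF a b] by (rule vnorm_le)
    then show ?thesis using \<open>\<epsilon> > 0\<close> by simp
  qed
  then show "\<exists>code :: (nat \<Rightarrow> real) \<Rightarrow> nat \<times> nat \<times> int list.
      \<forall>v\<in>carrier V. \<forall>w\<in>carrier V. code v = code w \<longrightarrow> vnorm V (v \<ominus>\<^bsub>V\<^esub> w) < \<epsilon>"
    by (intro exI[of _ full]) blast
qed

text \<open>The combinations extracted from a copy of l1 are sequences. They are lifted to
  combinations of functions on X, since the argument against l1 uses compactness; as d runs inside
  X, the lower estimate along d implies the one on X.\<close>

lemma rosenthal_V:
  assumes tame: "tame_system G X \<phi>" shows "rosenthal_space V"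
  unfolding rosenthal_space_def
proof (intro conjI notI)
  show "banach_space V" by (rule banach_space_V)
  assume "contains_isomorphic_copy V l1_space"
  then obtain w \<delta> where \<delta>: "\<delta> > 0" and w: "\<And>k::nat. \<exists>r\<le>1. abs_combination orbit_family (w k) r"
    and low: "sup_ell1_lower UNIV w \<delta>" using contains_ell1_imp_combinations by blast
  define F' where "F' = {\<lambda>x. dist (\<phi> g x) y | g y. g \<in> carrier G \<and> y \<in> X}"
  have lift: "\<exists>v. abs_combination F' v r \<and> w = (\<lambda>i. v (d i))" if "abs_combination orbit_family w r" for w r
    using that
  proof induction
    case zero
    show ?case by (intro exI[of _ "\<lambda>_. 0"]) (simp add: abs_combination.zero)
  next
    case (add w r f c)
    then obtain v where v: "abs_combination F' v r" "w = (\<lambda>i. v (d i))" by blast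
    obtain g y where f: "f = gen g y" "g \<in> carrier G" "y \<in> X" using add.hyps(2) by (auto simp: orbit_family_def)
    have "(\<lambda>x. dist (\<phi> g x) y) \<in> F'" using f by (auto simp: F'_def)
    from abs_combination.add[OF v(1) this, of c] show ?case
      by (rule_tac exI, rule_tac conjI, assumption) (simp add: v(2) f(1) gen_def)
  qed
  have "\<exists>v. (\<exists>r\<le>1. abs_combination F' v r) \<and> w k = (\<lambda>i. v (d i))" for k using w[of k] lift by blast
  then obtain v where v: "\<And>k. \<exists>r\<le>1. abs_combination F' (v k) r" "\<And>k. w k = (\<lambda>i. v k (d i))" by metis
  have "sup_ell1_lower X v \<delta>"
    unfolding sup_ell1_lower_def
  proof (intro allI impI)
    fix I c s assume I: "finite I" and s: "\<forall>x\<in>X. \<bar>\<Sum>k\<in>I. c k * v k x\<bar> \<le> s"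
    have "\<forall>i\<in>UNIV. \<bar>\<Sum>k\<in>I. c k * w k i\<bar> \<le> s" using s d_in by (simp add: v(2))
    then show "\<delta> * (\<Sum>k\<in>I. \<bar>c k\<bar>) \<le> s" using low I unfolding sup_ell1_lower_def by blast
  qed
  moreover have "\<not> sup_ell1_lower X v \<delta>"
  proof (rule abs_combination_not_ell1[where F = F' and D = "diameter X", OF compact _ _ _ _ v(1) \<delta>])
    show "X \<noteq> {}" using d_in by blast
    show "continuous_on X f" if "f \<in> F'" for f using that gen_cont by (auto simp: F'_def)
    show "\<bar>f x\<bar> \<le> diameter X" if "f \<in> F'" "x \<in> X" for f x
      using that diameter_bounded_bound[OF compact_imp_bounded[OF compact]] act_in by (auto simp: F'_def)
    fix f :: "nat \<Rightarrow> 'x \<Rightarrow> real" assume "\<And>n. f n \<in> F'"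
    then have "\<forall>n. \<exists>g y. g \<in> carrier G \<and> y \<in> X \<and> f n = (\<lambda>x. dist (\<phi> g x) y)" by (force simp: F'_def)
    then obtain g y where gy: "\<And>n. g n \<in> carrier G" "\<And>n. y n \<in> X" "\<And>n. f n = (\<lambda>x. dist (\<phi> (g n) x) (y n))"
      by metis
    show "\<exists>r. strict_mono (r :: nat \<Rightarrow> nat) \<and> (\<forall>x\<in>X. convergent (\<lambda>n. f (r n) x))"
      using tame_imp_pointwise_convergent_subseq[OF compact action.group_action_axioms act_cont tame gy(1,2)]
      by (simp add: gy(3))
  qed
  ultimately show False by blast
qed

lemma separable_rosenthal_representation:
  "tame_system G X \<phi> \<Longrightarrow> separable_rosenthal_representation_space G T X \<phi> V"
  unfolding separable_rosenthal_representation_space_def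
  using rosenthal_V separable_V representable by blast

end


section \<open>Independent sequences of functionals\<close>

context real_normed_space
begin

definition tends :: "(nat \<Rightarrow> 'v) \<Rightarrow> 'v \<Rightarrow> bool"
  where "tends \<sigma> v \<longleftrightarrow> (\<forall>n. \<sigma> n \<in> carrier V) \<and> v \<in> carrier V \<and> (\<lambda>n. vnorm V (\<sigma> n \<ominus> v)) \<longlonglongrightarrow> 0"

lemma minus_add_minus:
  assumes "a \<in> carrier V" "b \<in> carrier V" "c \<in> carrier V" "e \<in> carrier V"
  shows "(a \<oplus> b) \<ominus> (c \<oplus> e) = (a \<ominus> c) \<oplus> (b \<ominus> e)"
  using assms by (simp add: a_minus_def M.minus_add M.a_ac)

lemma tends_unique:
  assumes "tends \<sigma> v" "tends \<sigma> w" shows "v = w"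
proof -
  have vw: "v \<in> carrier V" "w \<in> carrier V" and \<sigma>: "\<And>n. \<sigma> n \<in> carrier V" using assms by (auto simp: tends_def)
  have "(\<lambda>n. vnorm V (\<sigma> n \<ominus> v) + vnorm V (\<sigma> n \<ominus> w)) \<longlonglongrightarrow> 0 + 0"
    using assms by (intro tendsto_add) (auto simp: tends_def)
  moreover have "vnorm V (v \<ominus> w) \<le> vnorm V (\<sigma> n \<ominus> v) + vnorm V (\<sigma> n \<ominus> w)" for n
    using vnorm_triangle_minus[OF vw(1) \<sigma>[of n] vw(2)] vnorm_minus_commute[OF vw(1) \<sigma>[of n]] by simp
  ultimately have "vnorm V (v \<ominus> w) \<le> 0" by (intro LIMSEQ_le_const[of _ "0::real"]) auto
  then show ?thesis
    using vnorm_nonneg[of "v \<ominus> w"] vnorm_eq_zero[of "v \<ominus> w"] eq_if_minus_zero[OF vw] vw by simp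
qed

lemma tends_add:
  assumes "tends \<sigma> v" "tends \<tau> w" shows "tends (\<lambda>n. \<sigma> n \<oplus> \<tau> n) (v \<oplus> w)"
proof -
  have c: "v \<in> carrier V" "w \<in> carrier V" "\<And>n. \<sigma> n \<in> carrier V" "\<And>n. \<tau> n \<in> carrier V"
    and lim: "(\<lambda>n. vnorm V (\<sigma> n \<ominus> v)) \<longlonglongrightarrow> 0" "(\<lambda>n. vnorm V (\<tau> n \<ominus> w)) \<longlonglongrightarrow> 0"
    using assms by (auto simp: tends_def)
  have "(\<lambda>n. vnorm V ((\<sigma> n \<oplus> \<tau> n) \<ominus> (v \<oplus> w))) \<longlonglongrightarrow> 0"
  proof (rule tendsto_sandwich[OF _ _ tendsto_const])
    show "(\<lambda>n. vnorm V (\<sigma> n \<ominus> v) + vnorm V (\<tau> n \<ominus> w)) \<longlonglongrightarrow> 0" using tendsto_add[OF lim] by simp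
    show "\<forall>\<^sub>F n in sequentially. 0 \<le> vnorm V ((\<sigma> n \<oplus> \<tau> n) \<ominus> (v \<oplus> w))"
      using c by (intro always_eventually allI vnorm_nonneg) simp
    show "\<forall>\<^sub>F n in sequentially. vnorm V ((\<sigma> n \<oplus> \<tau> n) \<ominus> (v \<oplus> w)) \<le> vnorm V (\<sigma> n \<ominus> v) + vnorm V (\<tau> n \<ominus> w)"
      using c by (intro always_eventually allI) (simp add: minus_add_minus vnorm_triangle)
  qed
  then show ?thesis using c by (simp add: tends_def)
qed

lemma smult_minus:
  assumes "a \<in> carrier V" "b \<in> carrier V" shows "(t::real) \<odot> a \<ominus> t \<odot> b = t \<odot> (a \<ominus> b)"
  using assms by (simp add: minus_eq smult_add_right smult_smult real_smult_closed mult.commute)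

lemma tends_smult:
  assumes "tends \<sigma> v" shows "tends (\<lambda>n. (t::real) \<odot> \<sigma> n) (t \<odot> v)"
proof -
  have c: "v \<in> carrier V" "\<And>n. \<sigma> n \<in> carrier V" and lim: "(\<lambda>n. vnorm V (\<sigma> n \<ominus> v)) \<longlonglongrightarrow> 0"
    using assms by (auto simp: tends_def)
  have "(\<lambda>n. \<bar>t\<bar> * vnorm V (\<sigma> n \<ominus> v)) \<longlonglongrightarrow> 0" using tendsto_mult_right_zero[OF lim] by simp
  then show ?thesis using c by (simp add: tends_def smult_minus vnorm_smult real_smult_closed)
qed

lemma tends_vnorm:
  assumes "tends \<sigma> v" shows "(\<lambda>n. vnorm V (\<sigma> n)) \<longlonglongrightarrow> vnorm V v"
proof -
  have c: "v \<in> carrier V" "\<And>n. \<sigma> n \<in> carrier V" and lim: "(\<lambda>n. vnorm V (\<sigma> n \<ominus> v)) \<longlonglongrightarrow> 0"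
    using assms by (auto simp: tends_def)
  have "\<bar>vnorm V (\<sigma> n) - vnorm V v\<bar> \<le> vnorm V (\<sigma> n \<ominus> v)" for n
    using vnorm_triangle_minus[of "\<sigma> n" v "\<zero>"] vnorm_triangle_minus[of v "\<sigma> n" "\<zero>"] c
      vnorm_minus_commute[of v "\<sigma> n"] by (simp add: minus_zero)
  then have "(\<lambda>n. vnorm V (\<sigma> n) - vnorm V v) \<longlonglongrightarrow> 0"
    by (intro tendsto_0_le[OF lim, of _ 1] always_eventually allI) (simp add: order_trans[OF _ abs_ge_self])
  then show ?thesis by (rule LIM_zero_cancel)
qed

primrec partial_sum :: "(nat \<Rightarrow> 'v) \<Rightarrow> (nat \<Rightarrow> real) \<Rightarrow> nat \<Rightarrow> 'v"
  where "partial_sum w c 0 = \<zero>"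
  | "partial_sum w c (Suc n) = partial_sum w c n \<oplus> c n \<odot> w n"

context
  fixes w :: "nat \<Rightarrow> 'v" and K :: real
  assumes w: "\<And>n. w n \<in> carrier V" and K: "\<And>n. vnorm V (w n) \<le> K"
begin

lemma partial_sum_closed: "partial_sum w c n \<in> carrier V"
  by (induction n) (auto simp: w real_smult_closed)

lemma partial_sum_plus: "partial_sum w (\<lambda>n. a n + b n) n = partial_sum w a n \<oplus> partial_sum w b n"
  by (induction n) (auto simp: w real_smult_closed partial_sum_closed smult_add_left M.a_ac)

lemma partial_sum_scale: "partial_sum w (\<lambda>n. t * a n) n = (t::real) \<odot> partial_sum w a n"
proof (induction n)
  case 0
  show ?case using smult_smult[of \<zero> t 0] by (simp add: zero_smult)
next
  case (Suc n)
  then show ?case by (simp add: w real_smult_closed partial_sum_closed smult_add_right smult_smult)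
qed

lemma partial_sum_diff:
  assumes "m \<le> n"
  shows "vnorm V (partial_sum w c n \<ominus> partial_sum w c m) \<le> K * (\<Sum>k=m..<n. \<bar>c k\<bar>)"
  using assms
proof (induction n rule: dec_induct)
  case base
  show ?case by (simp add: minus_self partial_sum_closed vnorm_zero)
next
  case (step n)
  have "partial_sum w c (Suc n) \<ominus> partial_sum w c n = c n \<odot> w n"
    using minus_add_minus[of "partial_sum w c n" "c n \<odot> w n" "partial_sum w c n" \<zero>]
      partial_sum_closed[of c n] real_smult_closed[OF w[of n], of "c n"]
    by (simp add: minus_self minus_zero)
  then have "vnorm V (partial_sum w c (Suc n) \<ominus> partial_sum w c n) \<le> \<bar>c n\<bar> * K"
    using K[of n] by (simp add: vnorm_smult w mult_left_mono)
  moreover have "(\<Sum>k=m..<Suc n. \<bar>c k\<bar>) = (\<Sum>k=m..<n. \<bar>c k\<bar>) + \<bar>c n\<bar>" using step by simp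
  ultimately show ?case
    using vnorm_triangle_minus[OF partial_sum_closed[of c "Suc n"] partial_sum_closed[of c n] partial_sum_closed[of c m]] step.IH
    by (simp add: distrib_left mult.commute)
qed

text \<open>The map sends c to the sum of the series with terms \<open>c k \<odot> w k\<close>,
  which converges absolutely in a complete space. The estimates for partial sums pass to the limit
  and bound the map from both sides.\<close>

lemma ell1_embedding:
  assumes complete: "banach_space V" and "\<delta> > 0"
    and low: "\<And>c n. \<delta> * (\<Sum>k<n. \<bar>c k\<bar>) \<le> vnorm V (partial_sum w c n)"
  shows "contains_isomorphic_copy V l1_space"
proof -
  have "0 \<le> K" using K[of 0] vnorm_nonneg[OF w[of 0]] by linarith
  have ex: "\<exists>v. tends (partial_sum w c) v" if c: "c \<in> carrier l1_space" for c
  proof -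
    have sum: "summable (\<lambda>n. \<bar>c n\<bar>)" using c by (simp add: l1_space_def)
    have "\<exists>N. \<forall>n\<ge>N. \<forall>n'\<ge>N. vnorm V (partial_sum w c n \<ominus> partial_sum w c n') < \<epsilon>" if "\<epsilon> > 0" for \<epsilon>
    proof -
      have e': "\<epsilon> / (K + 1) > 0" using that \<open>0 \<le> K\<close> by simp
      then obtain N where N: "\<And>m n. m \<ge> N \<Longrightarrow> norm (\<Sum>k=m..<n. \<bar>c k\<bar>) < \<epsilon> / (K + 1)"
        using sum[unfolded summable_Cauchy] by meson
      have small: "vnorm V (partial_sum w c n \<ominus> partial_sum w c m) < \<epsilon>" if "N \<le> m" "m \<le> n" for m n
      proof -
        have "K * (\<Sum>k=m..<n. \<bar>c k\<bar>) \<le> K * (\<epsilon> / (K + 1))"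
          using N[OF that(1), of n] \<open>0 \<le> K\<close> by (intro mult_left_mono) (auto simp: abs_le_iff)
        also have "\<dots> < \<epsilon>" using \<open>\<epsilon> > 0\<close> \<open>0 \<le> K\<close> by (simp add: field_simps)
        finally show ?thesis using partial_sum_diff[OF that(2), of c] by linarith
      qed
      have "vnorm V (partial_sum w c n \<ominus> partial_sum w c n') < \<epsilon>" if "n \<ge> N" "n' \<ge> N" for n n'
      proof (cases "n' \<le> n")
        case True
        then show ?thesis using small that by blast
      next
        case False
        then show ?thesis
          using small[of n n'] that vnorm_minus_commute[OF partial_sum_closed[of c n] partial_sum_closed[of c n']] by simp
      qed
      then show ?thesis by blast
    qed
    then obtain v where v: "v \<in> carrier V"
      "\<And>\<epsilon>. \<epsilon> > 0 \<Longrightarrow> \<exists>N. \<forall>n\<ge>N. vnorm V (partial_sum w c n \<ominus> v) < \<epsilon>"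
      using complete[unfolded banach_space_def mcomplete_iff] partial_sum_closed by blast
    have "(\<lambda>n. vnorm V (partial_sum w c n \<ominus> v)) \<longlonglongrightarrow> 0"
      by (rule LIMSEQ_I) (use v vnorm_nonneg partial_sum_closed in auto)
    then show ?thesis using v(1) partial_sum_closed by (auto simp: tends_def)
  qed
  define S where "S c = (SOME v. tends (partial_sum w c) v)" for c
  have S: "tends (partial_sum w c) (S c)" if "c \<in> carrier l1_space" for c
    unfolding S_def by (rule someI_ex[OF ex[OF that]])
  interpret L: real_normed_space "l1_space :: (nat \<Rightarrow> real) normed_module" by (rule real_normed_space_l1_space)
  have "linear_operator l1_space V S"
    unfolding linear_operator_def
  proof (intro conjI ballI allI)
    show "S \<in> carrier l1_space \<rightarrow> carrier V" using S by (auto simp: tends_def)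
    fix a b assume ab: "a \<in> carrier l1_space" "b \<in> carrier l1_space"
    have "tends (partial_sum w (a \<oplus>\<^bsub>l1_space\<^esub> b)) (S a \<oplus> S b)"
      using tends_add[OF S[OF ab(1)] S[OF ab(2)]] by (simp add: l1_space_def flip: partial_sum_plus)
    then show "S (a \<oplus>\<^bsub>l1_space\<^esub> b) = S a \<oplus> S b"
      using tends_unique S[OF L.M.add.m_closed[OF ab]] by blast
  next
    fix t a assume a: "a \<in> carrier l1_space"
    have "tends (partial_sum w (t \<odot>\<^bsub>l1_space\<^esub> a)) (t \<odot> S a)"
      using tends_smult[OF S[OF a], of t] by (simp add: l1_space_def flip: partial_sum_scale)
    then show "S (t \<odot>\<^bsub>l1_space\<^esub> a) = t \<odot> S a"
      using tends_unique S[OF L.real_smult_closed[OF a, of t]] by blast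
  qed
  then interpret S: linear_map_of_normed_spaces "l1_space :: (nat \<Rightarrow> real) normed_module" V S
    by unfold_locales
  have norms: "(\<lambda>n. \<Sum>k<n. \<bar>a k\<bar>) \<longlonglongrightarrow> vnorm l1_space a" if "a \<in> carrier l1_space" for a
    using that summable_LIMSEQ[of "\<lambda>n. \<bar>a n\<bar>"] by (simp add: l1_space_def)
  have "embedding_map (norm_topology l1_space) (norm_topology V) S"
  proof (rule S.embedding_of_bounded_below[OF \<open>\<delta> > 0\<close>, of "K + 1"])
    show "0 < K + 1" using \<open>0 \<le> K\<close> by simp
    fix a assume a: "a \<in> carrier (l1_space :: (nat \<Rightarrow> real) normed_module)"
    show "\<delta> * vnorm l1_space a \<le> vnorm V (S a)"
      by (rule LIMSEQ_le[OF tendsto_mult_left[OF norms[OF a]] tends_vnorm[OF S[OF a]]]) (use low in blast)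
    have "vnorm V (partial_sum w a n) \<le> (K + 1) * (\<Sum>k<n. \<bar>a k\<bar>)" for n
    proof -
      have "vnorm V (partial_sum w a n) \<le> K * (\<Sum>k<n. \<bar>a k\<bar>)"
        using partial_sum_diff[of 0 n a] partial_sum_closed[of a n] by (simp add: minus_zero atLeast0LessThan)
      also have "\<dots> \<le> (K + 1) * (\<Sum>k<n. \<bar>a k\<bar>)" by (intro mult_right_mono sum_nonneg) auto
      finally show ?thesis .
    qed
    then show "vnorm V (S a) \<le> (K + 1) * vnorm l1_space a"
      by (intro LIMSEQ_le[OF tends_vnorm[OF S[OF a]] tendsto_mult_left[OF norms[OF a]]]) blast
  qed
  then show ?thesis unfolding contains_isomorphic_copy_def using \<open>linear_operator l1_space V S\<close> by blast
qed

end

end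

text \<open>The thresholds come from a finite grid of mesh \<eta> / 2. If no pair of neighbouring
  grid values worked, U could be shrunk successively until none of these pairs is straddled on it,
  yet an oscillation of at least \<eta> always straddles one.\<close>

lemma not_fragmented_imp_gap:
  fixes \<psi> :: "'x::topological_space \<Rightarrow> real"
  assumes A: "A \<subseteq> X" "A \<noteq> {}" and C: "\<And>x. x \<in> X \<Longrightarrow> \<bar>\<psi> x\<bar> \<le> C" and "\<eta> > 0"
    and osc: "\<And>U. openin (top_of_set X) U \<Longrightarrow> U \<inter> A \<noteq> {} \<Longrightarrow> \<exists>y\<in>U \<inter> A. \<exists>z\<in>U \<inter> A. \<eta> \<le> \<psi> z - \<psi> y"
  shows "\<exists>a b U. a < b \<and> openin (top_of_set X) U \<and> U \<inter> A \<noteq> {} \<and>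
    (\<forall>U'\<subseteq>U. openin (top_of_set X) U' \<and> U' \<inter> A \<noteq> {} \<longrightarrow> (\<exists>y\<in>U' \<inter> A. \<psi> y \<le> a) \<and> (\<exists>z\<in>U' \<inter> A. b \<le> \<psi> z))"
proof (rule ccontr)
  assume neg: "\<not> ?thesis"
  define t where "t i = - C + real i * (\<eta> / 2)" for i :: nat
  define good where "good i U \<longleftrightarrow> (\<exists>y\<in>U \<inter> A. \<psi> y \<le> t i) \<and> (\<exists>z\<in>U \<inter> A. t (Suc i) \<le> \<psi> z)" for i U
  have good_mono: "good i U" if "good i U'" "U' \<subseteq> U" for i U U' using that unfolding good_def by blast
  have t_less: "t i < t (Suc i)" for i using \<open>\<eta> > 0\<close> by (simp add: t_def)
  have shrink: "\<exists>U'\<subseteq>U. openin (top_of_set X) U' \<and> U' \<inter> A \<noteq> {} \<and> \<not> good i U'"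
    if "openin (top_of_set X) U" "U \<inter> A \<noteq> {}" for U i
  proof (rule ccontr)
    assume "\<not> ?thesis"
    then have "\<forall>U'\<subseteq>U. openin (top_of_set X) U' \<and> U' \<inter> A \<noteq> {} \<longrightarrow> (\<exists>y\<in>U' \<inter> A. \<psi> y \<le> t i) \<and> (\<exists>z\<in>U' \<inter> A. t (Suc i) \<le> \<psi> z)"
      unfolding good_def by (simp only: not_ex) blast
    then show False using neg that t_less[of i]
      by (elim notE, intro exI[of _ "t i"] exI[of _ "t (Suc i)"] exI[of _ U] conjI)
  qed
  have none: "\<exists>U. openin (top_of_set X) U \<and> U \<inter> A \<noteq> {} \<and> (\<forall>i<k. \<not> good i U)" for k :: nat
  proof (induction k)
    case 0
    show ?case using A by (intro exI[of _ X]) auto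
  next
    case (Suc k)
    then obtain U where U: "openin (top_of_set X) U" "U \<inter> A \<noteq> {}" "\<forall>i<k. \<not> good i U" by blast
    obtain U' where U': "U' \<subseteq> U" "openin (top_of_set X) U'" "U' \<inter> A \<noteq> {}" "\<not> good k U'"
      using shrink[OF U(1,2), of k] by blast
    have "\<not> good i U'" if "i < Suc k" for i
      using that U(3) U'(1,4) good_mono[of i U' U] less_Suc_eq by auto
    then show ?case using U' by blast
  qed
  obtain U where U: "openin (top_of_set X) U" "U \<inter> A \<noteq> {}" "\<forall>i<nat \<lceil>2 * C / (\<eta> / 2)\<rceil> + 1. \<not> good i U"
    using none by blast
  obtain y z where yz: "y \<in> U \<inter> A" "z \<in> U \<inter> A" "\<eta> \<le> \<psi> z - \<psi> y" using osc[OF U(1,2)] by blast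
  have C': "- C \<le> \<psi> y" "\<psi> y \<le> C" using C[of y] yz(1) A(1) by (auto simp: abs_le_iff)
  \<comment> \<open>Rounding up puts \<open>t i\<close> into the half-open interval from \<psi> y to
    \<psi> y + \<eta> / 2, so \<open>t (Suc i)\<close> is still below \<psi> y + \<eta> and hence
    below \<psi> z.\<close>
  define i where "i = nat \<lceil>(\<psi> y + C) / (\<eta> / 2)\<rceil>"
  have q: "(\<psi> y + C) / (\<eta> / 2) \<ge> 0" using C' \<open>\<eta> > 0\<close> by simp
  have "(\<psi> y + C) / (\<eta> / 2) \<le> i" "i < (\<psi> y + C) / (\<eta> / 2) + 1"
    unfolding i_def using q by linarith+
  then have "\<psi> y + C \<le> i * (\<eta> / 2)" "i * (\<eta> / 2) < (\<psi> y + C) + \<eta> / 2"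
    using \<open>\<eta> > 0\<close> by (simp_all add: field_simps)
  then have "\<psi> y \<le> t i" "t (Suc i) \<le> \<psi> z"
    using yz(3) unfolding t_def by (simp_all add: algebra_simps)
  then have "good i U" using yz unfolding good_def by blast
  moreover have "i < nat \<lceil>2 * C / (\<eta> / 2)\<rceil> + 1"
  proof -
    have "(\<psi> y + C) / (\<eta> / 2) \<le> 2 * C / (\<eta> / 2)" using C'(2) \<open>\<eta> > 0\<close> by (intro divide_right_mono) auto
    then have "i \<le> nat \<lceil>2 * C / (\<eta> / 2)\<rceil>" unfolding i_def by (intro nat_mono ceiling_mono)
    then show ?thesis by simp
  qed
  ultimately show False using U(3) by blast
qed

text \<open>At each stage finitely many open sets meeting A are given, and \<psi> takes low and high
  values on A inside each of them. One continuous \<open>f g\<close> approximating \<psi> at these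
  finitely many points splits every set into two open sets that still meet A. The function \<psi>
  itself need not be continuous; openness comes from \<open>f g\<close>.\<close>

lemma not_fragmented_imp_independent:
  fixes \<psi> :: "'x::topological_space \<Rightarrow> real"
  assumes A: "A \<subseteq> X" "A \<noteq> {}" and C: "\<And>x. x \<in> X \<Longrightarrow> \<bar>\<psi> x\<bar> \<le> C" and "\<eta> > 0"
    and osc: "\<And>U. openin (top_of_set X) U \<Longrightarrow> U \<inter> A \<noteq> {} \<Longrightarrow> \<exists>y\<in>U \<inter> A. \<exists>z\<in>U \<inter> A. \<eta> \<le> \<psi> z - \<psi> y"
    and cont: "\<And>g. g \<in> I \<Longrightarrow> continuous_on X (f g)"
    and approx: "\<And>Q e. finite Q \<Longrightarrow> Q \<subseteq> X \<Longrightarrow> e > 0 \<Longrightarrow> \<exists>g\<in>I. \<forall>q\<in>Q. \<bar>f g q - \<psi> q\<bar> < e"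
  shows "\<exists>g a b. (\<forall>n::nat. g n \<in> I) \<and> a < b \<and>
    (\<forall>N \<epsilon>. \<exists>x\<in>X. \<forall>j<N. if \<epsilon> j then f (g j) x \<le> a else b \<le> f (g j) x)"
proof -
  have "\<exists>a b U. a < b \<and> openin (top_of_set X) U \<and> U \<inter> A \<noteq> {} \<and>
    (\<forall>U'\<subseteq>U. openin (top_of_set X) U' \<and> U' \<inter> A \<noteq> {} \<longrightarrow> (\<exists>y\<in>U' \<inter> A. \<psi> y \<le> a) \<and> (\<exists>z\<in>U' \<inter> A. b \<le> \<psi> z))"
    by (rule not_fragmented_imp_gap[OF A C \<open>\<eta> > 0\<close> osc])
  then obtain a0 b0 U0 where ab0: "a0 < b0" and U0: "openin (top_of_set X) U0" "U0 \<inter> A \<noteq> {}"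
    and gap: "\<forall>U\<subseteq>U0. openin (top_of_set X) U \<and> U \<inter> A \<noteq> {} \<longrightarrow> (\<exists>y\<in>U \<inter> A. \<psi> y \<le> a0) \<and> (\<exists>z\<in>U \<inter> A. b0 \<le> \<psi> z)"
    by (elim exE conjE) (rule that)
  \<comment> \<open>One third is lost to approximation at each end, leaving a gap b - a equal to
    e.\<close>
  define e where "e = (b0 - a0) / 3"
  have "e > 0" using ab0 by (simp add: e_def)
  define a where "a = a0 + e"
  define b where "b = b0 - e"
  have ab: "a < b" using ab0 by (simp add: a_def b_def e_def field_simps)
  define L where "L g = {x\<in>X. f g x < a}" for g
  define H where "H g = {x\<in>X. b < f g x}" for g
  have open_L: "openin (top_of_set X) (L g)" and open_H: "openin (top_of_set X) (H g)" if "g \<in> I" for g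
  proof -
    have "openin (top_of_set X) (X \<inter> f g -` {..<a})" "openin (top_of_set X) (X \<inter> f g -` {b<..})"
      by (rule continuous_openin_preimage_gen[OF cont[OF that]]; simp)+
    moreover have "X \<inter> f g -` {..<a} = L g" "X \<inter> f g -` {b<..} = H g" by (auto simp: L_def H_def)
    ultimately show "openin (top_of_set X) (L g)" "openin (top_of_set X) (H g)" by simp_all
  qed
  define ok where "ok \<U> \<longleftrightarrow> finite \<U> \<and> (\<forall>U\<in>\<U>. U \<subseteq> U0 \<and> openin (top_of_set X) U \<and> U \<inter> A \<noteq> {})" for \<U>
  define split where "split \<U> g = (\<lambda>U. U \<inter> L g) ` \<U> \<union> (\<lambda>U. U \<inter> H g) ` \<U>" for \<U> g
  have step: "\<exists>g\<in>I. ok (split \<U> g)" if ok: "ok \<U>" for \<U>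
  proof -
    have gapU: "(\<exists>y\<in>U \<inter> A. \<psi> y \<le> a0) \<and> (\<exists>z\<in>U \<inter> A. b0 \<le> \<psi> z)" if "U \<in> \<U>" for U
      using gap[rule_format, of U] ok that unfolding ok_def by simp
    have "\<forall>U\<in>\<U>. \<exists>y. y \<in> U \<inter> A \<and> \<psi> y \<le> a0" using gapU by (simp add: Bex_def)
    from bchoice[OF this] obtain y where y: "\<And>U. U \<in> \<U> \<Longrightarrow> y U \<in> U \<inter> A" "\<And>U. U \<in> \<U> \<Longrightarrow> \<psi> (y U) \<le> a0" by blast
    have "\<forall>U\<in>\<U>. \<exists>z. z \<in> U \<inter> A \<and> b0 \<le> \<psi> z" using gapU by (simp add: Bex_def)
    from bchoice[OF this] obtain z where z: "\<And>U. U \<in> \<U> \<Longrightarrow> z U \<in> U \<inter> A" "\<And>U. U \<in> \<U> \<Longrightarrow> b0 \<le> \<psi> (z U)" by blast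
    have "finite (y ` \<U> \<union> z ` \<U>)" "y ` \<U> \<union> z ` \<U> \<subseteq> X" using ok y(1) z(1) A(1) by (auto simp: ok_def)
    then obtain g where g: "g \<in> I" "\<And>q. q \<in> y ` \<U> \<union> z ` \<U> \<Longrightarrow> \<bar>f g q - \<psi> q\<bar> < e" using approx \<open>e > 0\<close> by meson
    have "y U \<in> L g" "z U \<in> H g" if U: "U \<in> \<U>" for U
    proof -
      have "\<bar>f g (y U) - \<psi> (y U)\<bar> < e" "\<bar>f g (z U) - \<psi> (z U)\<bar> < e" using g(2) U by auto
      then show "y U \<in> L g" "z U \<in> H g"
        using y[OF U] z[OF U] A(1) unfolding L_def H_def a_def b_def by (auto simp: abs_less_iff)
    qed
    then have "U \<inter> L g \<inter> A \<noteq> {}" "U \<inter> H g \<inter> A \<noteq> {}" if "U \<in> \<U>" for U using y(1) z(1) that by blast+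
    then have "ok (split \<U> g)"
      using ok open_L[OF g(1)] open_H[OF g(1)] unfolding ok_def split_def by auto
    then show ?thesis using g(1) by blast
  qed
  have "\<exists>\<sigma>. \<forall>n. ok (fst (\<sigma> n)) \<and> (n = 0 \<longrightarrow> fst (\<sigma> n) = {U0}) \<and>
      (snd (\<sigma> (Suc n)) \<in> I \<and> fst (\<sigma> (Suc n)) = split (fst (\<sigma> n)) (snd (\<sigma> (Suc n))))"
  proof -
    have 0: "\<exists>s. ok (fst s) \<and> ((0::nat) = 0 \<longrightarrow> fst s = {U0})"
      using U0 by (intro exI[of _ "({U0}, undefined)"]) (auto simp: ok_def)
    have S: "\<exists>s'. (ok (fst s') \<and> (Suc n = 0 \<longrightarrow> fst s' = {U0})) \<and> snd s' \<in> I \<and> fst s' = split (fst s) (snd s')"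
      if s: "ok (fst s) \<and> (n = 0 \<longrightarrow> fst s = {U0})" for s and n :: nat
    proof -
      obtain g where "g \<in> I" "ok (split (fst s) g)" using step[of "fst s"] s by blast
      then show ?thesis by (intro exI[of _ "(split (fst s) g, g)"]) simp
    qed
    show ?thesis
      using dependent_nat_choice[of "\<lambda>n s. ok (fst s) \<and> (n = 0 \<longrightarrow> fst s = {U0})"
        "\<lambda>n s s'. snd s' \<in> I \<and> fst s' = split (fst s) (snd s')", OF 0 S] by (simp add: conj_assoc)
  qed
  then obtain \<sigma> where all: "\<forall>n. ok (fst (\<sigma> n)) \<and> (n = 0 \<longrightarrow> fst (\<sigma> n) = {U0}) \<and>
      (snd (\<sigma> (Suc n)) \<in> I \<and> fst (\<sigma> (Suc n)) = split (fst (\<sigma> n)) (snd (\<sigma> (Suc n))))"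
    by (elim exE)
  have \<sigma>: "ok (fst (\<sigma> n))" "fst (\<sigma> 0) = {U0}" "snd (\<sigma> (Suc n)) \<in> I"
    "fst (\<sigma> (Suc n)) = split (fst (\<sigma> n)) (snd (\<sigma> (Suc n)))" for n
    using all[rule_format, of n] all[rule_format, of 0] by simp_all
  define g where "g n = snd (\<sigma> (Suc n))" for n
  have "\<exists>x\<in>X. \<forall>j<N. if \<epsilon> j then f (g j) x \<le> a else b \<le> f (g j) x" for N \<epsilon>
  proof -
    define T where "T = rec_nat U0 (\<lambda>j U. U \<inter> (if \<epsilon> j then L (g j) else H (g j)))"
    have T0: "T 0 = U0" and TS: "T (Suc j) = T j \<inter> (if \<epsilon> j then L (g j) else H (g j))" for j
      by (simp_all add: T_def)
    have "T j \<in> fst (\<sigma> j)" for j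
    proof (induction j)
      case (Suc j)
      then show ?case unfolding \<sigma>(4)[of j] split_def TS g_def by (cases "\<epsilon> j") auto
    qed (simp add: T0 \<sigma>(2))
    then have "T N \<inter> A \<noteq> {}" using \<sigma>(1)[of N] unfolding ok_def by blast
    then obtain x where x: "x \<in> T N" "x \<in> A" by blast
    have "x \<in> T n \<Longrightarrow> \<forall>j<n. x \<in> (if \<epsilon> j then L (g j) else H (g j))" for n
      by (induction n) (auto simp: TS less_Suc_eq)
    then have x': "\<And>j. j < N \<Longrightarrow> x \<in> (if \<epsilon> j then L (g j) else H (g j))" using x(1) by blast
    have "if \<epsilon> j then f (g j) x \<le> a else b \<le> f (g j) x" if "j < N" for j
      using x'[OF that] by (cases "\<epsilon> j") (simp_all add: L_def H_def)
    then show ?thesis using x(2) A(1) by blast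
  qed
  moreover have "\<forall>n. g n \<in> I" using \<sigma>(3) by (simp add: g_def)
  ultimately show ?thesis using ab by (intro exI[of _ g] exI[of _ a] exI[of _ b] conjI allI) simp_all
qed


section \<open>Representable systems are tame\<close>

text \<open>A neighbourhood in the pointwise topology constrains finitely many points, hence
  approximation on finite sets only.\<close>

lemma enveloping_semigroup_approx:
  fixes X :: "'x::topological_space set"
  assumes p: "p \<in> enveloping_semigroup G X \<phi>" and f: "continuous_map (top_of_set X) euclideanreal f"
    and Q: "finite Q" "Q \<subseteq> X" and "e > 0"
  shows "\<exists>g\<in>carrier G. \<forall>q\<in>Q. \<bar>f (\<phi> g q) - f (p q)\<bar> < e"
proof -
  let ?T = "product_topology (\<lambda>_. top_of_set X) X"
  have pT: "p \<in> topspace ?T" and cl: "\<And>U. p \<in> U \<Longrightarrow> openin ?T U \<Longrightarrow> \<exists>y. y \<in> \<phi> ` carrier G \<and> y \<in> U"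
    using p unfolding enveloping_semigroup_def in_closure_of by blast+
  define W where "W q = {s \<in> topspace ?T. f (s q) \<in> {f (p q) - e<..<f (p q) + e}}" for q
  have "openin ?T (W q)" if "q \<in> Q" for q
  proof -
    have "continuous_map ?T (top_of_set X) (\<lambda>s. s q)"
      by (rule continuous_map_product_projection) (use Q that in blast)
    from continuous_map_compose[OF this f] have "continuous_map ?T euclideanreal (\<lambda>s. f (s q))"
      by (simp add: o_def)
    then show ?thesis unfolding W_def by (rule openin_continuous_map_preimage) simp
  qed
  then have "openin ?T ((\<Inter>q\<in>Q. W q) \<inter> topspace ?T)" by (intro openin_INT Q(1))
  moreover have "p \<in> (\<Inter>q\<in>Q. W q) \<inter> topspace ?T" using pT \<open>e > 0\<close> by (simp add: W_def)
  ultimately have "\<exists>y. y \<in> \<phi> ` carrier G \<and> y \<in> (\<Inter>q\<in>Q. W q) \<inter> topspace ?T" by (intro cl)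
  then obtain y where y: "y \<in> \<phi> ` carrier G" "y \<in> (\<Inter>q\<in>Q. W q) \<inter> topspace ?T" by (elim exE conjE)
  from y(1) obtain g where "y = \<phi> g" "g \<in> carrier G" by (rule imageE)
  with y(2) have g: "g \<in> carrier G" "\<And>q. q \<in> Q \<Longrightarrow> \<phi> g \<in> W q" by simp_all
  have "\<bar>f (\<phi> g q) - f (p q)\<bar> < e" if "q \<in> Q" for q
    using g(2)[OF that] by (auto simp: W_def abs_less_iff)
  then show ?thesis using g(1) by blast
qed

text \<open>On a compact space, finitely many functions of a separating family already control
  distances at a given scale. Otherwise compactness would yield a pair of points at distance at
  least e on which all functions agree.\<close>

lemma dist_small_of_separating:
  fixes X :: "'x::metric_space set"
  assumes X: "compact X" and cont: "\<And>v. v \<in> I \<Longrightarrow> continuous_on X (f v :: 'x \<Rightarrow> real)"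
    and sep: "\<And>x y. x \<in> X \<Longrightarrow> y \<in> X \<Longrightarrow> (\<And>v. v \<in> I \<Longrightarrow> f v x = f v y) \<Longrightarrow> x = y" and "e > 0"
  shows "\<exists>J \<kappa>. finite J \<and> J \<subseteq> I \<and> \<kappa> > 0 \<and>
    (\<forall>x\<in>X. \<forall>y\<in>X. (\<forall>v\<in>J. \<bar>f v x - f v y\<bar> < \<kappa>) \<longrightarrow> dist x y < e)"
proof (rule ccontr)
  assume neg: "\<not> ?thesis"
  define K where "K = {z \<in> X \<times> X. e \<le> dist (fst z) (snd z)}"
  have XX: "compact (X \<times> X)" using X by (intro compact_Times)
  then have cXX: "closed (X \<times> X)" by (rule compact_imp_closed)
  have "closed K" unfolding K_def
    using cXX by (intro continuous_on_closed_Collect_le) (auto intro!: continuous_intros)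
  then have "compact K" using XX compact_Int_closed[of "X \<times> X" K] by (simp add: K_def inf.absorb2 Collect_conj_eq Int_assoc[symmetric])
  \<comment> \<open>The pair index lets one intersection range over both functions and tolerances; a
    finite set of pairs is served by its functions and its smallest tolerance.\<close>
  define B where "B = (\<lambda>(v, n). {z \<in> X \<times> X. \<bar>f v (fst z) - f v (snd z)\<bar> \<le> 1 / real (Suc n)})"
  have clB: "closed (B i)" if iI: "i \<in> I \<times> UNIV" for i
  proof -
    obtain v n where i: "i = (v, n)" "v \<in> I" using iI by auto
    have "continuous_on (X \<times> X) (\<lambda>z. f v (fst z))" "continuous_on (X \<times> X) (\<lambda>z. f v (snd z))"
      by (rule continuous_on_compose2[OF cont[OF i(2)]]; auto intro!: continuous_intros)+
    then show ?thesis unfolding i B_def prod.case using cXX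
      by (intro continuous_on_closed_Collect_le continuous_intros)
  qed
  have fip: "K \<inter> (\<Inter>i\<in>J. B i) \<noteq> {}" if J: "finite J" "J \<subseteq> I \<times> UNIV" for J
  proof -
    obtain m where m: "\<And>n. n \<in> snd ` J \<Longrightarrow> n \<le> m" using J(1) by (metis finite_imageI finite_nat_set_iff_bounded_le)
    have "finite (fst ` J)" "fst ` J \<subseteq> I" "1 / real (Suc m) > 0" using J by auto
    then have "\<not> (\<forall>x\<in>X. \<forall>y\<in>X. (\<forall>v\<in>fst ` J. \<bar>f v x - f v y\<bar> < 1 / real (Suc m)) \<longrightarrow> dist x y < e)"
      using neg by blast
    then obtain x y where xy: "x \<in> X" "y \<in> X" "\<And>v. v \<in> fst ` J \<Longrightarrow> \<bar>f v x - f v y\<bar> < 1 / real (Suc m)" "\<not> dist x y < e"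
      by blast
    have "(x, y) \<in> B i" if "i \<in> J" for i
    proof -
      have "fst i \<in> fst ` J" "snd i \<le> m" using that m by auto
      moreover from this have "1 / real (Suc m) \<le> 1 / real (Suc (snd i))" by (simp add: frac_le)
      ultimately show ?thesis using xy(1,2) xy(3)[of "fst i"] by (simp add: B_def case_prod_beta)
    qed
    then have "(x, y) \<in> K \<inter> (\<Inter>i\<in>J. B i)" using xy by (simp add: K_def)
    then show ?thesis by (metis empty_iff)
  qed
  have "K \<inter> (\<Inter>i\<in>I \<times> UNIV. B i) \<noteq> {}"
    by (rule compact_imp_fip_image[OF \<open>compact K\<close> clB fip])
  then obtain z where "z \<in> K \<inter> (\<Inter>i\<in>I \<times> UNIV. B i)" by (metis ex_in_conv)
  then have z: "z \<in> K" "\<And>v n. v \<in> I \<Longrightarrow> z \<in> B (v, n)" by simp_all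
  have "f v (fst z) = f v (snd z)" if v: "v \<in> I" for v
  proof (rule ccontr)
    assume "f v (fst z) \<noteq> f v (snd z)"
    then obtain n where "1 / Suc n < \<bar>f v (fst z) - f v (snd z)\<bar>"
      using nat_approx_posE[of "\<bar>f v (fst z) - f v (snd z)\<bar>"] by auto
    then show False using z(2)[OF v, of n] by (simp add: B_def)
  qed
  then have "fst z = snd z" using sep z(1) by (auto simp: K_def)
  then show False using z(1) \<open>e > 0\<close> by (simp add: K_def)
qed

text \<open>Excluding l1 makes p fragmented when viewed through one vector (\<open>single\<close>);
  shrinking U repeatedly extends this to finitely many vectors (\<open>several\<close>), and
  finitely many vectors control the metric of X.\<close>

lemma representable_imp_tame:
  fixes X :: "'x::metric_space set" and V :: "('v, 'k) normed_module_scheme"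
  assumes group: "topological_group G T" and X: "compact X"
    and rep: "separable_rosenthal_representation_space G T X \<phi> V"
  shows "tame_system G X \<phi>"
proof -
  have banach: "banach_space V" and no: "\<not> contains_isomorphic_copy V l1_space"
    using rep by (auto simp: separable_rosenthal_representation_space_def rosenthal_space_def)
  obtain h \<alpha> where h: "continuous_map T (isometry_topology V) h"
    and \<alpha>: "continuous_map (top_of_set X) (weak_star_topology V) \<alpha>"
    and bdd: "norm_bounded_functionals V (\<alpha> ` X)"
    and equiv: "\<And>g x v. g \<in> carrier G \<Longrightarrow> x \<in> X \<Longrightarrow> v \<in> carrier V \<Longrightarrow> \<alpha> (\<phi> g x) v = \<alpha> x (h g v)"
    and emb: "embedding_map (top_of_set X) (weak_star_topology V) \<alpha>"
    using rep unfolding separable_rosenthal_representation_space_def faithfully_representable_on_def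
      continuous_representation_def by blast
  interpret real_normed_space V using banach by (simp add: banach_space_def)
  have topT: "topspace T = carrier G" using group by (rule topological_group.topspace_eq)
  have iso: "h g \<in> linear_isometries V" if "g \<in> carrier G" for g
    using continuous_map_funspace[OF h] that topT by (auto simp: isometry_topology_def)
  have dual: "\<alpha> x \<in> dual_space V" if "x \<in> X" for x
    using continuous_map_funspace[OF \<alpha>] that by (auto simp: weak_star_topology_def)
  have \<alpha>_cont: "continuous_map (top_of_set X) euclideanreal (\<lambda>x. \<alpha> x v)" if "v \<in> carrier V" for v
    using \<alpha> that unfolding weak_star_topology_def continuous_map_in_subtopology continuous_map_componentwise by blast
  obtain C0 where C0: "\<And>x v. x \<in> X \<Longrightarrow> v \<in> carrier V \<Longrightarrow> \<bar>\<alpha> x v\<bar> \<le> C0 * vnorm V v"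
    using bdd unfolding norm_bounded_functionals_def by blast
  define C where "C = max C0 1"
  have C: "\<bar>\<alpha> x v\<bar> \<le> C * vnorm V v" if "x \<in> X" "v \<in> carrier V" for x v
  proof -
    have "C0 * vnorm V v \<le> C * vnorm V v" using vnorm_nonneg[OF that(2)] by (intro mult_right_mono) (auto simp: C_def)
    then show ?thesis using C0[OF that] by linarith
  qed
  have "C > 0" by (simp add: C_def)
  have hv: "h g v \<in> carrier V" "vnorm V (h g v) = vnorm V v" if "g \<in> carrier G" "v \<in> carrier V" for g v
    using iso[OF that(1)] that(2) by (auto simp: linear_isometries_def linear_operator_def)
  have single: "\<exists>U. openin (top_of_set X) U \<and> U \<inter> A \<noteq> {} \<and> (\<forall>y\<in>U \<inter> A. \<forall>z\<in>U \<inter> A. \<bar>\<alpha> (p y) v - \<alpha> (p z) v\<bar> < \<eta>)"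
    if p: "p \<in> enveloping_semigroup G X \<phi>" and v: "v \<in> carrier V" and A: "A \<subseteq> X" "A \<noteq> {}" and "\<eta> > 0" for p v A \<eta>
  proof (rule ccontr)
    assume neg: "\<not> ?thesis"
    have pX: "p x \<in> X" if "x \<in> X" for x
      using p that unfolding enveloping_semigroup_def in_closure_of by auto
    have "\<exists>g a b. (\<forall>n::nat. g n \<in> carrier G) \<and> a < b \<and>
      (\<forall>N \<epsilon>. \<exists>x\<in>X. \<forall>j<N. if \<epsilon> j then \<alpha> x (h (g j) v) \<le> a else b \<le> \<alpha> x (h (g j) v))"
    proof (rule not_fragmented_imp_independent[where \<psi> = "\<lambda>x. \<alpha> (p x) v" and C = "C * vnorm V v" and f = "\<lambda>g x. \<alpha> x (h g v)", OF A _ \<open>\<eta> > 0\<close>])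
      show "\<bar>\<alpha> (p x) v\<bar> \<le> C * vnorm V v" if "x \<in> X" for x using C[OF pX[OF that] v] .
      show "\<exists>y\<in>U \<inter> A. \<exists>z\<in>U \<inter> A. \<eta> \<le> \<alpha> (p z) v - \<alpha> (p y) v"
        if U: "openin (top_of_set X) U" "U \<inter> A \<noteq> {}" for U
      proof -
        obtain y z where yz: "y \<in> U \<inter> A" "z \<in> U \<inter> A" "\<not> \<bar>\<alpha> (p y) v - \<alpha> (p z) v\<bar> < \<eta>" using neg U by blast
        then consider "\<eta> \<le> \<alpha> (p z) v - \<alpha> (p y) v" | "\<eta> \<le> \<alpha> (p y) v - \<alpha> (p z) v" by linarith
        then show ?thesis using yz by cases blast+
      qed
      show "continuous_on X (\<lambda>x. \<alpha> x (h g v))" if "g \<in> carrier G" for g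
        using \<alpha>_cont[OF hv(1)[OF that v]] by simp
      fix Q and e :: real assume Q: "finite Q" "Q \<subseteq> X" "e > 0"
      obtain g where g: "g \<in> carrier G" "\<And>q. q \<in> Q \<Longrightarrow> \<bar>\<alpha> (\<phi> g q) v - \<alpha> (p q) v\<bar> < e"
        using enveloping_semigroup_approx[OF p \<alpha>_cont[OF v] Q] by blast
      have "\<bar>\<alpha> q (h g v) - \<alpha> (p q) v\<bar> < e" if "q \<in> Q" for q
        using g(2)[OF that] equiv[OF g(1) _ v, of q] Q(2) that by auto
      then show "\<exists>g\<in>carrier G. \<forall>q\<in>Q. \<bar>\<alpha> q (h g v) - \<alpha> (p q) v\<bar> < e" using g(1) by blast
    qed
    then obtain g a b where g': "\<forall>n::nat. g n \<in> carrier G" and ab: "a < b"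
      and ind': "\<forall>N \<epsilon>. \<exists>x\<in>X. \<forall>j<N. if \<epsilon> j then \<alpha> x (h (g j) v) \<le> a else b \<le> \<alpha> x (h (g j) v)"
      by (elim exE conjE) (rule that)
    have g: "g n \<in> carrier G" for n using g' by (rule spec)
    have ind: "\<exists>x\<in>X. \<forall>j<N. if \<epsilon> j then \<alpha> x (h (g j) v) \<le> a else b \<le> \<alpha> x (h (g j) v)" for N \<epsilon>
      by (rule ind'[THEN spec, THEN spec])
    define w where "w j = h (g j) v" for j
    have w: "w j \<in> carrier V" "vnorm V (w j) \<le> vnorm V v" for j using hv[OF g v] by (simp_all add: w_def)
    have lin: "\<alpha> x (partial_sum w c n) = (\<Sum>k<n. c k * \<alpha> x (w k))" if x: "x \<in> X" for x c n
    proof (induction n)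
      case 0
      have "\<alpha> x (0 \<odot>\<^bsub>V\<^esub> \<zero>\<^bsub>V\<^esub>) = 0 * \<alpha> x \<zero>\<^bsub>V\<^esub>" using dual[OF x] by (auto simp: dual_space_def)
      then show ?case by (simp add: zero_smult)
    next
      case (Suc n)
      have "\<alpha> x (partial_sum w c n \<oplus>\<^bsub>V\<^esub> c n \<odot>\<^bsub>V\<^esub> w n) = \<alpha> x (partial_sum w c n) + \<alpha> x (c n \<odot>\<^bsub>V\<^esub> w n)"
        using dual[OF x] partial_sum_closed[where w = w, OF w, where c = c and n = n] real_smult_closed[OF w(1)] by (simp add: dual_space_def)
      moreover have "\<alpha> x (c n \<odot>\<^bsub>V\<^esub> w n) = c n * \<alpha> x (w n)" using dual[OF x] w(1) by (simp add: dual_space_def)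
      ultimately show ?case using Suc by simp
    qed
    have low: "(b - a) / (2 * C) * (\<Sum>k<n. \<bar>c k\<bar>) \<le> vnorm V (partial_sum w c n)" for c n
    proof -
      let ?u = "partial_sum w c n"
      have u: "?u \<in> carrier V" by (rule partial_sum_closed[where w = w, OF w])
      \<comment> \<open>The pattern at x follows the signs of the coefficients and the one at y is
        opposite, so each term of the difference gains at least (b - a) times the modulus of c k,
        wherever a and b lie. Both functionals are bounded by C, whence the factor 2 C.\<close>
      obtain x where x: "x \<in> X" "\<forall>j<n. if c j < 0 then \<alpha> x (w j) \<le> a else b \<le> \<alpha> x (w j)"
        using ind[of n "\<lambda>j. c j < 0"] by (auto simp: w_def)
      obtain y where y: "y \<in> X" "\<forall>j<n. if \<not> c j < 0 then \<alpha> y (w j) \<le> a else b \<le> \<alpha> y (w j)"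
        using ind[of n "\<lambda>j. \<not> c j < 0"] by (auto simp: w_def)
      have "(b - a) * (\<Sum>k<n. \<bar>c k\<bar>) \<le> (\<Sum>k<n. c k * \<alpha> x (w k) - c k * \<alpha> y (w k))"
        unfolding sum_distrib_left
      proof (rule sum_mono)
        fix k assume "k \<in> {..<n}"
        then have k: "k < n" by simp
        show "(b - a) * \<bar>c k\<bar> \<le> c k * \<alpha> x (w k) - c k * \<alpha> y (w k)"
        proof (cases "c k < 0")
          case True
          then have "b - a \<le> \<alpha> y (w k) - \<alpha> x (w k)" using x(2)[rule_format, OF k] y(2)[rule_format, OF k] by simp
          from mult_right_mono[OF this, of "- c k"] show ?thesis using True by (simp add: algebra_simps)
        next
          case False
          then have "b - a \<le> \<alpha> x (w k) - \<alpha> y (w k)" using x(2)[rule_format, OF k] y(2)[rule_format, OF k] by simp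
          from mult_right_mono[OF this, of "c k"] show ?thesis using False by (simp add: algebra_simps)
        qed
      qed
      also have "\<dots> = \<alpha> x ?u - \<alpha> y ?u" by (simp add: lin x(1) y(1) sum_subtractf)
      also have "\<dots> \<le> 2 * C * vnorm V ?u" using C[OF x(1) u] C[OF y(1) u] by (auto simp: abs_le_iff)
      finally show ?thesis using \<open>C > 0\<close> by (simp add: field_simps)
    qed
    have "(b - a) / (2 * C) > 0" using ab \<open>C > 0\<close> by simp
    from ell1_embedding[OF w banach this low] no show False by blast
  qed
  have several: "\<exists>U. openin (top_of_set X) U \<and> U \<inter> A \<noteq> {} \<and>
      (\<forall>v\<in>J. \<forall>y\<in>U \<inter> A. \<forall>z\<in>U \<inter> A. \<bar>\<alpha> (p y) v - \<alpha> (p z) v\<bar> < \<kappa>)"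
    if p: "p \<in> enveloping_semigroup G X \<phi>" and J: "finite J" "J \<subseteq> carrier V" and A: "A \<subseteq> X" "A \<noteq> {}" and "\<kappa> > 0" for p J A \<kappa>
    using J
  proof (induction J rule: finite_induct)
    case empty
    show ?case using A by (intro exI[of _ X]) auto
  next
    case (insert v J)
    then obtain U where U: "openin (top_of_set X) U" "U \<inter> A \<noteq> {}"
      "\<forall>v\<in>J. \<forall>y\<in>U \<inter> A. \<forall>z\<in>U \<inter> A. \<bar>\<alpha> (p y) v - \<alpha> (p z) v\<bar> < \<kappa>" by auto
    have v: "v \<in> carrier V" and sub: "U \<inter> A \<subseteq> X" using insert.prems A by auto
    obtain U' where U': "openin (top_of_set X) U'" "U' \<inter> (U \<inter> A) \<noteq> {}"
      "\<forall>y\<in>U' \<inter> (U \<inter> A). \<forall>z\<in>U' \<inter> (U \<inter> A). \<bar>\<alpha> (p y) v - \<alpha> (p z) v\<bar> < \<kappa>"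
      using single[OF p v sub U(2) \<open>\<kappa> > 0\<close>] by blast
    show ?case
    proof (intro exI[of _ "U' \<inter> U"] conjI)
      show "openin (top_of_set X) (U' \<inter> U)" using U'(1) U(1) by (rule openin_Int)
      show "U' \<inter> U \<inter> A \<noteq> {}" using U'(2) by (simp add: Int_assoc)
      show "\<forall>u\<in>insert v J. \<forall>y\<in>U' \<inter> U \<inter> A. \<forall>z\<in>U' \<inter> U \<inter> A. \<bar>\<alpha> (p y) u - \<alpha> (p z) u\<bar> < \<kappa>"
        using U'(3) U(3) by auto
    qed
  qed
  have inj: "inj_on \<alpha> X"
    using emb homeomorphic_imp_injective_map unfolding embedding_map_def by fastforce
  have sep: "x = y" if xy: "x \<in> X" "y \<in> X" and eq: "\<And>v. v \<in> carrier V \<Longrightarrow> \<alpha> x v = \<alpha> y v" for x y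
  proof -
    have "\<alpha> x \<in> extensional (carrier V)" "\<alpha> y \<in> extensional (carrier V)" using dual xy by (auto simp: dual_space_def)
    then have "\<alpha> x = \<alpha> y" using eq by (rule extensionalityI)
    then show ?thesis using inj xy by (simp add: inj_on_eq_iff)
  qed
  show ?thesis
    unfolding tame_system_def fragmented_map_def
  proof (intro ballI allI impI, elim conjE)
    fix p A and E :: "'x \<times> 'x \<Rightarrow> bool"
    assume p: "p \<in> enveloping_semigroup G X \<phi>" and A: "A \<subseteq> X" "A \<noteq> {}" and E: "eventually E uniformity"
    obtain e where e: "e > 0" "\<And>x y. dist x y < e \<Longrightarrow> E (x, y)"
      using E unfolding eventually_uniformity_metric by blast
    have pX: "p x \<in> X" if "x \<in> X" for x
      using p that unfolding enveloping_semigroup_def in_closure_of by auto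
    have "\<exists>J \<kappa>. finite J \<and> J \<subseteq> carrier V \<and> \<kappa> > 0 \<and>
        (\<forall>x\<in>X. \<forall>y\<in>X. (\<forall>v\<in>J. \<bar>\<alpha> x v - \<alpha> y v\<bar> < \<kappa>) \<longrightarrow> dist x y < e)"
      by (rule dist_small_of_separating[where f = "\<lambda>v x. \<alpha> x v", OF X _ _ e(1)]) (use \<alpha>_cont sep in auto)
    then obtain J \<kappa> where J: "finite J" "J \<subseteq> carrier V" "\<kappa> > 0"
      and small: "\<forall>x\<in>X. \<forall>y\<in>X. (\<forall>v\<in>J. \<bar>\<alpha> x v - \<alpha> y v\<bar> < \<kappa>) \<longrightarrow> dist x y < e" by blast
    obtain U where U: "openin (top_of_set X) U" "U \<inter> A \<noteq> {}"
      "\<forall>v\<in>J. \<forall>y\<in>U \<inter> A. \<forall>z\<in>U \<inter> A. \<bar>\<alpha> (p y) v - \<alpha> (p z) v\<bar> < \<kappa>"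
      using several[OF p J(1,2) A J(3)] by blast
    have "E (p y, p z)" if "y \<in> U \<inter> A" "z \<in> U \<inter> A" for y z
    proof (rule e(2))
      have "p y \<in> X" "p z \<in> X" using pX that A(1) by auto
      then show "dist (p y) (p z) < e" using small U(3) that by blast
    qed
    then show "\<exists>U. openin (top_of_set X) U \<and> U \<inter> A \<noteq> {} \<and> (\<forall>y\<in>p ` (U \<inter> A). \<forall>z\<in>p ` (U \<inter> A). E (y, z))"
      using U(1,2) by (intro exI[of _ U]) auto
  qed
qed


section \<open>The main theorem\<close>

text \<open>
  The empty system is represented on the space of the one-point system, since \<open>metric_G_space\<close>
  requires a point.
\<close>

lemma one_point_G_space:
  assumes "topological_group G T"
  shows "G_space G T {x0} (\<lambda>g. \<lambda>x\<in>{x0}. x0)"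
  unfolding G_space_def
proof
  interpret topological_group G T by (rule assms)
  have bij: "(\<lambda>x\<in>{x0}. x0) \<in> Bij {x0}"
    by (auto simp: Bij_def bij_betw_def)
  have "(\<lambda>g. \<lambda>x\<in>{x0}. x0) \<in> hom G (BijGroup {x0})"
    using bij by (auto simp: hom_def BijGroup_def compose_def fun_eq_iff)
  then show "group_action G {x0} (\<lambda>g. \<lambda>x\<in>{x0}. x0)"
    by (intro group_action.intro group_hom.intro group_hom_axioms.intro group_BijGroup is_group)
  have "continuous_map (prod_topology T (top_of_set {x0})) (top_of_set {x0}) (\<lambda>_. x0)"
    by simp
  then show "continuous_map (prod_topology T (top_of_set {x0})) (top_of_set {x0}) (\<lambda>(g, x). (\<lambda>x\<in>{x0}. x0) x)"
    by (rule continuous_map_eq) auto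
qed

lemma one_point_tame:
  fixes x0 :: "'x::uniform_space" shows "tame_system G {x0} \<phi>"
  unfolding tame_system_def fragmented_map_def
proof (intro ballI allI impI, elim conjE)
  fix p A and E :: "'x \<times> 'x \<Rightarrow> bool"
  assume "A \<subseteq> {x0}" "A \<noteq> {}" and E: "eventually E uniformity"
  then have "A = {x0}" by blast
  moreover have "E (y, y)" for y using E uniformity_refl by blast
  ultimately show "\<exists>U. openin (top_of_set {x0}) U \<and> U \<inter> A \<noteq> {} \<and> (\<forall>y\<in>p ` (U \<inter> A). \<forall>z\<in>p ` (U \<inter> A). E (y, z))"
    by (intro exI[of _ "{x0}"]) auto
qed

text \<open>The conditions on \<alpha> become vacuous; the space and the continuous co-homomorphism
  into its isometries are what is taken from the given representation.\<close>

lemma representable_empty: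
  fixes X :: "'x::topological_space set" and V :: "('v, 'k) normed_module_scheme"
  assumes "separable_rosenthal_representation_space G T X \<phi> V"
  shows "separable_rosenthal_representation_space G T ({} :: 'x set) \<psi> V"
proof -
  have emb: "embedding_map (top_of_set {}) (weak_star_topology V) \<alpha>" for \<alpha> :: "'x \<Rightarrow> 'v \<Rightarrow> real"
    unfolding embedding_map_def by (simp add: homeomorphic_map_def quotient_map_def)
  obtain h \<alpha> where "continuous_representation G T X \<phi> V h \<alpha>"
    using assms unfolding separable_rosenthal_representation_space_def faithfully_representable_on_def
    by (elim conjE exE)
  then have "continuous_representation G T {} \<psi> V h \<alpha>"
    by (simp add: continuous_representation_def norm_bounded_functionals_def)
  then show ?thesis
    using assms emb[of \<alpha>] unfolding separable_rosenthal_representation_space_def faithfully_representable_on_def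
    by (elim conjE) (intro conjI exI[of _ h] exI[of _ \<alpha>])
qed

text \<open>The second conjunct extends the implication to tameness from the fixed carrier type of
  the existential to Banach spaces over an arbitrary one.\<close>

theorem theorem1p3:
  fixes G :: "('g, 'm) monoid_scheme" and T :: "'g topology"
    and X :: "'x::metric_space set" and \<phi> :: "'g \<Rightarrow> 'x \<Rightarrow> 'x"
  assumes "topological_group G T"
    and "compact X"
    and "G_space G T X \<phi>"
  shows "(tame_system G X \<phi> \<longleftrightarrow>
      (\<exists>V :: (nat \<Rightarrow> real) normed_module. separable_rosenthal_representation_space G T X \<phi> V)) \<and>
    (\<forall>V :: 'v normed_module. separable_rosenthal_representation_space G T X \<phi> V \<longrightarrow>
      tame_system G X \<phi>)"
proof -
  have ex: "\<exists>V :: (nat \<Rightarrow> real) normed_module. separable_rosenthal_representation_space G T Y \<psi> V"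
    if Y: "compact Y" "Y \<noteq> {}" "G_space G T Y \<psi>" "tame_system G Y \<psi>"
    for Y :: "'x set" and \<psi>
  proof -
    obtain d :: "nat \<Rightarrow> 'x" where d: "range d \<subseteq> Y" "Y \<subseteq> closure (range d)"
      using compact_dense_sequence[OF Y(1,2)] by blast
    interpret metric_G_space Y d G T \<psi>
      by (intro metric_G_space.intro dense_sequence.intro metric_G_space_axioms.intro assms(1) Y) (use d in auto)
    show ?thesis using separable_rosenthal_representation[OF Y(4)] by blast
  qed
  have main: "\<exists>V :: (nat \<Rightarrow> real) normed_module. separable_rosenthal_representation_space G T X \<phi> V"
    if tame: "tame_system G X \<phi>"
  proof (cases "X = {}")
    case True
    have "\<exists>V :: (nat \<Rightarrow> real) normed_module.
        separable_rosenthal_representation_space G T {undefined :: 'x} (\<lambda>g. \<lambda>x\<in>{undefined}. undefined) V"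
      by (rule ex[OF _ _ one_point_G_space[OF assms(1)] one_point_tame]) simp_all
    then show ?thesis unfolding True by (elim exE) (rule exI, erule representable_empty)
  next
    case False
    show ?thesis by (rule ex[OF assms(2) False assms(3) tame])
  qed
  show ?thesis
  proof (intro conjI iffI allI impI)
    assume "\<exists>V :: (nat \<Rightarrow> real) normed_module. separable_rosenthal_representation_space G T X \<phi> V"
    then show "tame_system G X \<phi>" by (elim exE) (rule representable_imp_tame[OF assms(1,2)])
  next
    fix V :: "'v normed_module" assume "separable_rosenthal_representation_space G T X \<phi> V"
    then show "tame_system G X \<phi>" by (rule representable_imp_tame[OF assms(1,2)])
  qed (rule main)
qed


end
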